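(* Let $d\in\mathbb{N}$ and let $\varphi$ be the random dynamical system on $[0,1]^d$ generated by the SDE $\mathrm{d}X^i(t)=X^i(t)(1-X^i(t))\,\mathrm{d}W^i(t)$, $i=1,\dots,d$ (see context). For any $m\in\{0,\dots,d-1\}$, the (deterministic) set $H^m$, the union of all $m$-dimensional faces of $[0,1]^d$, is the minimal forward $\Delta$-attractor and the minimal weak $\Delta$-attractor of $\varphi$ on $[0,1]^d$ for every $\Delta\in[m,m+1)$.
   Context: RDS setting. A metric dynamical system (MDS) is a probability space $(\Omega,\mathcal F,\mathbb P)$ with a jointly measurable family of maps $(\vartheta_t)_{t\in\mathbb R}$ preserving $\mathbb P$, with $\vartheta_0=\mathrm{Id}$ and $\vartheta_{t+s}=\vartheta_t\circ\vartheta_s$. A (two-sided) random dynamical system (RDS) on a metric space $(E,\mathrm d)$ is an MDS together with a measurable map $\varphi:\mathbb R\times\Omega\times E\to E$, $(t,\omega,x)\mapsto\varphi(t,\omega)x$, with $\varphi(0,\omega)=\mathrm{Id}_E$ and $\varphi(t+s,\omega)=\varphi(t,\vartheta_s\omega)\circ\varphi(s,\omega)$. The system. $E=[0,1]^d$ with the metric $\mathrm d$ induced by the uniform norm; $(\Omega,\mathcal F,\mathbb P)$ is the $d$-dimensional two-sided Wiener space, $W=(W^1,\dots,W^d)$ the two-sided $d$-dimensional Wiener process, and $(\vartheta_t\omega)_s=\omega_{s+t}-\omega_t$ the Wiener shift. $\varphi$ is the two-sided RDS on $[0,1]^d$, jointly continuous in time and space, such that for $t\ge 0$, $t\mapsto\varphi(t,\cdot)x$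 solves the Itô SDE $\mathrm dX^i(t)=X^i(t)(1-X^i(t))\,\mathrm dW^i(t)$, $i=1,\dots,d$, with $X(0)=x$. It acts coordinatewise, $\varphi(t,\omega)x=(\varphi^1(t,\omega)x^1,\dots,\varphi^d(t,\omega)x^d)$, each $\varphi^i(t,\omega)$ being an increasing bijection of $[0,1]$. Attractors. For nonempty $A,B\subseteq E$, $B$ bounded, $\mathrm d(A,B)=\sup_{x\in A}\inf_{y\in B}\mathrm d(x,y)$. A compact random set is a map $A$ from $\Omega$ to subsets of $E$ with $A(\omega)$ compact for each $\omega$ and $\omega\mapsto \mathrm d(x,A(\omega))$ measurable for each $x\in E$; it is strictly $\varphi$-invariant if for every $t$, $\varphi(t,\omega)A(\omega)=A(\vartheta_t\omega)$ for $\mathbb P$-almost all $\omega$. For a nonempty family $\mathcal C$ of subsets of $E$, a strictly $\varphi$-invariant compact random set $A$ is a forward (resp. weak) $\mathcal C$-attractor if for every $C\in\mathcal C$, $\lim_{t\to\infty}\mathrm d(\varphi(t,\omega)C,A(\vartheta_t\omega))=0$ $\mathbb P$-a.s. (resp. in probability); events that may fail to be measurable are understood to contain / be contained in suitable measurable sets. For $\Delta\ge0$, a $\Delta$-attractor ($\Delta$-Hausdorff-attractor) is a $\mathcal C_\Delta$-attractor, where $\mathcal C_\Delta$ is the family of nonempty compact $K\subseteq E$ with Hausdorff dimension $\dim_H(K)\le\Delta$. A $\mathcal C$-attractor is minimal if it is contained ($\mathbb P$-almost surely) in any other $\mathcal C$-attractor of the same type (forward, weak). Faces. For $\alpha\in\{-1,0,1\}^d$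 let $\Gamma_\alpha=\{x\in[0,1]^d:\ \forall i,\ \alpha_i\ne0\Rightarrow x^i=(1+\alpha_i)/2\}$ and $\|\alpha\|=\sum_i|\alpha_i|$. For $m\le d$, $H^m=\bigcup_{\|\alpha\|=d-m}\Gamma_\alpha$. *)

theory Defs
  imports "HOL-Probability.Probability"
begin

section \<open>The cube and the uniform metric\<close>

text \<open>
  All distances are taken in the uniform norm, which on \<^typ>\<open>real ^ 'd\<close> is \<^const>\<open>infnorm\<close>
  (the \<^const>\<open>dist\<close> of that type is Euclidean). Both norms induce the same topology, so
  compactness, continuity and Borel sets are the library's.
\<close>

definition unit_cube :: "(real ^ 'd::finite) set" where
  "unit_cube = {x. \<forall>i. 0 \<le> x $ i \<and> x $ i \<le> 1}"

definition point_dist :: "'a::euclidean_space \<Rightarrow> 'a set \<Rightarrow> real" where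
  "point_dist x B = (INF y\<in>B. infnorm (x - y))"

definition semidist :: "'a::euclidean_space set \<Rightarrow> 'a set \<Rightarrow> real" where
  "semidist A B = (SUP x\<in>A. point_dist x B)"

text \<open>Meant for \<open>\<alpha>\<close> with values in \<open>{-1, 0, 1}\<close>.\<close>

definition face :: "('d \<Rightarrow> int) \<Rightarrow> (real ^ 'd::finite) set" where
  "face \<alpha> = {x \<in> unit_cube. \<forall>i. \<alpha> i \<noteq> 0 \<longrightarrow> x $ i = (1 + real_of_int (\<alpha> i)) / 2}"

definition skeleton :: "nat \<Rightarrow> (real ^ 'd::finite) set" where
  "skeleton m = \<Union> {face \<alpha> | \<alpha>. range \<alpha> \<subseteq> {-1, 0, 1} \<and>
                                   (\<Sum>i\<in>UNIV. \<bar>\<alpha> i\<bar>) = int CARD('d) - int m}"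


section \<open>Hausdorff dimension with respect to the uniform metric\<close>

definition inf_diam :: "'a::euclidean_space set \<Rightarrow> real" where
  "inf_diam U = (SUP (x, y)\<in>U \<times> U. infnorm (x - y))"

text \<open>
  The summand \<open>(diam U)\<^sup>s\<close>, with the usual conventions: 0 for the empty set, and \<open>0\<^sup>0 = 1\<close> for
  nonempty sets (whereas \<open>0 powr 0 = 0\<close> in the library).
\<close>

definition hausdorff_gauge :: "real \<Rightarrow> 'a::euclidean_space set \<Rightarrow> real" where
  "hausdorff_gauge s U = (if U = {} then 0 else if s = 0 then 1 else inf_diam U powr s)"

definition hausdorff_pre :: "real \<Rightarrow> real \<Rightarrow> 'a::euclidean_space set \<Rightarrow> ennreal" where
  "hausdorff_pre s \<delta> A =
     (INF U \<in> {U :: nat \<Rightarrow> 'a set. A \<subseteq> (\<Union>n. U n) \<and> (\<forall>n. \<forall>x\<in>U n. \<forall>y\<in>U n. infnorm (x - y) \<le> \<delta>)}.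
        \<Sum>n. ennreal (hausdorff_gauge s (U n)))"

definition hausdorff_measure :: "real \<Rightarrow> 'a::euclidean_space set \<Rightarrow> ennreal" where
  "hausdorff_measure s A = (SUP \<delta>\<in>{0<..}. hausdorff_pre s \<delta> A)"

definition hausdorff_dim :: "'a::euclidean_space set \<Rightarrow> ereal" where
  "hausdorff_dim A = (INF s \<in> {s. 0 \<le> s \<and> hausdorff_measure s A = 0}. ereal s)"


section \<open>Random dynamical systems\<close>

definition metric_dynamical_system :: "'w measure \<Rightarrow> (real \<Rightarrow> 'w \<Rightarrow> 'w) \<Rightarrow> bool" where
  "metric_dynamical_system M \<theta> \<longleftrightarrow>
     prob_space M \<and>
     (\<lambda>(t, \<omega>). \<theta> t \<omega>) \<in> (borel \<Otimes>\<^sub>M M) \<rightarrow>\<^sub>M M \<and>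
     (\<forall>t. distr M M (\<theta> t) = M) \<and>
     (\<forall>\<omega>\<in>space M. \<theta> 0 \<omega> = \<omega>) \<and>
     (\<forall>t s. \<forall>\<omega>\<in>space M. \<theta> (t + s) \<omega> = \<theta> t (\<theta> s \<omega>))"

definition random_dynamical_system ::
  "'w measure \<Rightarrow> (real \<Rightarrow> 'w \<Rightarrow> 'w) \<Rightarrow> 'a::topological_space set
    \<Rightarrow> (real \<Rightarrow> 'w \<Rightarrow> 'a \<Rightarrow> 'a) \<Rightarrow> bool" where
  "random_dynamical_system M \<theta> E \<phi> \<longleftrightarrow>
     metric_dynamical_system M \<theta> \<and>
     (\<lambda>(t, \<omega>, x). \<phi> t \<omega> x)
        \<in> (borel \<Otimes>\<^sub>M (M \<Otimes>\<^sub>M restrict_space borel E)) \<rightarrow>\<^sub>M restrict_space borel E \<and>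
     (\<forall>\<omega>\<in>space M. \<forall>x\<in>E. \<phi> 0 \<omega> x = x) \<and>
     (\<forall>t s. \<forall>\<omega>\<in>space M. \<forall>x\<in>E. \<phi> (t + s) \<omega> x = \<phi> t (\<theta> s \<omega>) (\<phi> s \<omega> x))"


section \<open>Attractors\<close>

definition compact_random_set ::
  "'w measure \<Rightarrow> 'a::euclidean_space set \<Rightarrow> ('w \<Rightarrow> 'a set) \<Rightarrow> bool" where
  "compact_random_set M E A \<longleftrightarrow>
     (\<forall>\<omega>\<in>space M. A \<omega> \<subseteq> E \<and> A \<omega> \<noteq> {} \<and> compact (A \<omega>)) \<and>
     (\<forall>x\<in>E. (\<lambda>\<omega>. point_dist x (A \<omega>)) \<in> borel_measurable M)"

definition strictly_invariant ::
  "'w measure \<Rightarrow> (real \<Rightarrow> 'w \<Rightarrow> 'w) \<Rightarrow> (real \<Rightarrow> 'w \<Rightarrow> 'a \<Rightarrow> 'a) \<Rightarrow> ('w \<Rightarrow> 'a set) \<Rightarrow> bool" where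
  "strictly_invariant M \<theta> \<phi> A \<longleftrightarrow> (\<forall>t. AE \<omega> in M. \<phi> t \<omega> ` A \<omega> = A (\<theta> t \<omega>))"

definition forward_attractor ::
  "'w measure \<Rightarrow> (real \<Rightarrow> 'w \<Rightarrow> 'w) \<Rightarrow> 'a::euclidean_space set \<Rightarrow> (real \<Rightarrow> 'w \<Rightarrow> 'a \<Rightarrow> 'a)
    \<Rightarrow> 'a set set \<Rightarrow> ('w \<Rightarrow> 'a set) \<Rightarrow> bool" where
  "forward_attractor M \<theta> E \<phi> \<C> A \<longleftrightarrow>
     compact_random_set M E A \<and> strictly_invariant M \<theta> \<phi> A \<and>
     (\<forall>C\<in>\<C>. AE \<omega> in M. ((\<lambda>t. semidist (\<phi> t \<omega> ` C) (A (\<theta> t \<omega>))) \<longlongrightarrow> 0) at_top)"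

text \<open>Outer measure, since the distance need not be measurable in \<open>\<omega>\<close>.\<close>

definition weak_attractor ::
  "'w measure \<Rightarrow> (real \<Rightarrow> 'w \<Rightarrow> 'w) \<Rightarrow> 'a::euclidean_space set \<Rightarrow> (real \<Rightarrow> 'w \<Rightarrow> 'a \<Rightarrow> 'a)
    \<Rightarrow> 'a set set \<Rightarrow> ('w \<Rightarrow> 'a set) \<Rightarrow> bool" where
  "weak_attractor M \<theta> E \<phi> \<C> A \<longleftrightarrow>
     compact_random_set M E A \<and> strictly_invariant M \<theta> \<phi> A \<and>
     (\<forall>C\<in>\<C>. \<forall>\<epsilon>>0. ((\<lambda>t. outer_measure_of M
          {\<omega>\<in>space M. semidist (\<phi> t \<omega> ` C) (A (\<theta> t \<omega>)) > \<epsilon>}) \<longlongrightarrow> 0) at_top)"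

definition hausdorff_family :: "'a::euclidean_space set \<Rightarrow> real \<Rightarrow> 'a set set" where
  "hausdorff_family E \<Delta> = {K. K \<noteq> {} \<and> K \<subseteq> E \<and> compact K \<and> hausdorff_dim K \<le> ereal \<Delta>}"

definition minimal_attractor ::
  "'w measure \<Rightarrow> (('w \<Rightarrow> 'a set) \<Rightarrow> bool) \<Rightarrow> ('w \<Rightarrow> 'a set) \<Rightarrow> bool" where
  "minimal_attractor M is_attractor A \<longleftrightarrow>
     is_attractor A \<and> (\<forall>B. is_attractor B \<longrightarrow> (AE \<omega> in M. A \<omega> \<subseteq> B \<omega>))"


section \<open>The Wiener space\<close>

text \<open>
  Continuous two-sided paths starting at 0, with the \<open>\<sigma>\<close>-algebra generated by the evaluations
  (which is the Borel \<open>\<sigma>\<close>-algebra of locally uniform convergence).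
\<close>

definition path_space :: "(real \<Rightarrow> real ^ 'd::finite) measure" where
  "path_space = restrict_space (\<Pi>\<^sub>M t\<in>UNIV. borel) {\<omega>. continuous_on UNIV \<omega> \<and> \<omega> 0 = 0}"

definition wiener_measure :: "(real \<Rightarrow> real ^ 'd::finite) measure \<Rightarrow> bool" where
  "wiener_measure P \<longleftrightarrow>
     prob_space P \<and> space P = space path_space \<and> sets P = sets path_space \<and>
     (\<forall>s t i. s < t \<longrightarrow>
        distributed P lborel (\<lambda>\<omega>. \<omega> t $ i - \<omega> s $ i) (normal_density 0 (sqrt (t - s)))) \<and>
     (\<forall>n (\<tau> :: nat \<Rightarrow> real). strict_mono \<tau> \<longrightarrow>
        prob_space.indep_vars P (\<lambda>_. borel)
          (\<lambda>(k, i) \<omega>. \<omega> (\<tau> (Suc k)) $ i - \<omega> (\<tau> k) $ i) ({..<n} \<times> UNIV))"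

definition wiener_shift :: "real \<Rightarrow> (real \<Rightarrow> 'b::real_normed_vector) \<Rightarrow> (real \<Rightarrow> 'b)" where
  "wiener_shift t \<omega> = (\<lambda>s. \<omega> (s + t) - \<omega> t)"

text \<open>The filtration of the Wiener process on \<open>[0, \<infinity>)\<close>, augmented by the null sets.\<close>

definition wiener_filtration ::
  "(real \<Rightarrow> real ^ 'd::finite) measure \<Rightarrow> real \<Rightarrow> (real \<Rightarrow> real ^ 'd) measure" where
  "wiener_filtration P t = sigma (space P)
     ({(\<lambda>\<omega>. \<omega> s) -` B \<inter> space P | s B. 0 \<le> s \<and> s \<le> t \<and> B \<in> sets borel} \<union> null_sets P)"


section \<open>Ito integral and the stochastic differential equation\<close>

text \<open>
  A bounded elementary integrand on \<open>[0, T]\<close> has the value \<open>\<xi> k\<close> on \<open>(\<tau> k, \<tau> (k + 1)]\<close>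
  for \<open>k < n\<close>, where \<open>\<xi> k\<close> is measurable with respect to the past of \<open>\<tau> k\<close>.
\<close>

definition elementary_integrand ::
  "(real \<Rightarrow> 'w measure) \<Rightarrow> real \<Rightarrow> nat \<Rightarrow> (nat \<Rightarrow> real) \<Rightarrow> (nat \<Rightarrow> 'w \<Rightarrow> real) \<Rightarrow> bool" where
  "elementary_integrand F T n \<tau> \<xi> \<longleftrightarrow>
     (\<forall>k\<le>n. 0 \<le> \<tau> k \<and> \<tau> k \<le> T) \<and> (\<forall>k<n. \<tau> k \<le> \<tau> (Suc k)) \<and>
     (\<forall>k<n. \<xi> k \<in> borel_measurable (F (\<tau> k)) \<and> (\<exists>c. \<forall>\<omega>\<in>space (F (\<tau> k)). \<bar>\<xi> k \<omega>\<bar> \<le> c))"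

definition elementary_process ::
  "nat \<Rightarrow> (nat \<Rightarrow> real) \<Rightarrow> (nat \<Rightarrow> 'w \<Rightarrow> real) \<Rightarrow> real \<Rightarrow> 'w \<Rightarrow> real" where
  "elementary_process n \<tau> \<xi> s \<omega> = (\<Sum>k<n. \<xi> k \<omega> * indicator {\<tau> k<..\<tau> (Suc k)} s)"

definition elementary_integral ::
  "(real \<Rightarrow> 'w \<Rightarrow> real) \<Rightarrow> nat \<Rightarrow> (nat \<Rightarrow> real) \<Rightarrow> (nat \<Rightarrow> 'w \<Rightarrow> real) \<Rightarrow> 'w \<Rightarrow> real" where
  "elementary_integral B n \<tau> \<xi> \<omega> = (\<Sum>k<n. \<xi> k \<omega> * (B (\<tau> (Suc k)) \<omega> - B (\<tau> k) \<omega>))"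

text \<open>
  \<open>I\<close> is (a version of) the Ito integral of \<open>H\<close> against the Brownian motion \<open>B\<close> over \<open>[0, T]\<close>:
  the \<open>L\<^sup>2\<close>-limit of the integrals of elementary integrands that approximate \<open>H\<close> in
  \<open>L\<^sup>2([0, T] \<times> \<Omega>)\<close>. By the Ito isometry it is unique up to null sets.
\<close>

definition has_ito_integral ::
  "'w measure \<Rightarrow> (real \<Rightarrow> 'w measure) \<Rightarrow> (real \<Rightarrow> 'w \<Rightarrow> real) \<Rightarrow> real
    \<Rightarrow> (real \<Rightarrow> 'w \<Rightarrow> real) \<Rightarrow> ('w \<Rightarrow> real) \<Rightarrow> bool" where
  "has_ito_integral M F B T H I \<longleftrightarrow>
     (\<lambda>(s, \<omega>). H s \<omega>) \<in> borel_measurable (restrict_space borel {0..T} \<Otimes>\<^sub>M M) \<and>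
     (\<forall>s\<in>{0..T}. H s \<in> borel_measurable (F s)) \<and>
     I \<in> borel_measurable M \<and>
     (\<exists>(n :: nat \<Rightarrow> nat) \<tau> \<xi>.
        (\<forall>j. elementary_integrand F T (n j) (\<tau> j) (\<xi> j)) \<and>
        (\<lambda>j. \<integral>\<^sup>+ \<omega>. (\<integral>\<^sup>+ s\<in>{0..T}. ennreal ((elementary_process (n j) (\<tau> j) (\<xi> j) s \<omega> - H s \<omega>)\<^sup>2)
               \<partial>lborel) \<partial>M) \<longlonglongrightarrow> 0 \<and>
        (\<lambda>j. \<integral>\<^sup>+ \<omega>. ennreal ((elementary_integral B (n j) (\<tau> j) (\<xi> j) \<omega> - I \<omega>)\<^sup>2) \<partial>M) \<longlonglongrightarrow> 0)"

text \<open>\<open>X\<close> is a continuous adapted solution on \<open>[0, \<infinity>)\<close> of \<open>dX = \<sigma>(X) dB\<close>, \<open>X(0) = x\<close>.\<close>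

definition solves_ito_sde ::
  "'w measure \<Rightarrow> (real \<Rightarrow> 'w measure) \<Rightarrow> (real \<Rightarrow> 'w \<Rightarrow> real) \<Rightarrow> (real \<Rightarrow> real) \<Rightarrow> real
    \<Rightarrow> (real \<Rightarrow> 'w \<Rightarrow> real) \<Rightarrow> bool" where
  "solves_ito_sde M F B \<sigma> x X \<longleftrightarrow>
     (\<forall>t\<ge>0. X t \<in> borel_measurable (F t)) \<and>
     (AE \<omega> in M. X 0 \<omega> = x) \<and>
     (AE \<omega> in M. continuous_on {0..} (\<lambda>t. X t \<omega>)) \<and>
     (\<forall>t\<ge>0. has_ito_integral M F B t (\<lambda>s \<omega>. \<sigma> (X s \<omega>)) (\<lambda>\<omega>. X t \<omega> - x))"

text \<open>
  The equation is imposed for nonnegative times only; the cocycle property determines \<open>\<phi>\<close> at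
  negative times.
\<close>

definition sde_flow ::
  "(real \<Rightarrow> real ^ 'd::finite) measure
    \<Rightarrow> (real \<Rightarrow> (real \<Rightarrow> real ^ 'd) \<Rightarrow> real ^ 'd \<Rightarrow> real ^ 'd) \<Rightarrow> bool" where
  "sde_flow P \<phi> \<longleftrightarrow>
     random_dynamical_system P wiener_shift unit_cube \<phi> \<and>
     (\<forall>\<omega>\<in>space P. continuous_on (UNIV \<times> unit_cube) (\<lambda>(t, x). \<phi> t \<omega> x)) \<and>
     (\<forall>x\<in>unit_cube. \<forall>i. solves_ito_sde P (wiener_filtration P) (\<lambda>t \<omega>. \<omega> t $ i)
        (\<lambda>y. y * (1 - y)) (x $ i) (\<lambda>t \<omega>. \<phi> t \<omega> x $ i)) \<and>
     (\<forall>t. \<forall>\<omega>\<in>space P. \<forall>i. \<exists>f. bij_betw f {0..1} {0..1} \<and> strict_mono_on {0..1} f \<and>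
        (\<forall>x\<in>unit_cube. \<phi> t \<omega> x $ i = f (x $ i)))"

end

theory Submission
  imports Defs
begin

text \<open>
  Every coordinate is a martingale \<open>X\<close> with values in \<open>[0, 1]\<close>, and by the Ito isometry its variance
  grows at the rate \<open>E ((X (1 - X))\<^sup>2)\<close>. Since the variance stays bounded, \<open>X\<close> can only settle at 0 or at 1.
  The solution is increasing in its starting point, so for each coordinate \<open>i\<close> there is a random critical
  point \<open>c\<^sub>i\<close>: a start below \<open>c\<^sub>i\<close> is driven to 0, a start above \<open>c\<^sub>i\<close> is driven to 1. The probability
  that a start at \<open>b\<close> ends in 1 is its mean \<open>b\<close>, hence \<open>c\<^sub>i\<close> is uniformly distributed on \<open>[0, 1]\<close>, and
  the critical points of different coordinates are independent because the coordinates are driven by independent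
  Wiener processes.
  
  A point \<open>x\<close> fails to approach the \<open>m\<close>-skeleton only if at least \<open>m + 1\<close> of its coordinates coincide
  with the critical points. For a fixed set \<open>I\<close> of \<open>m + 1\<close> coordinates, a box of side \<open>r\<close> contains a point
  \<open>x\<close> with \<open>x\<^sub>i = c\<^sub>i\<close> for all \<open>i \<in> I\<close> with probability at most \<open>r ^ (m + 1)\<close>, so a compact set \<open>K\<close> of Hausdorff dimension less
  than \<open>m + 1\<close>, which has covers with arbitrarily small total \<open>r ^ (m + 1)\<close>, almost surely contains none
  (\<open>AE_critical_avoids\<close>). Compactness turns the convergence of the points of \<open>K\<close> into uniform convergence
  (\<open>skeleton_attracts\<close>); almost sure convergence implies convergence in probability.
  
  Minimality is soft. An \<open>m\<close>-dimensional face \<open>C\<close> has Hausdorff dimension at most \<open>m\<close> and is mapped onto itself,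
  so the distance from \<open>C\<close> to \<open>B (\<vartheta>\<^sub>t \<omega>)\<close> tends to 0 in probability for any attractor \<open>B\<close>. As the
  shift preserves the measure, the law of this distance does not depend on \<open>t\<close>, hence it vanishes and
  \<open>C \<subseteq> B\<close> almost surely (\<open>weakly_attracted_face_subset\<close>).
  
  The stochastic calculus is derived from the definition of the integral as a mean square limit:
  \<open>flow_increment_isometry\<close> and \<open>flow_martingale\<close>. Convergence to the endpoints comes from the nonnegative
  supermartingale \<open>X (1 - X)\<close>, whose mean at time \<open>t\<close> is at most \<open>1 / sqrt t\<close>, and a maximal inequality.
  Independence of the coordinates is seen on an Euler scheme, which is a function of the increments of a single
  coordinate of the Wiener process and converges in mean square to the solution.
\<close>

section \<open>The cube, its faces and its skeletons\<close>

lemma unit_cubeD: "x \<in> unit_cube \<Longrightarrow> 0 \<le> x $ i" "x \<in> unit_cube \<Longrightarrow> x $ i \<le> 1"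
  by (auto simp: unit_cube_def)

text \<open>
  All estimates in the uniform norm are carried out componentwise through this equivalence.
\<close>

lemma infnorm_vec_le_iff:
  fixes x :: "real ^ 'd::finite"
  shows "infnorm x \<le> c \<longleftrightarrow> (\<forall>i. \<bar>x $ i\<bar> \<le> c)"
proof -
  have "infnorm x = Sup (range (\<lambda>i. \<bar>x $ i\<bar>))"
    unfolding infnorm_cart by (simp add: full_SetCompr_eq)
  also have "\<dots> \<le> c \<longleftrightarrow> (\<forall>i. \<bar>x $ i\<bar> \<le> c)"
    by (subst cSup_eq_Max) auto
  finally show ?thesis .
qed

lemma unit_cube_eq_cbox: "unit_cube = cbox (0 :: real ^ 'd::finite) 1"
  by (auto simp: unit_cube_def mem_box_cart)

lemma compact_unit_cube: "compact (unit_cube :: (real ^ 'd::finite) set)"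
  by (simp add: unit_cube_eq_cbox)

lemma infnorm_cube_diff_le:
  assumes "x \<in> unit_cube" "y \<in> unit_cube" shows "infnorm (x - y) \<le> 1"
  unfolding infnorm_vec_le_iff
proof
  fix i show "\<bar>(x - y) $ i\<bar> \<le> 1"
    using unit_cubeD[OF assms(1), of i] unit_cubeD[OF assms(2), of i] by (simp add: abs_le_iff)
qed

lemma bdd_below_infnorm: "bdd_below ((\<lambda>y. infnorm (x - y)) ` B)"
  by (rule bdd_belowI2[of _ 0]) (rule infnorm_pos_le)

lemma point_dist_nonneg: "B \<noteq> {} \<Longrightarrow> 0 \<le> point_dist x B"
  unfolding point_dist_def by (rule cINF_greatest) (auto simp: infnorm_pos_le)

lemma point_dist_le: "y \<in> B \<Longrightarrow> point_dist x B \<le> infnorm (x - y)"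
  unfolding point_dist_def by (rule cINF_lower[OF bdd_below_infnorm])

lemma point_dist_triangle:
  assumes "B \<noteq> {}" shows "point_dist x B \<le> infnorm (x - y) + point_dist y B"
proof -
  have "point_dist x B - infnorm (x - y) \<le> infnorm (y - z)" if "z \<in> B" for z
    using point_dist_le[OF that, of x] infnorm_triangle[of "x - y" "y - z"] by simp
  then have "point_dist x B - infnorm (x - y) \<le> point_dist y B"
    unfolding point_dist_def[of y] by (intro cINF_greatest assms)
  then show ?thesis by simp
qed

lemma continuous_point_dist:
  fixes B :: "'a::euclidean_space set"
  assumes "B \<noteq> {}" shows "continuous_on S (\<lambda>x. point_dist x B)"
proof -
  have lip: "\<bar>point_dist x B - point_dist y B\<bar> \<le> dist x y" for x y
  proof -
    have "point_dist x B - point_dist y B \<le> dist x y"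
      using point_dist_triangle[OF assms, of x y] infnorm_le_norm[of "x - y"] by (simp add: dist_norm)
    moreover have "point_dist y B - point_dist x B \<le> dist x y"
      using point_dist_triangle[OF assms, of y x] infnorm_le_norm[of "y - x"]
      by (simp add: dist_norm norm_minus_commute)
    ultimately show ?thesis by (simp add: abs_le_iff)
  qed
  show ?thesis
    unfolding continuous_on_iff
    by (metis dist_real_def lip order_le_less_trans dist_commute)
qed

lemma point_dist_eq_0_imp_mem:
  fixes B :: "'a::euclidean_space set"
  assumes "compact B" "B \<noteq> {}" "point_dist x B \<le> 0" shows "x \<in> B"
proof -
  have "continuous_on B (\<lambda>y. infnorm (x - y))" by (intro continuous_intros)
  then obtain y where y: "y \<in> B" "\<And>z. z \<in> B \<Longrightarrow> infnorm (x - y) \<le> infnorm (x - z)"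
    using continuous_attains_inf[OF assms(1,2)] by blast
  have "infnorm (x - y) \<le> point_dist x B"
    unfolding point_dist_def by (intro cINF_greatest assms y)
  then have "infnorm (x - y) = 0" using assms(3) infnorm_pos_le[of "x - y"] by linarith
  then show ?thesis using y(1) by (simp add: infnorm_eq_0)
qed

lemma bdd_above_point_dist:
  assumes "A \<subseteq> unit_cube" "B \<subseteq> unit_cube" "B \<noteq> {}"
  shows "bdd_above ((\<lambda>x. point_dist x B) ` A)"
proof -
  obtain b where b: "b \<in> B" using assms by auto
  show ?thesis
  proof (rule bdd_aboveI2[of _ _ 1])
    fix x assume "x \<in> A"
    then show "point_dist x B \<le> 1"
      using point_dist_le[OF b, of x] infnorm_cube_diff_le[of x b] assms b by (meson order_trans subsetD)
  qed
qed

lemma semidist_le_iff: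
  assumes "A \<subseteq> unit_cube" "B \<subseteq> unit_cube" "A \<noteq> {}" "B \<noteq> {}"
  shows "semidist A B \<le> c \<longleftrightarrow> (\<forall>x\<in>A. point_dist x B \<le> c)"
  unfolding semidist_def by (rule cSUP_le_iff[OF assms(3) bdd_above_point_dist]) (use assms in auto)

lemma semidist_nonneg:
  assumes "A \<subseteq> unit_cube" "B \<subseteq> unit_cube" "A \<noteq> {}" "B \<noteq> {}"
  shows "0 \<le> semidist A B"
proof -
  obtain x where "x \<in> A" using assms(3) by auto
  then have "point_dist x B \<le> semidist A B"
    using semidist_le_iff[OF assms, of "semidist A B"] by simp
  then show ?thesis using point_dist_nonneg[OF assms(4), of x] by linarith
qed

lemma face_subset_cube: "face \<alpha> \<subseteq> unit_cube"
  by (auto simp: face_def)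

lemma compact_face: "compact (face \<alpha> :: (real ^ 'd::finite) set)"
proof -
  have "face \<alpha> = unit_cube \<inter> (\<Inter>i\<in>{i. \<alpha> i \<noteq> 0}. {x. x $ i = (1 + real_of_int (\<alpha> i)) / 2})"
    by (auto simp: face_def)
  moreover have "closed {x :: real ^ 'd. x $ i = c}" for i c
    by (intro closed_Collect_eq continuous_intros)
  ultimately show ?thesis
    by (simp only:) (intro compact_Int_closed compact_unit_cube closed_INT ballI, blast)
qed

lemma face_nonempty:
  assumes "range \<alpha> \<subseteq> {-1,0,1}" shows "face \<alpha> \<noteq> ({} :: (real ^ 'd::finite) set)"
proof -
  have "0 \<le> (1 + real_of_int (\<alpha> i)) / 2 \<and> (1 + real_of_int (\<alpha> i)) / 2 \<le> 1" for i
  proof -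
    have "\<alpha> i \<in> {-1,0,1}" using assms by auto
    then show ?thesis by auto
  qed
  then have "(\<chi> i. (1 + real_of_int (\<alpha> i)) / 2) \<in> face \<alpha>"
    by (auto simp: face_def unit_cube_def)
  then show ?thesis by blast
qed

lemma finite_sign_vectors: "finite {\<alpha> :: 'd::finite \<Rightarrow> int. range \<alpha> \<subseteq> {-1,0,1}}"
proof -
  have "{\<alpha> :: 'd \<Rightarrow> int. range \<alpha> \<subseteq> {-1,0,1}} = UNIV \<rightarrow>\<^sub>E {-1,0,1}" by (auto simp: PiE_UNIV_domain)
  then show ?thesis by (simp add: finite_PiE)
qed

lemma skeleton_eq: "skeleton m = (\<Union>\<alpha>\<in>{\<alpha>. range \<alpha> \<subseteq> {-1, 0, 1} \<and>
     (\<Sum>i\<in>UNIV. \<bar>\<alpha> i\<bar>) = int CARD('d) - int m}. face \<alpha> :: (real ^ 'd::finite) set)"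
  by (auto simp: skeleton_def)

lemma compact_skeleton: "compact (skeleton m :: (real ^ 'd::finite) set)"
  unfolding skeleton_eq
  by (rule compact_UN) (auto intro: compact_face finite_subset[OF _ finite_sign_vectors])

lemma skeleton_subset_cube: "skeleton m \<subseteq> unit_cube"
  unfolding skeleton_eq using face_subset_cube by blast

lemma sum_abs_sign_vector:
  assumes "range \<alpha> \<subseteq> {-1,0,1::int}"
  shows "(\<Sum>i\<in>UNIV. \<bar>\<alpha> i\<bar>) = int (card {i::'d::finite. \<alpha> i \<noteq> 0})"
proof -
  have "\<bar>\<alpha> i\<bar> = (if \<alpha> i \<noteq> 0 then 1 else 0)" for i
  proof -
    have "\<alpha> i \<in> {-1,0,1}" using assms by auto
    then show ?thesis by auto
  qed
  then have "(\<Sum>i\<in>UNIV. \<bar>\<alpha> i\<bar>) = (\<Sum>i\<in>UNIV. if \<alpha> i \<noteq> 0 then 1 else 0)" by simp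
  also have "\<dots> = int (card {i. \<alpha> i \<noteq> 0})" by (simp add: sum.If_cases)
  finally show ?thesis .
qed

text \<open>
  Moving \<open>CARD('d) - m\<close> coordinates to their nearest endpoint lands on a face of dimension \<open>m\<close> and
  moves the point by at most \<open>\<epsilon>\<close>. The index set may be larger than necessary, hence the choice of a
  subset of the right size.
\<close>

lemma point_dist_skeleton_le:
  fixes y :: "real ^ 'd::finite"
  assumes y: "y \<in> unit_cube" and "0 \<le> \<epsilon>" and J: "CARD('d) - m \<le> card J"
    and "m \<le> CARD('d)"
    and near: "\<And>i. i \<in> J \<Longrightarrow> y $ i \<le> \<epsilon> \<or> 1 - y $ i \<le> \<epsilon>"
  shows "\<exists>z\<in>skeleton m. infnorm (y - z) \<le> \<epsilon>"
proof -
  obtain J' where J': "J' \<subseteq> J" "card J' = CARD('d) - m"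
    using obtain_subset_with_card_n[OF J] by metis
  define \<alpha> where "\<alpha> i = (if i \<in> J' then if y $ i \<le> \<epsilon> then -1 else 1 else (0::int))" for i
  define z :: "real ^ 'd" where "z = (\<chi> i. if i \<in> J' then (1 + real_of_int (\<alpha> i)) / 2 else y $ i)"
  have r: "range \<alpha> \<subseteq> {-1,0,1}" by (auto simp: \<alpha>_def)
  have "{i. \<alpha> i \<noteq> 0} = J'" by (auto simp: \<alpha>_def)
  then have "(\<Sum>i\<in>UNIV. \<bar>\<alpha> i\<bar>) = int CARD('d) - int m"
    using sum_abs_sign_vector[OF r] J'(2) assms(4) by (simp add: of_nat_diff)
  moreover have "z \<in> face \<alpha>"
    using y by (auto simp: face_def unit_cube_def z_def \<alpha>_def)
  ultimately have "z \<in> skeleton m" using r unfolding skeleton_eq by blast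
  moreover have "infnorm (y - z) \<le> \<epsilon>"
    unfolding infnorm_vec_le_iff
  proof
    fix i show "\<bar>(y - z) $ i\<bar> \<le> \<epsilon>"
      using near[of i] J' unit_cubeD[OF y, of i] \<open>0 \<le> \<epsilon>\<close> by (auto simp: z_def \<alpha>_def)
  qed
  ultimately show ?thesis by blast
qed

lemma skeleton_nonempty:
  assumes "m \<le> CARD('d)" shows "skeleton m \<noteq> ({} :: (real ^ 'd::finite) set)"
proof -
  have z: "(0 :: real ^ 'd) \<in> unit_cube" by (simp add: unit_cube_def)
  show ?thesis using point_dist_skeleton_le[OF z, of 0 m UNIV] assms by auto
qed

lemma increasing_bijection_endpoints:
  fixes f :: "real \<Rightarrow> real"
  assumes "bij_betw f {0..1} {0..1}" "strict_mono_on {0..1} f"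
  shows "f 0 = 0" "f 1 = 1"
proof -
  have r: "f ` {0..1} = {0..1}" using assms(1) by (simp add: bij_betw_def)
  have m: "f x \<le> f y" if "x \<le> y" "0 \<le> x" "y \<le> 1" for x y
  proof (cases "x = y")
    case False
    then have "f x < f y" using that by (intro strict_mono_onD[OF assms(2)]) (use that False in auto)
    then show ?thesis by simp
  qed simp
  have i: "0 \<in> {0..1::real}" "1 \<in> {0..1::real}" by auto
  then have "0 \<in> f ` {0..1}" "1 \<in> f ` {0..1}" using r by blast+
  then obtain a b where a: "a \<in> {0..1}" "f a = 0" and b: "b \<in> {0..1}" "f b = 1" by auto
  have "f 0 \<in> {0..1}" "f 1 \<in> {0..1}" using r i by blast+
  then show "f 0 = 0" "f 1 = 1" using m[of 0 a] m[of b 1] a b by auto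
qed

text \<open>
  An increasing bijection of the unit interval fixes 0 and 1, so it preserves the constraints that
  define a face and permutes the values of the free coordinates.
\<close>

lemma coordinatewise_bijection_face:
  fixes f :: "'d::finite \<Rightarrow> real \<Rightarrow> real" and T :: "real ^ 'd \<Rightarrow> real ^ 'd"
  assumes bij: "\<And>i. bij_betw (f i) {0..1} {0..1}" and mono: "\<And>i. strict_mono_on {0..1} (f i)"
    and T: "\<And>x i. x \<in> unit_cube \<Longrightarrow> T x $ i = f i (x $ i)"
    and \<alpha>: "range \<alpha> \<subseteq> {-1,0,1}"
  shows "T ` face \<alpha> = face \<alpha>"
proof -
  note e = increasing_bijection_endpoints[OF bij mono]
  have v: "f i ((1 + real_of_int (\<alpha> i)) / 2) = (1 + real_of_int (\<alpha> i)) / 2" if "\<alpha> i \<noteq> 0" for i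
  proof -
    have "\<alpha> i \<in> {-1,0,1}" using \<alpha> by auto
    then show ?thesis using that e[of i] by auto
  qed
  have im: "f i ` {0..1} = {0..1}" for i using bij by (simp add: bij_betw_def)
  show ?thesis
  proof (intro equalityI subsetI)
    fix y assume "y \<in> T ` face \<alpha>"
    then obtain x where x: "x \<in> face \<alpha>" "y = T x" by auto
    then have xc: "x \<in> unit_cube" using face_subset_cube by auto
    have "f i (x $ i) \<in> {0..1}" for i
      using im[of i] unit_cubeD[OF xc, of i] by (metis atLeastAtMost_iff imageI)
    moreover have "f i (x $ i) = (1 + real_of_int (\<alpha> i)) / 2" if "\<alpha> i \<noteq> 0" for i
    proof -
      have "x $ i = (1 + real_of_int (\<alpha> i)) / 2" using x(1) that unfolding face_def by blast
      then show ?thesis using v[OF that] by metis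
    qed
    ultimately show "y \<in> face \<alpha>"
      using T[OF xc] unfolding x(2) face_def unit_cube_def by auto
  next
    fix y assume y: "y \<in> face \<alpha>"
    have "\<exists>x\<in>{0..1}. f i x = y $ i \<and> (\<alpha> i \<noteq> 0 \<longrightarrow> x = (1 + real_of_int (\<alpha> i)) / 2)" for i
    proof (cases "\<alpha> i = 0")
      case True
      have "y $ i \<in> f i ` {0..1}" using im[of i] y by (auto simp: face_def unit_cube_def)
      then show ?thesis using True by auto
    next
      case False
      have "\<alpha> i \<in> {-1,0,1}" using \<alpha> by auto
      then show ?thesis using False v[OF False] y
        by (intro bexI[of _ "(1 + real_of_int (\<alpha> i)) / 2"]) (auto simp: face_def)
    qed
    then obtain x where x: "\<And>i. x i \<in> {0..1}" "\<And>i. f i (x i) = y $ i"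
      "\<And>i. \<alpha> i \<noteq> 0 \<Longrightarrow> x i = (1 + real_of_int (\<alpha> i)) / 2" by metis
    have xf: "(\<chi> i. x i) \<in> face \<alpha>" using x(1,3) by (auto simp: face_def unit_cube_def)
    have "T (\<chi> i. x i) = y"
      using T[of "\<chi> i. x i"] x(2) xf face_subset_cube by (auto simp: vec_eq_iff)
    then show "y \<in> T ` face \<alpha>" using xf by blast
  qed
qed

section \<open>Sets of small Hausdorff dimension\<close>

lemma inf_diam_upper:
  assumes "\<forall>x\<in>U. \<forall>y\<in>U. infnorm (x - y) \<le> \<delta>" "x \<in> U" "y \<in> U"
  shows "infnorm (x - y) \<le> inf_diam U"
proof -
  have "bdd_above ((\<lambda>(x, y). infnorm (x - y)) ` (U \<times> U))"
    using assms(1) by (intro bdd_aboveI2[of _ _ \<delta>]) auto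
  from cSUP_upper[OF _ this, of "(x, y)"] show ?thesis
    using assms(2,3) by (simp add: inf_diam_def)
qed

lemma inf_diam_least:
  assumes "U \<noteq> {}" "\<forall>x\<in>U. \<forall>y\<in>U. infnorm (x - y) \<le> \<delta>"
  shows "inf_diam U \<le> \<delta>"
  unfolding inf_diam_def using assms by (intro cSUP_least) auto

lemma inf_diam_nonneg:
  assumes "U \<noteq> {}" "\<forall>x\<in>U. \<forall>y\<in>U. infnorm (x - y) \<le> \<delta>"
  shows "0 \<le> inf_diam U"
  using assms inf_diam_upper[OF assms(2)] infnorm_pos_le by (metis all_not_in_conv order_trans)

text \<open>
  Covers by sets of diameter at most 1 suffice later on: for such sets a larger exponent only decreases
  the power of the diameter.
\<close>

lemma hausdorff_dim_less_cover:
  assumes "hausdorff_dim K < ereal k" "0 < \<epsilon>"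
  obtains U s where "0 \<le> s" "s < k" "K \<subseteq> (\<Union>n::nat. U n)"
    "\<And>n. \<forall>x\<in>U n. \<forall>y\<in>U n. infnorm (x - y) \<le> 1"
    "(\<Sum>n. ennreal (hausdorff_gauge s (U n))) < ennreal \<epsilon>"
proof -
  obtain s where s: "0 \<le> s" "hausdorff_measure s K = 0" "s < k"
    using assms(1) unfolding hausdorff_dim_def INF_less_iff by auto
  have "hausdorff_pre s 1 K \<le> hausdorff_measure s K"
    unfolding hausdorff_measure_def by (rule SUP_upper) auto
  then have "hausdorff_pre s 1 K < ennreal \<epsilon>" using s(2) assms(2) by simp
  then show ?thesis
    unfolding hausdorff_pre_def INF_less_iff using s that by auto
qed

text \<open>
  Sets of diameter 0 occur in covers, while the hitting estimate is about balls of positive radius; this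
  is how much the radius may be enlarged at a given cost.
\<close>

lemma power_perturb:
  fixes r \<epsilon> :: real
  assumes "0 < \<epsilon>" shows "\<exists>\<eta>>0. (r + \<eta>) ^ k \<le> r ^ k + \<epsilon>"
proof -
  have "((\<lambda>\<eta>. (r + \<eta>) ^ k) \<longlongrightarrow> (r + 0) ^ k) (at_right 0)"
    by (intro tendsto_intros)
  then have "eventually (\<lambda>\<eta>. (r + \<eta>) ^ k < r ^ k + \<epsilon>) (at_right 0)"
    by (rule order_tendstoD) (use assms in auto)
  moreover have "eventually (\<lambda>\<eta>::real. 0 < \<eta>) (at_right 0)" by (rule eventually_at_right_less)
  ultimately have "eventually (\<lambda>\<eta>. 0 < \<eta> \<and> (r + \<eta>) ^ k < r ^ k + \<epsilon>) (at_right 0)"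
    by eventually_elim simp
  then have "\<exists>\<eta>. 0 < \<eta> \<and> (r + \<eta>) ^ k < r ^ k + \<epsilon>"
    by (rule eventually_happens'[rotated]) simp
  then show ?thesis by (auto intro: less_imp_le)
qed

text \<open>
  The random set \<open>{x. Q \<omega> x}\<close> meets a ball of radius \<open>r\<close> with probability of order \<open>r ^ k\<close>, so
  summing over an economical cover bounds the probability of meeting \<open>K\<close> by a multiple of the
  \<open>s\<close>-dimensional Hausdorff sum for some \<open>s < k\<close>, which can be made arbitrarily small. The event
  that a ball is hit may fail to be measurable, which is why the estimate is stated for a measurable superset \<open>E\<close>.
\<close>

lemma AE_avoids_low_dimension:
  fixes K :: "'a::euclidean_space set" and Q :: "'w \<Rightarrow> 'a \<Rightarrow> bool"
  assumes dim: "hausdorff_dim K < ereal (real k)" and "0 \<le> C"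
    and box: "\<And>u r. 0 < r \<Longrightarrow> \<exists>E\<in>sets M. {\<omega>\<in>space M. \<exists>x. infnorm (x - u) < r \<and> Q \<omega> x} \<subseteq> E \<and>
                 emeasure M E \<le> ennreal (C * r ^ k)"
  shows "AE \<omega> in M. \<forall>x\<in>K. \<not> Q \<omega> x"
proof -
  have cover: "\<exists>E\<in>sets M. {\<omega>\<in>space M. \<exists>x\<in>K. Q \<omega> x} \<subseteq> E \<and> emeasure M E \<le> ennreal (2 * C * \<epsilon>)"
    if \<epsilon>0: "0 < \<epsilon>" for \<epsilon>
  proof -
    obtain U s where s: "0 \<le> s" "s < real k" and U: "K \<subseteq> (\<Union>n::nat. U n)"
      "\<And>n. \<forall>x\<in>U n. \<forall>y\<in>U n. infnorm (x - y) \<le> 1"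
      "(\<Sum>n. ennreal (hausdorff_gauge s (U n))) < ennreal \<epsilon>"
      using hausdorff_dim_less_cover[OF dim \<epsilon>0] by metis
    have "\<exists>E\<in>sets M. {\<omega>\<in>space M. \<exists>x\<in>U n. Q \<omega> x} \<subseteq> E \<and>
        emeasure M E \<le> ennreal C * ennreal (hausdorff_gauge s (U n)) + ennreal C * ennreal (\<epsilon> * (1/2) ^ Suc n)" for n
    proof (cases "U n = {}")
      case True then show ?thesis by (intro bexI[of _ "{}"]) auto
    next
      case False
      then obtain u where u: "u \<in> U n" by auto
      have r0: "0 \<le> inf_diam (U n)" and r1: "inf_diam (U n) \<le> 1"
        using inf_diam_nonneg[OF False U(2)] inf_diam_least[OF False U(2)] by auto
      \<comment> \<open>The factors \<open>(1/2) ^ Suc n\<close> make the costs of enlarging the radii add up to \<open>\<epsilon>\<close>.\<close>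
      obtain \<eta> where \<eta>: "\<eta> > 0" "(inf_diam (U n) + \<eta>) ^ k \<le> inf_diam (U n) ^ k + \<epsilon> * (1/2) ^ Suc n"
        using power_perturb[of "\<epsilon> * (1/2) ^ Suc n" "inf_diam (U n)" k] \<epsilon>0 by auto
      have g: "inf_diam (U n) ^ k \<le> hausdorff_gauge s (U n)"
      proof (cases "s = 0")
        case True then show ?thesis using False r0 r1 by (simp add: hausdorff_gauge_def power_le_one)
      next
        case s0: False
        show ?thesis
        proof (cases "inf_diam (U n) = 0")
          case True then show ?thesis using s s0 False by (auto simp: hausdorff_gauge_def zero_power)
        next
          case d: False
          have "inf_diam (U n) ^ k = inf_diam (U n) powr real k"
            using d r0 by (simp add: powr_realpow)
          also have "\<dots> \<le> inf_diam (U n) powr s"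
            using d r0 r1 s by (intro powr_mono') auto
          finally show ?thesis using s0 False by (simp add: hausdorff_gauge_def)
        qed
      qed
      obtain E where E: "E \<in> sets M"
        "{\<omega>\<in>space M. \<exists>x. infnorm (x - u) < inf_diam (U n) + \<eta> \<and> Q \<omega> x} \<subseteq> E"
        "emeasure M E \<le> ennreal (C * (inf_diam (U n) + \<eta>) ^ k)"
        using box[of "inf_diam (U n) + \<eta>" u] \<eta> r0 by auto
      have sub: "{\<omega>\<in>space M. \<exists>x\<in>U n. Q \<omega> x} \<subseteq> E"
      proof -
        have "infnorm (x - u) < inf_diam (U n) + \<eta>" if "x \<in> U n" for x
          using inf_diam_upper[OF U(2) that u] \<eta>(1) by simp
        then show ?thesis using E(2) by blast
      qed
      have "C * (inf_diam (U n) + \<eta>) ^ k \<le> C * (hausdorff_gauge s (U n) + \<epsilon> * (1/2) ^ Suc n)"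
        using \<eta>(2) g \<open>0 \<le> C\<close> by (intro mult_left_mono) auto
      moreover have "ennreal (C * (hausdorff_gauge s (U n) + \<epsilon> * (1/2) ^ Suc n))
          = ennreal C * ennreal (hausdorff_gauge s (U n)) + ennreal C * ennreal (\<epsilon> * (1/2) ^ Suc n)"
        using \<open>0 \<le> C\<close> \<epsilon>0 order_trans[OF zero_le_power[OF r0] g]
        by (simp add: distrib_left ennreal_mult[symmetric] ennreal_plus[symmetric] del: ennreal_plus)
      ultimately have "emeasure M E
          \<le> ennreal C * ennreal (hausdorff_gauge s (U n)) + ennreal C * ennreal (\<epsilon> * (1/2) ^ Suc n)"
        using E(3) by (metis ennreal_leI order_trans)
      then show ?thesis using E(1) sub by blast
    qed
    then obtain E where E: "\<And>n. E n \<in> sets M \<and> {\<omega>\<in>space M. \<exists>x\<in>U n. Q \<omega> x} \<subseteq> E n \<and>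
        emeasure M (E n) \<le> ennreal C * ennreal (hausdorff_gauge s (U n)) + ennreal C * ennreal (\<epsilon> * (1/2) ^ Suc n)"
      unfolding Bex_def by (atomize_elim, intro choice allI)
    have geo: "(\<Sum>n. ennreal (\<epsilon> * (1/2) ^ Suc n)) = ennreal \<epsilon>"
    proof -
      have "(\<lambda>n. \<epsilon> * (1/2) ^ Suc n) sums (\<epsilon> * 1)"
        by (intro sums_mult power_half_series)
      then show ?thesis using \<epsilon>0 by (subst suminf_ennreal_eq) auto
    qed
    have "emeasure M (\<Union>n. E n) \<le> (\<Sum>n. emeasure M (E n))"
      using E by (intro emeasure_subadditive_countably) auto
    also have "\<dots> \<le> (\<Sum>n. ennreal C * ennreal (hausdorff_gauge s (U n)) + ennreal C * ennreal (\<epsilon> * (1/2) ^ Suc n))"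
      using E by (intro suminf_le) auto
    also have "\<dots> = ennreal C * (\<Sum>n. ennreal (hausdorff_gauge s (U n))) + ennreal C * ennreal \<epsilon>"
      by (subst suminf_add[symmetric], simp, simp, simp only: ennreal_suminf_cmult geo)
    also have "\<dots> \<le> ennreal C * ennreal \<epsilon> + ennreal C * ennreal \<epsilon>"
      using U(3) by (intro add_right_mono mult_left_mono) auto
    also have "\<dots> = ennreal (2 * C * \<epsilon>)"
      using \<epsilon>0 \<open>0 \<le> C\<close> by (simp add: ennreal_mult[symmetric] ennreal_plus[symmetric] del: ennreal_plus)
    finally have "emeasure M (\<Union>n. E n) \<le> ennreal (2 * C * \<epsilon>)" .
    moreover have "{\<omega>\<in>space M. \<exists>x\<in>K. Q \<omega> x} \<subseteq> (\<Union>n. E n)"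
    proof clarify
      fix \<omega> x assume "\<omega> \<in> space M" "x \<in> K" "Q \<omega> x"
      moreover then obtain n where "x \<in> U n" using U(1) by auto
      ultimately show "\<omega> \<in> (\<Union>n. E n)" using E[of n] by auto
    qed
    moreover have "(\<Union>n. E n) \<in> sets M" using E by auto
    ultimately show ?thesis by blast
  qed
  have "\<exists>E. \<forall>n::nat. E n \<in> sets M \<and> {\<omega>\<in>space M. \<exists>x\<in>K. Q \<omega> x} \<subseteq> E n \<and>
      emeasure M (E n) \<le> ennreal (2 * C * (1 / Suc n))"
    using cover[of "1 / Suc n" for n] unfolding Bex_def by (intro choice allI) simp
  then obtain E where "\<forall>n::nat. E n \<in> sets M \<and> {\<omega>\<in>space M. \<exists>x\<in>K. Q \<omega> x} \<subseteq> E n \<and>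
      emeasure M (E n) \<le> ennreal (2 * C * (1 / Suc n))" ..
  then have E: "\<And>n. E n \<in> sets M" "\<And>n. {\<omega>\<in>space M. \<exists>x\<in>K. Q \<omega> x} \<subseteq> E n"
    "\<And>n. emeasure M (E n) \<le> ennreal (2 * C * (1 / Suc n))" by blast+
  have N: "(\<Inter>n. E n) \<in> sets M" using E(1) by auto
  have "emeasure M (\<Inter>n. E n) \<le> ennreal (2 * C * (1 / Suc n))" for n
    using emeasure_mono[OF INT_lower[of n UNIV E] E(1)] E(3)[of n] by (meson UNIV_I order_trans)
  moreover have "(\<lambda>n. ennreal (2 * C * (1 / Suc n))) \<longlonglongrightarrow> ennreal (2 * C * 0)"
    by (intro tendsto_ennrealI tendsto_mult tendsto_const LIMSEQ_Suc[OF lim_1_over_n])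
  ultimately have "emeasure M (\<Inter>n. E n) \<le> ennreal (2 * C * 0)"
    by (intro LIMSEQ_le_const) auto
  then have "(\<Inter>n. E n) \<in> null_sets M" using N by auto
  then show ?thesis by (rule AE_I') (use E(2) in auto)
qed

lemma hausdorff_dim_le:
  assumes "0 \<le> m"
    and "\<And>s. m < s \<Longrightarrow> hausdorff_measure s A = 0"
  shows "hausdorff_dim A \<le> ereal m"
proof (rule ereal_le_epsilon2)
  fix e :: real assume "0 < e"
  then show "hausdorff_dim A \<le> ereal m + ereal e"
    unfolding hausdorff_dim_def using assms by (intro INF_lower2[of "m + e"]) auto
qed

text \<open>
  Finite covers by sets of a common diameter bound, indexed arbitrarily; the sequence demanded by the
  definition is obtained by enumeration and padding with empty sets, whose gauge is 0.
\<close>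

lemma hausdorff_measure_eq_0I:
  assumes "0 < s"
    and cov: "\<And>\<delta> \<epsilon>. 0 < \<delta> \<Longrightarrow> 0 < \<epsilon> \<Longrightarrow> \<exists>I f h. finite I \<and> A \<subseteq> (\<Union>k\<in>I. f k) \<and> 0 < h \<and> h \<le> \<delta> \<and>
          (\<forall>k\<in>(I::'b set). \<forall>x\<in>f k. \<forall>y\<in>f k. infnorm (x - y) \<le> h) \<and> real (card I) * h powr s \<le> \<epsilon>"
  shows "hausdorff_measure s A = 0"
proof -
  have "hausdorff_pre s \<delta> A \<le> 0" if \<delta>: "0 < \<delta>" for \<delta>
  proof (rule ennreal_le_epsilon)
    fix e :: real assume "0 < e"
    obtain I :: "'b set" and f h where I: "finite I" "A \<subseteq> (\<Union>k\<in>I. f k)" "0 < h" "h \<le> \<delta>"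
      "\<And>k x y. k \<in> I \<Longrightarrow> x \<in> f k \<Longrightarrow> y \<in> f k \<Longrightarrow> infnorm (x - y) \<le> h" "real (card I) * h powr s \<le> e"
      using cov[OF \<delta> \<open>0 < e\<close>] by metis
    obtain b where b: "bij_betw b {..<card I} I"
      using I(1) bij_betw_from_nat_into_finite by (metis)
    define U where "U n = (if n < card I then f (b n) else {})" for n
    have bI: "b n \<in> I" if "n < card I" for n using b that by (auto simp: bij_betw_def)
    have d: "\<forall>x\<in>U n. \<forall>y\<in>U n. infnorm (x - y) \<le> h" for n
      using I(5)[OF bI] by (auto simp: U_def)
    have "A \<subseteq> (\<Union>n. U n)"
    proof
      fix x assume "x \<in> A"
      then obtain k where k: "k \<in> I" "x \<in> f k" using I(2) by auto
      then obtain n where "n < card I" "k = b n" using b by (auto simp: bij_betw_def)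
      then show "x \<in> (\<Union>n. U n)" using k by (auto simp: U_def intro!: exI[of _ n])
    qed
    moreover have "\<forall>n. \<forall>x\<in>U n. \<forall>y\<in>U n. infnorm (x - y) \<le> \<delta>" using d I(4) by (meson order_trans)
    ultimately have "hausdorff_pre s \<delta> A \<le> (\<Sum>n. ennreal (hausdorff_gauge s (U n)))"
      unfolding hausdorff_pre_def by (intro INF_lower) auto
    also have "\<dots> = (\<Sum>n<card I. ennreal (hausdorff_gauge s (U n)))"
      by (rule suminf_finite) (auto simp: U_def hausdorff_gauge_def)
    also have "\<dots> \<le> (\<Sum>n<card I. ennreal (h powr s))"
    proof (intro sum_mono ennreal_leI)
      fix n show "hausdorff_gauge s (U n) \<le> h powr s"
      proof (cases "U n = {}")
        case False
        then show ?thesis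
          using inf_diam_least[OF False d] inf_diam_nonneg[OF False d] \<open>0 < s\<close>
          by (auto simp: hausdorff_gauge_def intro!: powr_mono2)
      qed (simp add: hausdorff_gauge_def)
    qed
    also have "\<dots> = ennreal (real (card I) * h powr s)"
      by (simp add: ennreal_mult ennreal_of_nat_eq_real_of_nat)
    also have "\<dots> \<le> ennreal e" by (intro ennreal_leI I)
    finally show "hausdorff_pre s \<delta> A \<le> 0 + ennreal e" by simp
  qed
  then have "hausdorff_measure s A \<le> 0"
    unfolding hausdorff_measure_def by (intro SUP_least) auto
  then show ?thesis by simp
qed

lemma unit_interval_grid:
  fixes x :: real
  assumes "0 \<le> x" "x \<le> 1" "0 < N"
  shows "\<exists>k<N. real k / real N \<le> x \<and> x \<le> (real k + 1) / real N"
proof (cases "x = 1")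
  case True
  then show ?thesis using assms by (intro exI[of _ "N - 1"]) (auto simp: field_simps of_nat_diff)
next
  case False
  define k where "k = nat \<lfloor>x * real N\<rfloor>"
  have k: "real k \<le> x * real N" "x * real N < real k + 1"
    unfolding k_def using assms by (simp_all add: floor_le_iff)
  have "x * real N < 1 * real N" using False assms by (intro mult_strict_right_mono) auto
  then have "real k < real N" using k(1) by linarith
  then show ?thesis using k assms by (intro exI[of _ k]) (auto simp: field_simps)
qed

text \<open>
  The face splits into \<open>N ^ k\<close> subcubes of side \<open>1 / N\<close>, where \<open>k\<close> is the number of free coordinates, and
  \<open>N ^ k * (1 / N) powr s\<close> tends to 0 for \<open>s > k\<close>.
\<close>

lemma hausdorff_dim_face:
  fixes \<alpha> :: "'d::finite \<Rightarrow> int"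
  shows "hausdorff_dim (face \<alpha> :: (real ^ 'd) set) \<le> ereal (real (card {i. \<alpha> i = 0}))"
proof (rule hausdorff_dim_le)
  define F where "F = {i. \<alpha> i = 0}"
  fix s assume s: "real (card {i. \<alpha> i = 0}) < s"
  then have s0: "0 < s" by linarith
  show "hausdorff_measure s (face \<alpha> :: (real ^ 'd) set) = 0"
  proof (rule hausdorff_measure_eq_0I[OF s0])
    fix \<delta> \<epsilon> :: real assume "0 < \<delta>" "0 < \<epsilon>"
    have "((\<lambda>N. real N powr (real (card F) - s)) \<longlongrightarrow> 0) sequentially"
      using s unfolding F_def by (intro tendsto_neg_powr filterlim_real_sequentially) auto
    then have "\<forall>\<^sub>F N in sequentially. real N powr (real (card F) - s) < \<epsilon>"
      by (rule order_tendstoD) fact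
    moreover have "\<forall>\<^sub>F N in sequentially. 1 / real N < \<delta>"
      by (rule order_tendstoD[OF lim_1_over_n]) fact
    moreover have "\<forall>\<^sub>F N in sequentially. (0::nat) < N" by (rule eventually_gt_at_top)
    ultimately have "\<forall>\<^sub>F N in sequentially. real N powr (real (card F) - s) < \<epsilon> \<and> 1 / real N < \<delta> \<and> 0 < N"
      by eventually_elim simp
    then obtain N where N: "real N powr (real (card F) - s) < \<epsilon>" "1 / real N < \<delta>" "0 < N"
      using eventually_happens'[OF sequentially_bot] by blast
    define I where "I = (F \<rightarrow>\<^sub>E {..<N})"
    define f where "f k = {x \<in> face \<alpha>. \<forall>i\<in>F. real (k i) / real N \<le> x $ i \<and> x $ i \<le> (real (k i) + 1) / real N}"
      for k :: "'d \<Rightarrow> nat"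
    have cov: "face \<alpha> \<subseteq> (\<Union>k\<in>I. f k)"
    proof
      fix x :: "real ^ 'd" assume x: "x \<in> face \<alpha>"
      have "\<forall>i. \<exists>k<N. real k / real N \<le> x $ i \<and> x $ i \<le> (real k + 1) / real N"
        using x N(3) unit_interval_grid unit_cubeD face_subset_cube by (meson subsetD)
      then obtain k where k: "\<And>i. k i < N" "\<And>i. real (k i) / real N \<le> x $ i" "\<And>i. x $ i \<le> (real (k i) + 1) / real N"
        by metis
      have "restrict k F \<in> I" "x \<in> f (restrict k F)" using k x by (auto simp: I_def f_def)
      then show "x \<in> (\<Union>k\<in>I. f k)" by blast
    qed
    have diam: "infnorm (x - y) \<le> 1 / real N" if "x \<in> f k" "y \<in> f k" for k x y
      unfolding infnorm_vec_le_iff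
    proof
      fix i
      show "\<bar>(x - y) $ i\<bar> \<le> 1 / real N"
      proof (cases "i \<in> F")
        case True
        then have "real (k i) / real N \<le> x $ i" "x $ i \<le> real (k i) / real N + 1 / real N"
          "real (k i) / real N \<le> y $ i" "y $ i \<le> real (k i) / real N + 1 / real N"
          using that by (auto simp: f_def add_divide_distrib)
        then show ?thesis by (simp add: abs_le_iff)
      next
        case False
        then have "x $ i = (1 + real_of_int (\<alpha> i)) / 2" "y $ i = (1 + real_of_int (\<alpha> i)) / 2"
          using that unfolding f_def face_def F_def by blast+
        then have "x $ i = y $ i" by metis
        then show ?thesis by simp
      qed
    qed
    have "real (card I) * (1 / real N) powr s = real N powr (real (card F) - s)"
      using N(3) by (simp add: I_def card_PiE powr_diff powr_realpow powr_divide)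
    then show "\<exists>(I :: ('d \<Rightarrow> nat) set) f h. finite I \<and> face \<alpha> \<subseteq> (\<Union>k\<in>I. f k) \<and> 0 < h \<and> h \<le> \<delta> \<and>
       (\<forall>k\<in>I. \<forall>x\<in>f k. \<forall>y\<in>f k. infnorm (x - y) \<le> h) \<and> real (card I) * h powr s \<le> \<epsilon>"
      using N cov diam
      by (intro exI[of _ I] exI[of _ f] exI[of _ "1 / real N"]) (auto simp: I_def finite_PiE)
  qed
qed simp

section \<open>Mean square limits\<close>

text \<open>
  The square of the distance in \<open>L\<^sup>2(M)\<close>, with values in the extended reals so that no integrability has to
  be established beforehand.
\<close>

definition l2_dist :: "'a measure \<Rightarrow> ('a \<Rightarrow> real) \<Rightarrow> ('a \<Rightarrow> real) \<Rightarrow> ennreal" where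
  "l2_dist M f g = (\<integral>\<^sup>+x. ennreal ((f x - g x)\<^sup>2) \<partial>M)"

lemma l2_dist_diff_le:
  assumes [measurable]: "f \<in> borel_measurable M" "g \<in> borel_measurable M"
    "f' \<in> borel_measurable M" "g' \<in> borel_measurable M"
  shows "l2_dist M (\<lambda>x. f x - f' x) (\<lambda>x. g x - g' x) \<le> 2 * l2_dist M f g + 2 * l2_dist M f' g'"
proof -
  have "l2_dist M (\<lambda>x. f x - f' x) (\<lambda>x. g x - g' x)
      \<le> (\<integral>\<^sup>+x. 2 * ennreal ((f x - g x)\<^sup>2) + 2 * ennreal ((f' x - g' x)\<^sup>2) \<partial>M)"
    unfolding l2_dist_def
  proof (rule nn_integral_mono)
    fix x
    have "(f x - f' x - (g x - g' x))\<^sup>2 \<le> 2 * (f x - g x)\<^sup>2 + 2 * (f' x - g' x)\<^sup>2"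
      using sum_squares_ge_zero[of "f x - g x + (f' x - g' x)" 0] by (simp add: power2_eq_square algebra_simps)
    then have "ennreal ((f x - f' x - (g x - g' x))\<^sup>2) \<le> ennreal (2 * (f x - g x)\<^sup>2 + 2 * (f' x - g' x)\<^sup>2)"
      by (rule ennreal_leI)
    then show "ennreal ((f x - f' x - (g x - g' x))\<^sup>2) \<le> 2 * ennreal ((f x - g x)\<^sup>2) + 2 * ennreal ((f' x - g' x)\<^sup>2)"
      by (simp add: ennreal_mult)
  qed
  also have "\<dots> = 2 * l2_dist M f g + 2 * l2_dist M f' g'"
    unfolding l2_dist_def by (subst nn_integral_add) (simp_all add: nn_integral_cmult)
  finally show ?thesis .
qed

lemma tendsto_0_ennreal_le:
  fixes f g :: "'b \<Rightarrow> ennreal"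
  assumes "(g \<longlongrightarrow> 0) F" "\<And>j. f j \<le> g j" shows "(f \<longlongrightarrow> 0) F"
  by (rule tendsto_sandwich[OF _ _ tendsto_const assms(1)]) (auto simp: assms(2))

lemma l2_tendsto_diff:
  assumes [measurable]: "\<And>j. f j \<in> borel_measurable M" "g \<in> borel_measurable M"
    "\<And>j. f' j \<in> borel_measurable M" "g' \<in> borel_measurable M"
    and "((\<lambda>j. l2_dist M (f j) g) \<longlongrightarrow> 0) F" "((\<lambda>j. l2_dist M (f' j) g') \<longlongrightarrow> 0) F"
  shows "((\<lambda>j. l2_dist M (\<lambda>x. f j x - f' j x) (\<lambda>x. g x - g' x)) \<longlongrightarrow> 0) F"
proof (rule tendsto_0_ennreal_le)
  have "((\<lambda>j. 2 * l2_dist M (f j) g + 2 * l2_dist M (f' j) g') \<longlongrightarrow> 2 * 0 + 2 * 0) F"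
    by (intro tendsto_add ennreal_tendsto_cmult assms) auto
  then show "((\<lambda>j. 2 * l2_dist M (f j) g + 2 * l2_dist M (f' j) g') \<longlongrightarrow> 0) F" by simp
qed (intro l2_dist_diff_le assms)

text \<open>
  A substitute for the triangle inequality that avoids square roots: \<open>(a + b)\<^sup>2 \<le> (1 + \<eta>) a\<^sup>2 + (1 + 1/\<eta>) b\<^sup>2\<close>.
\<close>

lemma l2_norm_le:
  assumes [measurable]: "f \<in> borel_measurable M" "g \<in> borel_measurable M" and "0 < \<eta>"
  shows "l2_dist M f (\<lambda>_. 0) \<le> ennreal (1 + \<eta>) * l2_dist M g (\<lambda>_. 0) + ennreal (1 + 1 / \<eta>) * l2_dist M f g"
proof -
  have "l2_dist M f (\<lambda>_. 0) \<le> (\<integral>\<^sup>+x. ennreal (1 + \<eta>) * ennreal ((g x - 0)\<^sup>2) + ennreal (1 + 1 / \<eta>) * ennreal ((f x - g x)\<^sup>2) \<partial>M)"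
    unfolding l2_dist_def
  proof (rule nn_integral_mono)
    fix x
    have "(1 + \<eta>) * (g x)\<^sup>2 + (1 + 1 / \<eta>) * (f x - g x)\<^sup>2 - (f x)\<^sup>2 = (\<eta> * g x - (f x - g x))\<^sup>2 / \<eta>"
      using \<open>0 < \<eta>\<close> by (simp add: field_simps power2_eq_square)
    then have "(f x)\<^sup>2 \<le> (1 + \<eta>) * (g x)\<^sup>2 + (1 + 1 / \<eta>) * (f x - g x)\<^sup>2"
      using \<open>0 < \<eta>\<close> by (smt (verit) divide_nonneg_pos zero_le_power2)
    then have "ennreal ((f x)\<^sup>2) \<le> ennreal ((1 + \<eta>) * (g x)\<^sup>2 + (1 + 1 / \<eta>) * (f x - g x)\<^sup>2)"
      by (rule ennreal_leI)
    also have "\<dots> = ennreal (1 + \<eta>) * ennreal ((g x)\<^sup>2) + ennreal (1 + 1 / \<eta>) * ennreal ((f x - g x)\<^sup>2)"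
      using \<open>0 < \<eta>\<close> by (subst ennreal_plus) (simp_all add: ennreal_mult del: ennreal_plus)
    finally show "ennreal ((f x - 0)\<^sup>2) \<le> ennreal (1 + \<eta>) * ennreal ((g x - 0)\<^sup>2) + ennreal (1 + 1 / \<eta>) * ennreal ((f x - g x)\<^sup>2)"
      by simp
  qed
  also have "\<dots> = ennreal (1 + \<eta>) * l2_dist M g (\<lambda>_. 0) + ennreal (1 + 1 / \<eta>) * l2_dist M f g"
    unfolding l2_dist_def by (subst nn_integral_add) (simp_all add: nn_integral_cmult)
  finally show ?thesis .
qed

lemma l2_dist_commute: "l2_dist M f g = l2_dist M g f"
  unfolding l2_dist_def by (simp add: power2_commute)

lemma l2_limit_norm_le:
  assumes [measurable]: "\<And>j. f j \<in> borel_measurable M" "f\<^sub>0 \<in> borel_measurable M"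
    "\<And>j. g j \<in> borel_measurable N" "g\<^sub>0 \<in> borel_measurable N"
    and f: "(\<lambda>j. l2_dist M (f j) f\<^sub>0) \<longlonglongrightarrow> 0" and g: "(\<lambda>j. l2_dist N (g j) g\<^sub>0) \<longlonglongrightarrow> 0"
    and eq: "\<And>j. l2_dist M (f j) (\<lambda>_. 0) = l2_dist N (g j) (\<lambda>_. 0)"
  shows "l2_dist M f\<^sub>0 (\<lambda>_. 0) \<le> l2_dist N g\<^sub>0 (\<lambda>_. 0)"
proof (cases "l2_dist N g\<^sub>0 (\<lambda>_. 0)")
  case (real r)
  have le: "l2_dist M f\<^sub>0 (\<lambda>_. 0) \<le> ennreal ((1 + \<eta>)\<^sup>2 * r)" if \<eta>: "0 < \<eta>" for \<eta>
  proof -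
    let ?b = "\<lambda>j. ennreal (1 + \<eta>) * (ennreal (1 + \<eta>) * l2_dist N g\<^sub>0 (\<lambda>_. 0) + ennreal (1 + 1 / \<eta>) * l2_dist N (g j) g\<^sub>0)
        + ennreal (1 + 1 / \<eta>) * l2_dist M (f j) f\<^sub>0"
    have "?b \<longlonglongrightarrow> ennreal (1 + \<eta>) * (ennreal (1 + \<eta>) * l2_dist N g\<^sub>0 (\<lambda>_. 0) + ennreal (1 + 1 / \<eta>) * 0) + ennreal (1 + 1 / \<eta>) * 0"
      by (intro tendsto_add ennreal_tendsto_cmult tendsto_const f g) auto
    moreover have "l2_dist M f\<^sub>0 (\<lambda>_. 0) \<le> ?b j" for j
    proof -
      have "l2_dist M f\<^sub>0 (\<lambda>_. 0) \<le> ennreal (1 + \<eta>) * l2_dist M (f j) (\<lambda>_. 0) + ennreal (1 + 1 / \<eta>) * l2_dist M f\<^sub>0 (f j)"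
        by (rule l2_norm_le) (use \<eta> in auto)
      also have "\<dots> = ennreal (1 + \<eta>) * l2_dist N (g j) (\<lambda>_. 0) + ennreal (1 + 1 / \<eta>) * l2_dist M (f j) f\<^sub>0"
        by (simp only: eq l2_dist_commute[of M f\<^sub>0])
      also have "\<dots> \<le> ?b j"
        by (intro add_right_mono mult_left_mono l2_norm_le) (use \<eta> in auto)
      finally show ?thesis .
    qed
    ultimately have "l2_dist M f\<^sub>0 (\<lambda>_. 0) \<le> ennreal (1 + \<eta>) * (ennreal (1 + \<eta>) * l2_dist N g\<^sub>0 (\<lambda>_. 0) + ennreal (1 + 1 / \<eta>) * 0) + ennreal (1 + 1 / \<eta>) * 0"
      by (intro LIMSEQ_le_const) auto
    also have "\<dots> = ennreal ((1 + \<eta>)\<^sup>2 * r)"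
      using \<eta> real by (simp add: ennreal_mult'[symmetric] power2_eq_square mult.assoc del: ennreal_plus)
    finally show ?thesis .
  qed
  have "(\<lambda>n. ennreal ((1 + 1 / real (Suc n))\<^sup>2 * r)) \<longlonglongrightarrow> ennreal ((1 + 0)\<^sup>2 * r)"
    by (intro tendsto_ennrealI tendsto_intros LIMSEQ_Suc[OF lim_1_over_n])
  then have "l2_dist M f\<^sub>0 (\<lambda>_. 0) \<le> ennreal ((1 + 0)\<^sup>2 * r)"
    by (rule LIMSEQ_le_const) (use le in \<open>auto simp del: of_nat_Suc\<close>)
  then show ?thesis using real by simp
qed simp

text \<open>
  An isometry that holds along two approximating sequences, possibly in different spaces, passes to their
  limits. This is how the Ito isometry is transferred from simple integrands.
\<close>

lemma l2_limit_norm_eq: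
  assumes "\<And>j. f j \<in> borel_measurable M" "f\<^sub>0 \<in> borel_measurable M"
    "\<And>j. g j \<in> borel_measurable N" "g\<^sub>0 \<in> borel_measurable N"
    and "(\<lambda>j. l2_dist M (f j) f\<^sub>0) \<longlonglongrightarrow> 0" "(\<lambda>j. l2_dist N (g j) g\<^sub>0) \<longlonglongrightarrow> 0"
    and "\<And>j. l2_dist M (f j) (\<lambda>_. 0) = l2_dist N (g j) (\<lambda>_. 0)"
  shows "l2_dist M f\<^sub>0 (\<lambda>_. 0) = l2_dist N g\<^sub>0 (\<lambda>_. 0)"
  by (intro antisym l2_limit_norm_le[OF assms] l2_limit_norm_le[OF assms(3,4,1,2,6,5) assms(7)[symmetric]])

context prob_space
begin

lemma expectation_square_le:
  fixes f :: "'a \<Rightarrow> real"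
  assumes [measurable]: "f \<in> borel_measurable M" and f2: "integrable M (\<lambda>x. (f x)\<^sup>2)"
  shows "integrable M f" "(expectation f)\<^sup>2 \<le> expectation (\<lambda>x. (f x)\<^sup>2)"
proof -
  show i: "integrable M f" by (rule square_integrable_imp_integrable[OF assms])
  show "(expectation f)\<^sup>2 \<le> expectation (\<lambda>x. (f x)\<^sup>2)"
    using variance_eq[OF i f2] variance_positive[of f] by simp
qed

lemma integrable_square_iff:
  fixes f :: "'a \<Rightarrow> real"
  assumes [measurable]: "f \<in> borel_measurable M"
  shows "integrable M (\<lambda>x. (f x)\<^sup>2) \<longleftrightarrow> l2_dist M f (\<lambda>_. 0) < \<infinity>"
  unfolding l2_dist_def integrable_iff_bounded by simp

lemma l2_dist_eq_expectation:
  fixes f :: "'a \<Rightarrow> real"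
  assumes "integrable M (\<lambda>x. (f x - g x)\<^sup>2)"
  shows "l2_dist M f g = ennreal (expectation (\<lambda>x. (f x - g x)\<^sup>2))"
  unfolding l2_dist_def by (rule nn_integral_eq_integral) (use assms in auto)

lemma l2_tendsto_expectation:
  fixes f :: "nat \<Rightarrow> 'a \<Rightarrow> real"
  assumes [measurable]: "\<And>j. f j \<in> borel_measurable M" "g \<in> borel_measurable M"
    and f2: "\<And>j. integrable M (\<lambda>x. (f j x)\<^sup>2)" and g2: "integrable M (\<lambda>x. (g x)\<^sup>2)"
    and lim: "(\<lambda>j. l2_dist M (f j) g) \<longlonglongrightarrow> 0"
    and Z[measurable]: "Z \<in> borel_measurable M" and bZ: "\<And>x. x \<in> space M \<Longrightarrow> \<bar>Z x\<bar> \<le> c"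
  shows "(\<lambda>j. expectation (\<lambda>x. Z x * f j x)) \<longlonglongrightarrow> expectation (\<lambda>x. Z x * g x)"
proof -
  have d2: "integrable M (\<lambda>x. (f j x - g x)\<^sup>2)" for j
  proof (rule Bochner_Integration.integrable_bound[where f="\<lambda>x. 2 * (f j x)\<^sup>2 + 2 * (g x)\<^sup>2"])
    have "(f j x - g x)\<^sup>2 \<le> 2 * (f j x)\<^sup>2 + 2 * (g x)\<^sup>2" for x
      using sum_squares_ge_zero[of "f j x + g x" 0] by (simp add: power2_eq_square algebra_simps)
    then show "AE x in M. norm ((f j x - g x)\<^sup>2) \<le> norm (2 * (f j x)\<^sup>2 + 2 * (g x)\<^sup>2)" by simp
  qed (use f2 g2 in auto)
  have int: "integrable M (f j)" "integrable M g" for j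
    using expectation_square_le(1)[OF _ f2] expectation_square_le(1)[OF _ g2] by auto
  have Zint: "integrable M (\<lambda>x. Z x * u x)" if "integrable M u" for u :: "'a \<Rightarrow> real"
    using that by (intro integrable_real_mult_indicator Bochner_Integration.integrable_bound[OF integrable_mult_right[OF that, of c]])
      (auto simp: abs_mult intro!: mult_mono order_trans[OF bZ])
  have "(\<lambda>j. ennreal (expectation (\<lambda>x. (f j x - g x)\<^sup>2))) \<longlonglongrightarrow> ennreal 0"
    using lim by (simp add: l2_dist_eq_expectation[OF d2])
  then have "(\<lambda>j. expectation (\<lambda>x. (f j x - g x)\<^sup>2)) \<longlonglongrightarrow> 0"
    by (subst (asm) tendsto_ennreal_iff) auto
  then have "(\<lambda>j. \<bar>c\<bar> * sqrt (expectation (\<lambda>x. (f j x - g x)\<^sup>2))) \<longlonglongrightarrow> \<bar>c\<bar> * sqrt 0"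
    by (intro tendsto_intros)
  then have lim0: "(\<lambda>j. \<bar>c\<bar> * sqrt (expectation (\<lambda>x. (f j x - g x)\<^sup>2))) \<longlonglongrightarrow> 0" by simp
  have bd: "\<bar>expectation (\<lambda>x. Z x * f j x) - expectation (\<lambda>x. Z x * g x)\<bar>
      \<le> \<bar>c\<bar> * sqrt (expectation (\<lambda>x. (f j x - g x)\<^sup>2))" for j
  proof -
    have "expectation (\<lambda>x. Z x * f j x) - expectation (\<lambda>x. Z x * g x) = expectation (\<lambda>x. Z x * (f j x - g x))"
      by (simp add: right_diff_distrib Zint int)
    also have "\<bar>\<dots>\<bar> \<le> expectation (\<lambda>x. \<bar>c\<bar> * \<bar>f j x - g x\<bar>)"
    proof (rule order_trans[OF integral_abs_bound], rule integral_mono)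
      fix x assume "x \<in> space M"
      then show "\<bar>Z x * (f j x - g x)\<bar> \<le> \<bar>c\<bar> * \<bar>f j x - g x\<bar>"
        using bZ[of x] by (auto simp: abs_mult intro!: mult_right_mono)
    qed (use int in \<open>auto intro!: Zint\<close>)
    also have "\<dots> = \<bar>c\<bar> * expectation (\<lambda>x. \<bar>f j x - g x\<bar>)" by simp
    also have "expectation (\<lambda>x. \<bar>f j x - g x\<bar>) \<le> sqrt (expectation (\<lambda>x. (f j x - g x)\<^sup>2))"
      using expectation_square_le(2)[of "\<lambda>x. \<bar>f j x - g x\<bar>"] d2 by (intro real_le_rsqrt) simp
    finally show ?thesis by (simp add: mult_left_mono)
  qed
  show ?thesis
    by (rule LIM_zero_cancel, rule Lim_null_comparison[OF _ lim0]) (use bd in auto)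
qed

end

section \<open>Independence of the past and the future of a Wiener process\<close>

type_synonym 'd path = "real \<Rightarrow> real ^ 'd"

text \<open>
  A triple \<open>(a, b, \<xi>)\<close> contributes the value \<open>\<xi>\<close> on the interval \<open>(a, b]\<close>. The intervals of a list may
  overlap, so that the sum of two integrands is the concatenation of their lists and no common refinement of
  partitions is ever needed.
\<close>

type_synonym 'd simple_integrand = "(real \<times> real \<times> ('d path \<Rightarrow> real)) list"

locale wiener =
  fixes P :: "(real \<Rightarrow> real ^ 'd::finite) measure"
  assumes wiener: "wiener_measure P"
begin

sublocale prob_space P using wiener by (simp add: wiener_measure_def)

definition incr :: "'d \<Rightarrow> real \<Rightarrow> real \<Rightarrow> 'd path \<Rightarrow> real" where
  "incr i a b \<omega> = \<omega> b $ i - \<omega> a $ i"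

lemma incr_split: "incr i a c \<omega> = incr i a b \<omega> + incr i b c \<omega>"
  by (simp add: incr_def)

lemma incr_self [simp]: "incr i a a = (\<lambda>_. 0)"
  by (simp add: incr_def fun_eq_iff)

lemma path_start: "\<omega> \<in> space P \<Longrightarrow> \<omega> 0 = 0"
  using wiener by (auto simp: wiener_measure_def path_space_def space_restrict_space)

lemma measurable_eval [measurable]: "(\<lambda>\<omega>. \<omega> t) \<in> borel_measurable P"
proof -
  have "(\<lambda>\<omega>. \<omega> t) \<in> measurable path_space borel"
    unfolding path_space_def by (rule measurable_restrict_space1) measurable
  moreover have "sets P = sets path_space" using wiener by (simp add: wiener_measure_def)
  ultimately show ?thesis by (simp cong: measurable_cong_sets)
qed

lemma borel_measurable_vec_nth [measurable]: "(\<lambda>x::real^'d. x $ i) \<in> borel_measurable borel"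
  by (intro borel_measurable_continuous_onI continuous_intros)

lemma measurable_incr [measurable]: "incr i a b \<in> borel_measurable P"
  unfolding incr_def by measurable

abbreviation "F \<equiv> wiener_filtration P"

definition filtration_generator :: "real \<Rightarrow> 'd path set set" where
  "filtration_generator t =
     {(\<lambda>\<omega>. \<omega> s) -` B \<inter> space P | s B. 0 \<le> s \<and> s \<le> t \<and> B \<in> sets borel} \<union> null_sets P"

lemma filtration_generator_events: "filtration_generator t \<subseteq> events"
  unfolding filtration_generator_def by (auto intro: measurable_sets[OF measurable_eval] dest: null_setsD2)

lemma filtration_generator_Pow: "filtration_generator t \<subseteq> Pow (space P)"
  using filtration_generator_events sets.space_closed by blast

lemma space_F [simp]: "space (F t) = space P"
  using filtration_generator_Pow[of t] by (simp add: wiener_filtration_def filtration_generator_def space_measure_of_conv)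

lemma sets_F: "sets (F t) = sigma_sets (space P) (filtration_generator t)"
  using filtration_generator_Pow[of t]
  unfolding wiener_filtration_def filtration_generator_def by (rule sets_measure_of)

lemma sets_F_events: "sets (F t) \<subseteq> events"
  unfolding sets_F by (rule sets.sigma_sets_subset[OF filtration_generator_events])

lemma F_imp_P: "f \<in> measurable (F t) N \<Longrightarrow> f \<in> measurable P N"
  using sets_F_events unfolding measurable_def by auto

lemma F_mono: "s \<le> t \<Longrightarrow> f \<in> measurable (F s) N \<Longrightarrow> f \<in> measurable (F t) N"
proof -
  assume st: "s \<le> t" and f: "f \<in> measurable (F s) N"
  have "filtration_generator s \<subseteq> filtration_generator t"
  proof
    fix A assume "A \<in> filtration_generator s"
    then consider r B where "A = (\<lambda>\<omega>. \<omega> r) -` B \<inter> space P" "0 \<le> r" "r \<le> s" "B \<in> sets borel" | "A \<in> null_sets P"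
      by (auto simp: filtration_generator_def)
    then show "A \<in> filtration_generator t"
    proof cases
      case (1 r B)
      then have "r \<le> t" using st by simp
      with 1 show ?thesis unfolding filtration_generator_def by blast
    qed (simp add: filtration_generator_def)
  qed
  then have "sets (F s) \<subseteq> sets (F t)" unfolding sets_F by (rule sigma_sets_mono')
  then show ?thesis using f unfolding measurable_def by auto
qed

lemma eval_measurable_F: "0 \<le> s \<Longrightarrow> s \<le> t \<Longrightarrow> (\<lambda>\<omega>. \<omega> s) \<in> borel_measurable (F t)"
  by (rule measurableI) (auto simp: sets_F filtration_generator_def intro!: sigma_sets.Basic)

lemma incr_measurable_F:
  assumes "0 \<le> a" "a \<le> t" "0 \<le> b" "b \<le> t" shows "incr i a b \<in> borel_measurable (F t)"
proof -
  note [measurable] = eval_measurable_F[OF assms(1,2)] eval_measurable_F[OF assms(3,4)]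
  show ?thesis unfolding incr_def by measurable
qed

definition cylinders :: "real set \<Rightarrow> 'd path set set" where
  "cylinders S = {(\<lambda>\<omega>. restrict \<omega> S) -` B \<inter> space P | B. B \<in> sets (Pi\<^sub>M S (\<lambda>_. borel))}"

lemma cylinders_events: "cylinders S \<subseteq> events"
proof -
  have "(\<lambda>\<omega>. restrict \<omega> S) \<in> measurable P (Pi\<^sub>M S (\<lambda>_. borel))"
    by (rule measurable_restrict) measurable
  then show ?thesis by (auto simp: cylinders_def measurable_sets)
qed

lemma cylinders_mono:
  assumes "S \<subseteq> T" shows "cylinders S \<subseteq> cylinders T"
proof
  fix A assume "A \<in> cylinders S"
  then obtain B where B: "A = (\<lambda>\<omega>. restrict \<omega> S) -` B \<inter> space P" "B \<in> sets (Pi\<^sub>M S (\<lambda>_. borel))"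
    by (auto simp: cylinders_def)
  have m: "(\<lambda>f. restrict f S) \<in> measurable (Pi\<^sub>M T (\<lambda>_. borel)) (Pi\<^sub>M S (\<lambda>_. borel :: (real^'d) measure))"
    by (rule measurable_restrict_subset[OF assms])
  have "restrict \<omega> S = restrict (restrict \<omega> T) S" for \<omega> :: "real \<Rightarrow> real^'d"
    using assms by (auto simp: fun_eq_iff)
  then have "A = (\<lambda>\<omega>. restrict \<omega> T) -` ((\<lambda>f. restrict f S) -` B \<inter> space (Pi\<^sub>M T (\<lambda>_. borel))) \<inter> space P"
    unfolding B(1) by (auto simp: space_PiM)
  then show "A \<in> cylinders T" unfolding cylinders_def using measurable_sets[OF m B(2)] by blast
qed

lemma cylinders_Int:
  assumes "A \<in> cylinders S" "A' \<in> cylinders S" shows "A \<inter> A' \<in> cylinders S"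
proof -
  obtain B B' where "A = (\<lambda>\<omega>. restrict \<omega> S) -` B \<inter> space P" "B \<in> sets (Pi\<^sub>M S (\<lambda>_. borel))"
    "A' = (\<lambda>\<omega>. restrict \<omega> S) -` B' \<inter> space P" "B' \<in> sets (Pi\<^sub>M S (\<lambda>_. borel))"
    using assms by (auto simp: cylinders_def)
  moreover from this have "A \<inter> A' = (\<lambda>\<omega>. restrict \<omega> S) -` (B \<inter> B') \<inter> space P" by auto
  ultimately show ?thesis unfolding cylinders_def by blast
qed

lemma indep_increments_grid:
  "strict_mono \<tau> \<Longrightarrow> indep_vars (\<lambda>_. borel) (\<lambda>p. incr (snd p) (\<tau> (fst p)) (\<tau> (Suc (fst p)))) ({..<n::nat} \<times> UNIV)"
proof -
  assume "strict_mono \<tau>"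
  then have "indep_vars (\<lambda>_. borel) (\<lambda>(k, i) \<omega>. \<omega> (\<tau> (Suc k)) $ i - \<omega> (\<tau> k) $ i) ({..<n} \<times> UNIV)"
    using wiener by (simp add: wiener_measure_def)
  then show ?thesis by (simp add: incr_def[abs_def] case_prod_beta')
qed

text \<open>
  Any finite set of times up to \<open>c\<close> can be refined to a grid that starts at 0 and passes through \<open>c\<close>
  and then \<open>d\<close>; the grid continues beyond \<open>d\<close> because the independence of increments speaks of infinite strictly
  increasing sequences.
\<close>

lemma finite_time_grid:
  assumes "finite S" "S \<subseteq> {0..c}" "0 \<le> c" "c < d"
  obtains \<tau> :: "nat \<Rightarrow> real" and n where "strict_mono \<tau>" "\<tau> 0 = 0" "\<tau> n = c" "\<tau> (Suc n) = d"
    "\<And>s. s \<in> S \<Longrightarrow> \<exists>k\<le>n. \<tau> k = s"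
proof -
  define T where "T = insert 0 (insert c S)"
  define l where "l = sorted_list_of_set T"
  have T: "finite T" "T \<noteq> {}" using assms by (auto simp: T_def)
  have l: "set l = T" "sorted l" "distinct l" using T by (auto simp: l_def)
  have len: "length l > 0" using T l by auto
  define n where "n = length l - 1"
  have n: "length l = Suc n" using len by (simp add: n_def)
  define \<tau> where "\<tau> k = (if k \<le> n then l ! k else d + real (k - Suc n))" for k
  have mono_l: "l ! j \<le> l ! k" if "j \<le> k" "k \<le> n" for j k
    using that l(2) n by (auto simp: sorted_iff_nth_mono)
  have ran: "\<exists>k\<le>n. \<tau> k = s" if "s \<in> T" for s
  proof -
    have "s \<in> set l" using that l(1) by simp
    then obtain k where "k < length l" "l ! k = s" unfolding in_set_conv_nth by blast
    then show ?thesis using n by (intro exI[of _ k]) (auto simp: \<tau>_def)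
  qed
  have bounds: "0 \<le> l ! k" "l ! k \<le> c" if "k \<le> n" for k
  proof -
    have "l ! k \<in> T" using that n l(1) by (metis le_imp_less_Suc nth_mem)
    then show "0 \<le> l ! k" "l ! k \<le> c" using assms by (auto simp: T_def)
  qed
  have "\<tau> 0 = 0"
  proof -
    obtain k where "k \<le> n" "\<tau> k = 0" using ran[of 0] by (auto simp: T_def)
    then show ?thesis using mono_l[of 0 k] bounds(1)[of 0] by (auto simp: \<tau>_def)
  qed
  moreover have \<tau>n: "\<tau> n = c"
  proof -
    obtain k where "k \<le> n" "\<tau> k = c" using ran[of c] by (auto simp: T_def)
    then show ?thesis using mono_l[of k n] bounds(2)[of n] by (auto simp: \<tau>_def)
  qed
  moreover have "\<tau> (Suc n) = d" by (simp add: \<tau>_def)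
  moreover have "strict_mono \<tau>"
    unfolding strict_mono_Suc_iff
  proof
    fix k
    consider "Suc k \<le> n" | "k = n" | "n < k" by linarith
    then show "\<tau> k < \<tau> (Suc k)"
    proof cases
      case 1
      then have "l ! k \<noteq> l ! Suc k" using l(3) n by (simp add: nth_eq_iff_index_eq)
      then show ?thesis using mono_l[of k "Suc k"] 1 by (auto simp: \<tau>_def)
    next
      case 2 then show ?thesis using \<tau>n \<open>\<tau> (Suc n) = d\<close> assms by simp
    next
      case 3 then show ?thesis by (auto simp: \<tau>_def)
    qed
  qed
  ultimately show ?thesis using ran that[of \<tau> n] by (auto simp: T_def)
qed

text \<open>
  The path starts at 0, so its values up to time \<open>c\<close> are sums of increments over a grid, and these are
  independent of the increment over the next grid interval \<open>[c, d]\<close>.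
\<close>

lemma cylinder_indep_increment:
  assumes S: "finite S" "S \<subseteq> {0..c}" and c: "0 \<le> c" "c < d"
    and A: "A \<in> cylinders S" and C: "C \<in> sets borel"
  shows "prob (A \<inter> (incr i c d -` C \<inter> space P)) = prob A * prob (incr i c d -` C \<inter> space P)"
proof -
  obtain \<tau> n where \<tau>: "strict_mono \<tau>" "\<tau> 0 = 0" "\<tau> n = c" "\<tau> (Suc n) = d"
    "\<And>s. s \<in> S \<Longrightarrow> \<exists>k\<le>n. \<tau> k = s" using finite_time_grid[OF S c] by metis
  define idx where "idx s = (SOME k. k \<le> n \<and> \<tau> k = s)" for s
  have idx: "idx s \<le> n" "\<tau> (idx s) = s" if "s \<in> S" for s
    using someI_ex[OF \<tau>(5)[OF that]] by (auto simp: idx_def)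
  obtain B where B: "A = (\<lambda>\<omega>. restrict \<omega> S) -` B \<inter> space P" "B \<in> sets (Pi\<^sub>M S (\<lambda>_. borel))"
    using A by (auto simp: cylinders_def)
  define X where "X p = incr (snd p) (\<tau> (fst p)) (\<tau> (Suc (fst p)))" for p :: "nat \<times> 'd"
  define I where "I = {..<n} \<times> (UNIV :: 'd set)"
  have ind: "indep_vars (\<lambda>_. borel) X ({..<Suc n} \<times> UNIV)"
    unfolding X_def by (rule indep_increments_grid[OF \<tau>(1)])
  have iv: "indep_var (Pi\<^sub>M I (\<lambda>_. borel)) (\<lambda>\<omega>. restrict (\<lambda>p. X p \<omega>) I)
      (Pi\<^sub>M {(n, i)} (\<lambda>_. borel)) (\<lambda>\<omega>. restrict (\<lambda>p. X p \<omega>) {(n, i)})"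
    by (rule indep_var_restrict[OF ind]) (auto simp: I_def)
  define Y where "Y v = (\<lambda>s\<in>S. \<chi> j. \<Sum>k<idx s. v (k, j))" for v :: "nat \<times> 'd \<Rightarrow> real"
  have Ym: "Y \<in> measurable (Pi\<^sub>M I (\<lambda>_. borel)) (Pi\<^sub>M S (\<lambda>_. borel))"
    unfolding Y_def
  proof (rule measurable_restrict)
    fix s assume s: "s \<in> S"
    show "(\<lambda>v. (\<chi> j. \<Sum>k<idx s. v (k, j)) :: real^'d) \<in> borel_measurable (Pi\<^sub>M I (\<lambda>_. borel))"
      unfolding borel_measurable_euclidean_space[where 'c="real^'d"]
    proof
      fix b :: "real^'d" assume "b \<in> Basis"
      then obtain j where b: "b = axis j 1" by (auto simp: Basis_vec_def)
      have "(\<lambda>v. \<Sum>k<idx s. v (k, j)) \<in> borel_measurable (Pi\<^sub>M I (\<lambda>_. borel :: real measure))"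
        using idx(1)[OF s] by (intro borel_measurable_sum measurable_component_singleton) (auto simp: I_def)
      then show "(\<lambda>v. (\<chi> j. \<Sum>k<idx s. v (k, j)) \<bullet> b) \<in> borel_measurable (Pi\<^sub>M I (\<lambda>_. borel :: real measure))"
        by (simp add: b inner_axis)
    qed
  qed
  have tel: "restrict \<omega> S = Y (restrict (\<lambda>p. X p \<omega>) I)" if "\<omega> \<in> space P" for \<omega>
  proof
    fix s show "restrict \<omega> S s = Y (restrict (\<lambda>p. X p \<omega>) I) s"
    proof (cases "s \<in> S")
      case s: True
      have "(\<Sum>k<idx s. restrict (\<lambda>p. X p \<omega>) I (k, j)) = \<omega> s $ j" for j
      proof -
        have "(\<Sum>k<idx s. restrict (\<lambda>p. X p \<omega>) I (k, j)) = (\<Sum>k<idx s. \<omega> (\<tau> (Suc k)) $ j - \<omega> (\<tau> k) $ j)"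
          using idx(1)[OF s] by (intro sum.cong) (auto simp: I_def X_def incr_def)
        also have "\<dots> = \<omega> (\<tau> (idx s)) $ j - \<omega> (\<tau> 0) $ j" by (rule sum_lessThan_telescope)
        finally show ?thesis using idx(2)[OF s] \<tau>(2) path_start[OF that] by simp
      qed
      then show ?thesis using s by (simp add: Y_def vec_eq_iff)
    qed (simp add: Y_def)
  qed
  define A' where "A' = Y -` B \<inter> space (Pi\<^sub>M I (\<lambda>_. borel :: real measure))"
  define C' where "C' = (\<lambda>v. v (n, i)) -` C \<inter> space (Pi\<^sub>M {(n, i)} (\<lambda>_. borel :: real measure))"
  have m: "A' \<in> sets (Pi\<^sub>M I (\<lambda>_. borel))" "C' \<in> sets (Pi\<^sub>M {(n, i)} (\<lambda>_. borel))"
    unfolding A'_def C'_def using measurable_sets[OF Ym B(2)] C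
    by (auto intro!: measurable_sets[OF measurable_component_singleton])
  have e1: "(\<lambda>\<omega>. restrict (\<lambda>p. X p \<omega>) I) -` A' \<inter> space P = A"
    unfolding A'_def B(1) using tel by (auto simp: space_PiM)
  have e2: "(\<lambda>\<omega>. restrict (\<lambda>p. X p \<omega>) {(n, i)}) -` C' \<inter> space P = incr i c d -` C \<inter> space P"
    unfolding C'_def using \<tau>(3,4) by (auto simp: space_PiM X_def)
  have e3: "(\<lambda>\<omega>. (restrict (\<lambda>p. X p \<omega>) I, restrict (\<lambda>p. X p \<omega>) {(n, i)})) -` (A' \<times> C') \<inter> space P
      = A \<inter> (incr i c d -` C \<inter> space P)"
    unfolding e1[symmetric] e2[symmetric] by auto
  show ?thesis using indep_varD[OF iv m] unfolding e1 e2 e3 .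
qed

text \<open>
  A \<open>\<pi>\<close>-system argument: the events that agree with a cylinder event up to a null set generate the
  augmented filtration, and they are independent of the increment.
\<close>

lemma past_indep_increment:
  assumes c: "0 \<le> c" "c < d" and Z: "Z \<in> borel_measurable (F c)"
  shows "indep_var borel Z borel (incr i c d)"
proof -
  \<comment> \<open>Null sets belong to the filtration, so cylinder events are taken modulo null sets.\<close>
  define \<D> where "\<D> = {A \<in> events. \<exists>S. finite S \<and> S \<subseteq> {0..c} \<and> (\<exists>A'\<in>cylinders S. (A - A') \<union> (A' - A) \<in> null_sets P)}"
  define G where "G = {incr i c d -` C \<inter> space P | C. C \<in> sets (borel :: real measure)}"
  have G: "G \<subseteq> events" by (auto simp: G_def)
  have "indep_set \<D> G"
  proof (rule indep_setI)
    fix A D assume "A \<in> \<D>" "D \<in> G"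
    then obtain S A' C where S: "finite S" "S \<subseteq> {0..c}" "A' \<in> cylinders S" "(A - A') \<union> (A' - A) \<in> null_sets P"
      and D: "D = incr i c d -` C \<inter> space P" "C \<in> sets borel" and A: "A \<in> events"
      by (auto simp: \<D>_def G_def)
    have A': "A' \<in> events" using S(3) cylinders_events by auto
    have De: "D \<in> events" using \<open>D \<in> G\<close> G by auto
    have ae: "AE \<omega> in P. \<omega> \<in> A \<longleftrightarrow> \<omega> \<in> A'"
      by (rule AE_I'[OF S(4)]) auto
    have "prob A = prob A'" using A A' ae by (intro finite_measure_eq_AE) auto
    moreover have "prob (A \<inter> D) = prob (A' \<inter> D)" using A A' De ae by (intro finite_measure_eq_AE) auto
    ultimately show "prob (A \<inter> D) = prob A * prob D"
      using cylinder_indep_increment[OF S(1,2) c S(3) D(2)] D(1) by simp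
  qed (use G in \<open>auto simp: \<D>_def\<close>)
  moreover have "Int_stable \<D>"
  proof (rule Int_stableI)
    fix A1 A2 assume "A1 \<in> \<D>" "A2 \<in> \<D>"
    then obtain S1 S2 B1 B2 where *: "A1 \<in> events" "A2 \<in> events" "finite S1" "S1 \<subseteq> {0..c}" "finite S2" "S2 \<subseteq> {0..c}"
      "B1 \<in> cylinders S1" "B2 \<in> cylinders S2" "(A1 - B1) \<union> (B1 - A1) \<in> null_sets P" "(A2 - B2) \<union> (B2 - A2) \<in> null_sets P"
      by (auto simp: \<D>_def)
    have "B1 \<in> cylinders (S1 \<union> S2)" "B2 \<in> cylinders (S1 \<union> S2)"
      using *(7,8) cylinders_mono[of S1 "S1 \<union> S2"] cylinders_mono[of S2 "S1 \<union> S2"] by auto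
    then have B: "B1 \<inter> B2 \<in> cylinders (S1 \<union> S2)" by (rule cylinders_Int)
    have Be: "B1 \<in> events" "B2 \<in> events" using *(7,8) cylinders_events by blast+
    have "(A1 \<inter> A2 - B1 \<inter> B2) \<union> (B1 \<inter> B2 - A1 \<inter> A2) \<in> null_sets P"
      by (rule null_sets_subset[OF null_sets.Un[OF *(9,10)]])
        (use *(1,2) Be in auto)
    then show "A1 \<inter> A2 \<in> \<D>" using * B unfolding \<D>_def
      by (intro CollectI conjI exI[of _ "S1 \<union> S2"] bexI[of _ "B1 \<inter> B2"]) auto
  qed
  moreover have "Int_stable G"
  proof (rule Int_stableI)
    fix A B assume "A \<in> G" "B \<in> G"
    then obtain C D where "A = incr i c d -` C \<inter> space P" "B = incr i c d -` D \<inter> space P" "C \<in> sets borel" "D \<in> sets borel"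
      by (auto simp: G_def)
    then show "A \<inter> B \<in> G" unfolding G_def by (intro CollectI exI[of _ "C \<inter> D"]) auto
  qed
  ultimately have ind: "indep_set (sigma_sets (space P) \<D>) (sigma_sets (space P) G)"
    by (rule indep_set_sigma_sets)
  have gen: "filtration_generator c \<subseteq> \<D>"
  proof
    fix A assume A: "A \<in> filtration_generator c"
    then have Ae: "A \<in> events" using filtration_generator_events by auto
    consider s B where "A = (\<lambda>\<omega>. \<omega> s) -` B \<inter> space P" "0 \<le> s" "s \<le> c" "B \<in> sets borel" | "A \<in> null_sets P"
      using A by (auto simp: filtration_generator_def)
    then show "A \<in> \<D>"
    proof cases
      case (1 s B)
      have "(\<lambda>f. f s) -` B \<inter> space (Pi\<^sub>M {s} (\<lambda>_. borel)) \<in> sets (Pi\<^sub>M {s} (\<lambda>_. borel :: (real^'d) measure))"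
        using 1(4) by (intro measurable_sets[OF measurable_component_singleton]) auto
      moreover have "A = (\<lambda>\<omega>. restrict \<omega> {s}) -` ((\<lambda>f. f s) -` B \<inter> space (Pi\<^sub>M {s} (\<lambda>_. borel))) \<inter> space P"
        using 1(1) by (auto simp: space_PiM)
      ultimately have "A \<in> cylinders {s}" unfolding cylinders_def by blast
      then show ?thesis unfolding \<D>_def using 1 Ae by (intro CollectI conjI exI[of _ "{s}"] bexI[of _ A]) auto
    next
      case 2
      have "{} \<in> cylinders {}" unfolding cylinders_def by (intro CollectI exI[of _ "{}"]) auto
      then show ?thesis unfolding \<D>_def using 2 Ae by (intro CollectI conjI exI[of _ "{}"] bexI[of _ "{}"]) auto
    qed
  qed
  have Zsub: "sigma_sets (space P) {Z -` A \<inter> space P | A. A \<in> sets borel} \<subseteq> sigma_sets (space P) \<D>"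
  proof (rule sigma_sets_mono)
    show "{Z -` A \<inter> space P | A. A \<in> sets borel} \<subseteq> sigma_sets (space P) \<D>"
    proof clarify
      fix A :: "real set" assume "A \<in> sets borel"
      then have "Z -` A \<inter> space (F c) \<in> sets (F c)" using Z by (rule measurable_sets[rotated])
      then show "Z -` A \<inter> space P \<in> sigma_sets (space P) \<D>"
        unfolding sets_F using sigma_sets_mono'[OF gen] by auto
    qed
  qed
  show ?thesis
    unfolding indep_var_eq
  proof (intro conjI)
    show "indep_set (sigma_sets (space P) {Z -` A \<inter> space P | A. A \<in> sets borel})
        (sigma_sets (space P) {incr i c d -` A \<inter> space P | A. A \<in> sets borel})"
      using ind unfolding indep_set_def G_def
      by (rule indep_sets_mono_sets) (use Zsub in \<open>auto split: bool.split\<close>)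
  qed (use F_imp_P[OF Z] in auto)
qed

lemma increment_moments:
  assumes "s < t"
  shows "integrable P (incr i s t)" "expectation (incr i s t) = 0"
    "integrable P (\<lambda>\<omega>. (incr i s t \<omega>)\<^sup>2)" "expectation (\<lambda>\<omega>. (incr i s t \<omega>)\<^sup>2) = t - s"
proof -
  have \<sigma>: "0 < sqrt (t - s)" using assms by simp
  have D: "distributed P lborel (incr i s t) (normal_density 0 (sqrt (t - s)))"
    using wiener assms unfolding incr_def wiener_measure_def by simp
  show i1: "integrable P (incr i s t)"
    using integrable_normal_moment_nz_1[OF \<sigma>, of 0] distributed_integrable[OF D, of "\<lambda>x. x"] by simp
  show e: "expectation (incr i s t) = 0"
    by (rule normal_distributed_expectation[OF \<sigma> D])
  show "integrable P (\<lambda>\<omega>. (incr i s t \<omega>)\<^sup>2)"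
    using integrable_normal_moment[OF \<sigma>, of 0 2] distributed_integrable[OF D, of "\<lambda>x. x\<^sup>2"] by simp
  show "expectation (\<lambda>\<omega>. (incr i s t \<omega>)\<^sup>2) = t - s"
    using normal_distributed_variance[OF \<sigma> D] e assms by simp
qed

text \<open>
  The two moment formulas on which the isometry and the martingale property rest: given the past, an
  increment has mean 0 and variance \<open>d - c\<close>.
\<close>

lemma past_times_increment:
  assumes Y: "Y \<in> borel_measurable (F c)" "integrable P Y" and c: "0 \<le> c" "c \<le> d"
  shows "integrable P (\<lambda>\<omega>. Y \<omega> * incr i c d \<omega>)" "expectation (\<lambda>\<omega>. Y \<omega> * incr i c d \<omega>) = 0"
    "integrable P (\<lambda>\<omega>. Y \<omega> * (incr i c d \<omega>)\<^sup>2)"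
    "expectation (\<lambda>\<omega>. Y \<omega> * (incr i c d \<omega>)\<^sup>2) = expectation Y * (d - c)"
proof -
  have "integrable P (\<lambda>\<omega>. Y \<omega> * incr i c d \<omega>) \<and> expectation (\<lambda>\<omega>. Y \<omega> * incr i c d \<omega>) = 0 \<and>
    integrable P (\<lambda>\<omega>. Y \<omega> * (incr i c d \<omega>)\<^sup>2) \<and>
    expectation (\<lambda>\<omega>. Y \<omega> * (incr i c d \<omega>)\<^sup>2) = expectation Y * (d - c)"
  proof (cases "c = d")
    case False
    then have cd: "c < d" using c by simp
    note ind = past_indep_increment[OF c(1) cd Y(1), of i]
    have "indep_var borel ((\<lambda>x. x) \<circ> Y) borel ((\<lambda>x. x\<^sup>2) \<circ> incr i c d)"
      by (rule indep_var_compose[OF ind]) auto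
    then have ind2: "indep_var borel Y borel (\<lambda>\<omega>. (incr i c d \<omega>)\<^sup>2)" by (simp add: comp_def)
    note m = increment_moments[OF cd, of i]
    show ?thesis
      using indep_var_integrable[OF ind Y(2) m(1)] indep_var_lebesgue_integral[OF ind Y(2) m(1)]
        indep_var_integrable[OF ind2 Y(2) m(3)] indep_var_lebesgue_integral[OF ind2 Y(2) m(3)] m(2,4) by simp
  qed simp
  then show "integrable P (\<lambda>\<omega>. Y \<omega> * incr i c d \<omega>)" "expectation (\<lambda>\<omega>. Y \<omega> * incr i c d \<omega>) = 0"
    "integrable P (\<lambda>\<omega>. Y \<omega> * (incr i c d \<omega>)\<^sup>2)"
    "expectation (\<lambda>\<omega>. Y \<omega> * (incr i c d \<omega>)\<^sup>2) = expectation Y * (d - c)" by auto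
qed

end

section \<open>Simple integrands and the Ito isometry\<close>

context wiener
begin

text \<open>
  Bounded random variables that are measurable with respect to the past of time \<open>s\<close>: the admissible values of a
  simple integrand, and the test variables in the martingale property.
\<close>

definition bounded_F :: "real \<Rightarrow> ('d path \<Rightarrow> real) set" where
  "bounded_F s = {Z \<in> borel_measurable (F s). \<exists>c. \<forall>\<omega>\<in>space P. \<bar>Z \<omega>\<bar> \<le> c}"

lemma bounded_F_measurable: "Z \<in> bounded_F s \<Longrightarrow> Z \<in> borel_measurable (F s)"
  by (simp add: bounded_F_def)

lemma bounded_F_mult:
  assumes "Y \<in> bounded_F s" "Z \<in> bounded_F t" "s \<le> u" "t \<le> u" shows "(\<lambda>\<omega>. Y \<omega> * Z \<omega>) \<in> bounded_F u"
proof -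
  note [measurable] = F_mono[OF assms(3) bounded_F_measurable[OF assms(1)]] F_mono[OF assms(4) bounded_F_measurable[OF assms(2)]]
  obtain c c' where c: "\<And>\<omega>. \<omega> \<in> space P \<Longrightarrow> \<bar>Y \<omega>\<bar> \<le> c" "\<And>\<omega>. \<omega> \<in> space P \<Longrightarrow> \<bar>Z \<omega>\<bar> \<le> c'"
    using assms(1,2) by (auto simp: bounded_F_def)
  have "\<bar>Y \<omega> * Z \<omega>\<bar> \<le> c * c'" if "\<omega> \<in> space P" for \<omega>
    using c(1)[OF that] c(2)[OF that] unfolding abs_mult by (intro mult_mono) auto
  then show ?thesis unfolding bounded_F_def by auto
qed

lemma bounded_F_integrable:
  assumes "Z \<in> bounded_F s" shows "integrable P Z"
proof -
  note [measurable] = F_imp_P[OF bounded_F_measurable[OF assms]]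
  obtain c where "\<And>\<omega>. \<omega> \<in> space P \<Longrightarrow> \<bar>Z \<omega>\<bar> \<le> c" using assms by (auto simp: bounded_F_def)
  then show ?thesis by (intro integrable_const_bound[of _ c]) auto
qed

lemma bounded_F_mono: "Z \<in> bounded_F s \<Longrightarrow> s \<le> t \<Longrightarrow> Z \<in> bounded_F t"
  unfolding bounded_F_def using F_mono by auto

text \<open>
  The length of the intersection of the intervals \<open>(a, b]\<close> and \<open>(c, d]\<close>.
\<close>

definition overlap :: "real \<Rightarrow> real \<Rightarrow> real \<Rightarrow> real \<Rightarrow> real" where
  "overlap a b c d = max 0 (min b d - max a c)"

lemma past_times_earlier_increment:
  assumes Y: "Y \<in> bounded_F c" and "0 \<le> a" "a \<le> c" and ab: "0 \<le> b" "b \<le> c" and cd: "c \<le> d"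
  shows "integrable P (\<lambda>\<omega>. Y \<omega> * incr i a b \<omega> * incr i c d \<omega>)"
    "expectation (\<lambda>\<omega>. Y \<omega> * incr i a b \<omega> * incr i c d \<omega>) = 0"
proof -
  have c0: "0 \<le> c" using assms by linarith
  note m = bounded_F_measurable[OF Y] incr_measurable_F[OF \<open>0 \<le> a\<close> \<open>a \<le> c\<close> ab, of i]
  have "(\<lambda>\<omega>. Y \<omega> * incr i a b \<omega>) \<in> borel_measurable (F c)" using m by measurable
  moreover have "integrable P (\<lambda>\<omega>. Y \<omega> * incr i a b \<omega>)"
  proof -
    obtain k where k: "\<And>\<omega>. \<omega> \<in> space P \<Longrightarrow> \<bar>Y \<omega>\<bar> \<le> k" using Y by (auto simp: bounded_F_def)
    have "integrable P (incr i a b)"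
    proof -
      consider "a < b" | "a = b" | "b < a" by linarith
      then show ?thesis
      proof cases
        case 3
        have "incr i a b = (\<lambda>\<omega>. - incr i b a \<omega>)" by (simp add: incr_def fun_eq_iff)
        then show ?thesis using increment_moments(1)[OF 3, of i] by simp
      qed (use increment_moments(1) in auto)
    qed
    then have "integrable P (\<lambda>\<omega>. k * incr i a b \<omega>)" by simp
    then show ?thesis
      by (rule Bochner_Integration.integrable_bound)
        (use F_imp_P[OF m(1)] in \<open>auto simp: abs_mult intro!: mult_right_mono order_trans[OF k]\<close>)
  qed
  ultimately show "integrable P (\<lambda>\<omega>. Y \<omega> * incr i a b \<omega> * incr i c d \<omega>)"
    "expectation (\<lambda>\<omega>. Y \<omega> * incr i a b \<omega> * incr i c d \<omega>) = 0"
    using past_times_increment(1,2)[OF _ _ c0 cd] by auto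
qed

text \<open>
  The isometry for a pair of one-step integrands. Splitting both increments at the endpoints of the two
  intervals leaves products of an increment with something that is known before it starts, which have mean 0, and
  the square of the increment over the common interval.
\<close>

lemma increments_covariance:
  assumes \<xi>: "\<xi> \<in> bounded_F a" and \<eta>: "\<eta> \<in> bounded_F c" and ab: "0 \<le> a" "a \<le> b" and cd: "0 \<le> c" "c \<le> d"
  shows "integrable P (\<lambda>\<omega>. (\<xi> \<omega> * incr i a b \<omega>) * (\<eta> \<omega> * incr i c d \<omega>))"
    "expectation (\<lambda>\<omega>. (\<xi> \<omega> * incr i a b \<omega>) * (\<eta> \<omega> * incr i c d \<omega>)) =
      expectation (\<lambda>\<omega>. \<xi> \<omega> * \<eta> \<omega>) * overlap a b c d"
proof -
  have same: "integrable P (\<lambda>\<omega>. Y \<omega> * incr i c b \<omega> * incr i c d \<omega>) \<and>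
      expectation (\<lambda>\<omega>. Y \<omega> * incr i c b \<omega> * incr i c d \<omega>) = expectation Y * (b - c)"
    if Y: "Y \<in> bounded_F c" and "0 \<le> c" "c \<le> b" "b \<le> d" for Y b c d
  proof -
    note p = past_times_increment(3,4)[OF bounded_F_measurable[OF Y] bounded_F_integrable[OF Y] that(2,3), of i]
    have q: "integrable P (\<lambda>\<omega>. Y \<omega> * incr i c b \<omega> * incr i b d \<omega>)"
      "expectation (\<lambda>\<omega>. Y \<omega> * incr i c b \<omega> * incr i b d \<omega>) = 0"
      using past_times_earlier_increment[OF bounded_F_mono[OF Y \<open>c \<le> b\<close>], of c b d i] that by auto
    have "(\<lambda>\<omega>. Y \<omega> * incr i c b \<omega> * incr i c d \<omega>)
        = (\<lambda>\<omega>. Y \<omega> * (incr i c b \<omega>)\<^sup>2 + Y \<omega> * incr i c b \<omega> * incr i b d \<omega>)"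
      unfolding incr_split[of i c d _ b] by (simp add: fun_eq_iff algebra_simps power2_eq_square)
    then show ?thesis using p q by simp
  qed
  have main: "integrable P (\<lambda>\<omega>. (\<xi> \<omega> * incr i a b \<omega>) * (\<eta> \<omega> * incr i c d \<omega>)) \<and>
    expectation (\<lambda>\<omega>. (\<xi> \<omega> * incr i a b \<omega>) * (\<eta> \<omega> * incr i c d \<omega>)) =
      expectation (\<lambda>\<omega>. \<xi> \<omega> * \<eta> \<omega>) * overlap a b c d"
    if \<xi>: "\<xi> \<in> bounded_F a" and \<eta>: "\<eta> \<in> bounded_F c" and ab: "0 \<le> a" "a \<le> b" and cd: "0 \<le> c" "c \<le> d"
      and ac: "a \<le> c" for \<xi> \<eta> a b c d
  proof -
    define Y where "Y \<omega> = \<xi> \<omega> * \<eta> \<omega>" for \<omega>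
    have Y: "Y \<in> bounded_F c" unfolding Y_def using bounded_F_mult[OF \<xi> \<eta> ac order_refl] .
    have eq: "(\<lambda>\<omega>. (\<xi> \<omega> * incr i a b \<omega>) * (\<eta> \<omega> * incr i c d \<omega>)) = (\<lambda>\<omega>. Y \<omega> * incr i a b \<omega> * incr i c d \<omega>)"
      by (simp add: Y_def fun_eq_iff)
    show ?thesis
    proof (cases "b \<le> c")
      case True
      then show ?thesis unfolding eq
        using past_times_earlier_increment[OF Y ab(1) ac _ True cd(2), of i] ab ac cd by (simp add: overlap_def)
    next
      case False
      have p: "integrable P (\<lambda>\<omega>. Y \<omega> * incr i a c \<omega> * incr i c d \<omega>)"
        "expectation (\<lambda>\<omega>. Y \<omega> * incr i a c \<omega> * incr i c d \<omega>) = 0"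
        using past_times_earlier_increment[OF Y ab(1) ac cd(1) order_refl cd(2), of i] by auto
      have q: "integrable P (\<lambda>\<omega>. Y \<omega> * incr i c b \<omega> * incr i c d \<omega>) \<and>
          expectation (\<lambda>\<omega>. Y \<omega> * incr i c b \<omega> * incr i c d \<omega>) = expectation Y * (min b d - c)"
      proof (cases "b \<le> d")
        case True then show ?thesis using same[OF Y cd(1), of b d] False by (simp add: min_def)
      next
        case b: False
        have "(\<lambda>\<omega>. Y \<omega> * incr i c b \<omega> * incr i c d \<omega>) = (\<lambda>\<omega>. Y \<omega> * incr i c d \<omega> * incr i c b \<omega>)"
          by (simp add: fun_eq_iff)
        then show ?thesis using same[OF Y cd(1,2), of b] b by (simp add: min_def)
      qed
      have "(\<lambda>\<omega>. Y \<omega> * incr i a b \<omega> * incr i c d \<omega>)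
          = (\<lambda>\<omega>. Y \<omega> * incr i a c \<omega> * incr i c d \<omega> + Y \<omega> * incr i c b \<omega> * incr i c d \<omega>)"
        unfolding incr_split[of i a b _ c] by (simp add: fun_eq_iff algebra_simps)
      moreover have "overlap a b c d = min b d - c" using False ac cd by (auto simp: overlap_def max_def min_def)
      ultimately show ?thesis unfolding eq using p q by (simp add: Y_def[abs_def])
    qed
  qed
  have "integrable P (\<lambda>\<omega>. (\<xi> \<omega> * incr i a b \<omega>) * (\<eta> \<omega> * incr i c d \<omega>)) \<and>
    expectation (\<lambda>\<omega>. (\<xi> \<omega> * incr i a b \<omega>) * (\<eta> \<omega> * incr i c d \<omega>)) =
      expectation (\<lambda>\<omega>. \<xi> \<omega> * \<eta> \<omega>) * overlap a b c d"
  proof (cases "a \<le> c")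
    case True then show ?thesis using main[OF \<xi> \<eta> ab cd] by simp
  next
    case False
    then show ?thesis using main[OF \<eta> \<xi> cd ab]
      by (simp add: overlap_def mult.commute max.commute min.commute)
  qed
  then show "integrable P (\<lambda>\<omega>. (\<xi> \<omega> * incr i a b \<omega>) * (\<eta> \<omega> * incr i c d \<omega>))"
    "expectation (\<lambda>\<omega>. (\<xi> \<omega> * incr i a b \<omega>) * (\<eta> \<omega> * incr i c d \<omega>)) =
      expectation (\<lambda>\<omega>. \<xi> \<omega> * \<eta> \<omega>) * overlap a b c d" by auto
qed

abbreviation "Q \<equiv> P \<Otimes>\<^sub>M (lborel :: real measure)"

sublocale PQ: pair_sigma_finite P "lborel :: real measure" ..

definition adapted_list :: "'d simple_integrand \<Rightarrow> bool" where
  "adapted_list L \<longleftrightarrow> (\<forall>(a, b, \<xi>)\<in>set L. 0 \<le> a \<and> a \<le> b \<and> \<xi> \<in> bounded_F a)"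

definition ito_sum :: "'d \<Rightarrow> 'd simple_integrand \<Rightarrow> 'd path \<Rightarrow> real" where
  "ito_sum i L \<omega> = (\<Sum>(a, b, \<xi>)\<leftarrow>L. \<xi> \<omega> * incr i a b \<omega>)"

definition step_fun :: "'d simple_integrand \<Rightarrow> 'd path \<times> real \<Rightarrow> real" where
  "step_fun L = (\<lambda>(\<omega>, s). \<Sum>(a, b, \<xi>)\<leftarrow>L. \<xi> \<omega> * indicator {a<..b} s)"

lemma adapted_list_Nil [simp]: "adapted_list []"
  and adapted_list_Cons [simp]: "adapted_list ((a, b, \<xi>) # L) \<longleftrightarrow> 0 \<le> a \<and> a \<le> b \<and> \<xi> \<in> bounded_F a \<and> adapted_list L"
  and adapted_list_append [simp]: "adapted_list (L @ L') \<longleftrightarrow> adapted_list L \<and> adapted_list L'"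
  by (simp_all add: adapted_list_def ball_Un)

lemma ito_sum_Nil [simp]: "ito_sum i [] \<omega> = 0"
  and ito_sum_Cons [simp]: "ito_sum i ((a, b, \<xi>) # L) \<omega> = \<xi> \<omega> * incr i a b \<omega> + ito_sum i L \<omega>"
  and ito_sum_append [simp]: "ito_sum i (L @ L') \<omega> = ito_sum i L \<omega> + ito_sum i L' \<omega>"
  by (auto simp: ito_sum_def)

lemma step_fun_Nil [simp]: "step_fun [] p = 0"
  and step_fun_Cons [simp]: "step_fun ((a, b, \<xi>) # L) p = \<xi> (fst p) * indicator {a<..b} (snd p) + step_fun L p"
  and step_fun_append [simp]: "step_fun (L @ L') p = step_fun L p + step_fun L' p"
  by (auto simp: step_fun_def split_beta)

lemma ito_sum_measurable: "adapted_list L \<Longrightarrow> ito_sum i L \<in> borel_measurable P"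
proof (induction L)
  case Nil then show ?case by (simp add: ito_sum_def)
next
  case (Cons p L)
  obtain a b \<xi> where p: "p = (a, b, \<xi>)" by (cases p)
  have [measurable]: "\<xi> \<in> borel_measurable P" "ito_sum i L \<in> borel_measurable P"
    using Cons p F_imp_P[OF bounded_F_measurable] by auto
  show ?case unfolding p by (subst measurable_cong[OF ito_sum_Cons]) measurable
qed

lemma step_fun_measurable: "adapted_list L \<Longrightarrow> step_fun L \<in> borel_measurable Q"
proof (induction L)
  case Nil then show ?case by (simp add: step_fun_def)
next
  case (Cons p L)
  obtain a b \<xi> where p: "p = (a, b, \<xi>)" by (cases p)
  have [measurable]: "\<xi> \<in> borel_measurable P" "step_fun L \<in> borel_measurable Q"
    using Cons p F_imp_P[OF bounded_F_measurable] by auto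
  show ?case unfolding p by (subst measurable_cong[OF step_fun_Cons]) measurable
qed

text \<open>
  The counterpart of \<open>increments_covariance\<close> in \<open>L\<^sup>2\<close> of the product of \<open>P\<close> and Lebesgue measure.
\<close>

lemma step_covariance:
  assumes \<xi>: "\<xi> \<in> bounded_F a" and \<eta>: "\<eta> \<in> bounded_F c"
  shows "integrable Q (\<lambda>p. (\<xi> (fst p) * indicator {a<..b} (snd p)) * (\<eta> (fst p) * indicator {c<..d} (snd p)))"
    "(\<integral>p. (\<xi> (fst p) * indicator {a<..b} (snd p)) * (\<eta> (fst p) * indicator {c<..d} (snd p)) \<partial>Q) =
      expectation (\<lambda>\<omega>. \<xi> \<omega> * \<eta> \<omega>) * overlap a b c d"
proof -
  define Y where "Y \<omega> = \<xi> \<omega> * \<eta> \<omega>" for \<omega>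
  define I where "I = {max a c<..min b d}"
  have Y: "Y \<in> bounded_F (max a c)" unfolding Y_def using bounded_F_mult[OF \<xi> \<eta>] by simp
  then have [measurable]: "Y \<in> borel_measurable P" using F_imp_P[OF bounded_F_measurable] by blast
  obtain k where k: "\<And>\<omega>. \<omega> \<in> space P \<Longrightarrow> \<bar>Y \<omega>\<bar> \<le> k" using Y by (auto simp: bounded_F_def)
  have [measurable]: "I \<in> sets borel" by (simp add: I_def)
  have eq: "(\<lambda>p. (\<xi> (fst p) * indicator {a<..b} (snd p)) * (\<eta> (fst p) * indicator {c<..d} (snd p)))
      = (\<lambda>p. Y (fst p) * indicator I (snd p) :: real)"
    by (auto simp: fun_eq_iff Y_def I_def indicator_def)
  have int: "integrable Q (\<lambda>p. Y (fst p) * indicator I (snd p))"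
  proof (rule integrableI_bounded_set[where A="space P \<times> I" and B=k])
    have "emeasure lborel I < \<infinity>" by (rule emeasure_bounded_finite) (simp add: I_def)
    then show "emeasure Q (space P \<times> I) < \<infinity>"
      by (subst lborel.emeasure_pair_measure_Times) (auto simp: emeasure_space_1)
    show "AE p in Q. p \<in> space P \<times> I \<longrightarrow> norm (Y (fst p) * indicator I (snd p)) \<le> k"
      by (rule AE_I2) (auto simp: indicator_def intro: k)
    show "AE p in Q. p \<notin> space P \<times> I \<longrightarrow> Y (fst p) * indicator I (snd p) = 0"
      by (rule AE_I2) (auto simp: indicator_def space_pair_measure)
  qed measurable
  have "(\<integral>p. Y (fst p) * indicator I (snd p) \<partial>Q) = (\<integral>\<omega>. (\<integral>s. Y \<omega> * indicator I s \<partial>lborel) \<partial>P)"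
    using PQ.integral_fst'[OF int] by simp
  also have "\<dots> = (\<integral>\<omega>. Y \<omega> * overlap a b c d \<partial>P)"
  proof -
    have "measure lborel I = overlap a b c d"
      by (cases "max a c \<le> min b d") (auto simp: I_def overlap_def)
    then show ?thesis by simp
  qed
  finally show "(\<integral>p. (\<xi> (fst p) * indicator {a<..b} (snd p)) * (\<eta> (fst p) * indicator {c<..d} (snd p)) \<partial>Q) =
      expectation (\<lambda>\<omega>. \<xi> \<omega> * \<eta> \<omega>) * overlap a b c d"
    unfolding eq by (simp add: Y_def)
  show "integrable Q (\<lambda>p. (\<xi> (fst p) * indicator {a<..b} (snd p)) * (\<eta> (fst p) * indicator {c<..d} (snd p)))"
    unfolding eq by (rule int)
qed

text \<open>
  Polarized, so that both lists can be built up one step at a time by induction.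
\<close>

lemma ito_isometry_bilinear:
  assumes "adapted_list L" "adapted_list L'"
  shows "integrable P (\<lambda>\<omega>. ito_sum i L \<omega> * ito_sum i L' \<omega>) \<and> integrable Q (\<lambda>p. step_fun L p * step_fun L' p) \<and>
    expectation (\<lambda>\<omega>. ito_sum i L \<omega> * ito_sum i L' \<omega>) = (\<integral>p. step_fun L p * step_fun L' p \<partial>Q)"
  using assms(1)
proof (induction L)
  case (Cons p L)
  obtain a b \<xi> where p: "p = (a, b, \<xi>)" by (cases p)
  have one: "integrable P (\<lambda>\<omega>. (\<xi> \<omega> * incr i a b \<omega>) * ito_sum i L' \<omega>) \<and>
    integrable Q (\<lambda>q. (\<xi> (fst q) * indicator {a<..b} (snd q)) * step_fun L' q) \<and>
    expectation (\<lambda>\<omega>. (\<xi> \<omega> * incr i a b \<omega>) * ito_sum i L' \<omega>) =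
      (\<integral>q. (\<xi> (fst q) * indicator {a<..b} (snd q)) * step_fun L' q \<partial>Q)"
    using assms(2)
  proof (induction L')
    case (Cons p' L')
    obtain c d \<eta> where p': "p' = (c, d, \<eta>)" by (cases p')
    have *: "\<xi> \<in> bounded_F a" "\<eta> \<in> bounded_F c" "0 \<le> a" "a \<le> b" "0 \<le> c" "c \<le> d"
      using \<open>adapted_list (p # L)\<close> Cons.prems by (auto simp: p p')
    show ?case
      using Cons increments_covariance[OF *, of i] step_covariance[OF *(1,2), of b d]
      unfolding p' by (simp add: distrib_left)
  qed simp
  show ?case using Cons one unfolding p by (simp add: distrib_right)
qed simp

lemma ito_isometry:
  assumes "adapted_list L"
  shows "integrable P (\<lambda>\<omega>. (ito_sum i L \<omega>)\<^sup>2)" "l2_dist P (ito_sum i L) (\<lambda>_. 0) = l2_dist Q (step_fun L) (\<lambda>_. 0)"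
proof -
  note iso = ito_isometry_bilinear[OF assms assms, of i]
  show "integrable P (\<lambda>\<omega>. (ito_sum i L \<omega>)\<^sup>2)" using iso by (simp add: power2_eq_square)
  show "l2_dist P (ito_sum i L) (\<lambda>_. 0) = l2_dist Q (step_fun L) (\<lambda>_. 0)"
    unfolding l2_dist_def using iso
    by (simp add: power2_eq_square nn_integral_eq_integral)
qed

definition negate :: "'d simple_integrand \<Rightarrow> 'd simple_integrand" where
  "negate = map (\<lambda>(a, b, \<xi>). (a, b, \<lambda>\<omega>. - \<xi> \<omega>))"

lemma bounded_F_uminus: "\<xi> \<in> bounded_F a \<Longrightarrow> (\<lambda>\<omega>. - \<xi> \<omega>) \<in> bounded_F a"
  by (auto simp: bounded_F_def)

lemma adapted_negate: "adapted_list L \<Longrightarrow> adapted_list (negate L)"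
  by (auto simp: adapted_list_def negate_def intro: bounded_F_uminus)

lemma ito_sum_negate [simp]: "ito_sum i (negate L) \<omega> = - ito_sum i L \<omega>"
  by (induction L) (auto simp: negate_def)

lemma step_fun_negate [simp]: "step_fun (negate L) p = - step_fun L p"
  by (induction L) (auto simp: negate_def)

text \<open>
  The integrand restricted to times up to \<open>s\<close>; a triple that starts after \<open>s\<close> has to be removed and not
  merely shortened, since its value is not known at time \<open>s\<close>.
\<close>

definition stop_at :: "real \<Rightarrow> 'd simple_integrand \<Rightarrow> 'd simple_integrand" where
  "stop_at s L = map (\<lambda>(a, b, \<xi>). (a, min b s, \<xi>)) (filter (\<lambda>(a, b, \<xi>). a \<le> s) L)"

lemma adapted_stop_at: "adapted_list L \<Longrightarrow> adapted_list (stop_at s L)"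
  by (auto simp: adapted_list_def stop_at_def)

lemma step_fun_stop_at: "step_fun (stop_at s L) p = step_fun L p * indicator {..s} (snd p)"
  by (induction L) (auto simp: stop_at_def indicator_def)

text \<open>
  Conditional expectation of the integral in weak form: tested against the past of \<open>s\<close>, only the part of the
  integral up to time \<open>s\<close> survives.
\<close>

lemma expectation_stop_at:
  assumes "adapted_list L" and Z: "Z \<in> bounded_F s" and s: "0 \<le> s"
  shows "expectation (\<lambda>\<omega>. Z \<omega> * ito_sum i L \<omega>) = expectation (\<lambda>\<omega>. Z \<omega> * ito_sum i (stop_at s L) \<omega>)
    \<and> integrable P (\<lambda>\<omega>. Z \<omega> * ito_sum i L \<omega>) \<and> integrable P (\<lambda>\<omega>. Z \<omega> * ito_sum i (stop_at s L) \<omega>)"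
  using assms(1)
proof (induction L)
  case (Cons p L)
  obtain a b \<xi> where p: "p = (a, b, \<xi>)" by (cases p)
  have *: "\<xi> \<in> bounded_F a" "0 \<le> a" "a \<le> b" "adapted_list L" using Cons.prems by (auto simp: p)
  note IH = Cons.IH[OF *(4)]
  show ?case
  proof (cases "a \<le> s")
    case False
    have Y: "(\<lambda>\<omega>. Z \<omega> * \<xi> \<omega>) \<in> bounded_F a" using bounded_F_mult[OF Z *(1)] False by simp
    note z = past_times_increment(1,2)[OF bounded_F_measurable[OF Y] bounded_F_integrable[OF Y] *(2,3), of i]
    have "stop_at s (p # L) = stop_at s L" using False by (simp add: stop_at_def p)
    then show ?thesis using IH z by (simp add: p distrib_left mult.assoc)
  next
    case True
    have st: "stop_at s (p # L) = (a, min b s, \<xi>) # stop_at s L" using True by (simp add: stop_at_def p)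
    have Y: "(\<lambda>\<omega>. Z \<omega> * \<xi> \<omega>) \<in> bounded_F s" using bounded_F_mult[OF Z *(1)] True by simp
    have b: "min b s \<le> b" "0 \<le> min b s" "min b s \<le> s" using * True s by auto
    have z2: "integrable P (\<lambda>\<omega>. Z \<omega> * \<xi> \<omega> * incr i (min b s) b \<omega>) \<and>
       expectation (\<lambda>\<omega>. Z \<omega> * \<xi> \<omega> * incr i (min b s) b \<omega>) = 0"
    proof (cases "b \<le> s")
      case True then show ?thesis by (simp add: min_def)
    next
      case False
      then show ?thesis
        using past_times_increment(1,2)[OF bounded_F_measurable[OF Y] bounded_F_integrable[OF Y] s, of b i]
        by (simp add: min_def)
    qed
    have z1: "integrable P (\<lambda>\<omega>. Z \<omega> * \<xi> \<omega> * incr i a (min b s) \<omega>)"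
    proof -
      obtain k where k: "\<And>\<omega>. \<omega> \<in> space P \<Longrightarrow> \<bar>Z \<omega>\<bar> \<le> k" using Z by (auto simp: bounded_F_def)
      have "integrable P (\<lambda>\<omega>. (Z \<omega> * 1) * (\<xi> \<omega> * incr i a (min b s) \<omega>))"
      proof (rule Bochner_Integration.integrable_bound)
        show "integrable P (\<lambda>\<omega>. k * (\<xi> \<omega> * incr i a (min b s) \<omega>))"
          using past_times_increment(1)[OF bounded_F_measurable[OF *(1)] bounded_F_integrable[OF *(1)] *(2), of "min b s" i] * True
          by simp
        show "AE \<omega> in P. norm ((Z \<omega> * 1) * (\<xi> \<omega> * incr i a (min b s) \<omega>)) \<le> norm (k * (\<xi> \<omega> * incr i a (min b s) \<omega>))"
          by (rule AE_I2) (auto simp: abs_mult intro!: mult_right_mono order_trans[OF k])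
        show "(\<lambda>\<omega>. (Z \<omega> * 1) * (\<xi> \<omega> * incr i a (min b s) \<omega>)) \<in> borel_measurable P"
          using F_imp_P[OF bounded_F_measurable[OF *(1)]] F_imp_P[OF bounded_F_measurable[OF Z]] by measurable
      qed
      then show ?thesis by (simp add: mult.assoc)
    qed
    have "(\<lambda>\<omega>. Z \<omega> * ito_sum i (p # L) \<omega>) = (\<lambda>\<omega>. Z \<omega> * \<xi> \<omega> * incr i a (min b s) \<omega> +
        Z \<omega> * \<xi> \<omega> * incr i (min b s) b \<omega> + Z \<omega> * ito_sum i L \<omega>)"
      unfolding p by (simp add: incr_split[of i a b _ "min b s"] fun_eq_iff algebra_simps)
    moreover have "(\<lambda>\<omega>. Z \<omega> * ito_sum i (stop_at s (p # L)) \<omega>) = (\<lambda>\<omega>. Z \<omega> * \<xi> \<omega> * incr i a (min b s) \<omega> +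
        Z \<omega> * ito_sum i (stop_at s L) \<omega>)"
      unfolding st by (simp add: fun_eq_iff algebra_simps)
    ultimately show ?thesis using IH z1 z2 by simp
  qed
qed (simp add: stop_at_def)

end

section \<open>The coordinate processes as Ito integrals\<close>

lemma logistic_bounds:
  fixes y :: real assumes "0 \<le> y" "y \<le> 1"
  shows "0 \<le> y * (1 - y)" "y * (1 - y) \<le> 1"
  using assms mult_le_one[of y "1 - y"] by auto

text \<open>
  On the unit interval the diffusion coefficient has Lipschitz constant 1, because its derivative
  \<open>1 - 2 y\<close> is bounded by 1 there.
\<close>

lemma logistic_lipschitz:
  fixes y z :: real assumes "0 \<le> y" "y \<le> 1" "0 \<le> z" "z \<le> 1"
  shows "\<bar>y * (1 - y) - z * (1 - z)\<bar> \<le> \<bar>y - z\<bar>"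
proof -
  have "y * (1 - y) - z * (1 - z) = (y - z) * (1 - y - z)" by (simp add: algebra_simps)
  moreover have "\<bar>1 - y - z\<bar> \<le> 1" using assms by auto
  ultimately show ?thesis by (simp add: abs_mult mult_left_le)
qed

locale logistic_flow = wiener P
  for P :: "(real \<Rightarrow> real ^ 'd::finite) measure" +
  fixes \<phi> :: "real \<Rightarrow> 'd path \<Rightarrow> real ^ 'd \<Rightarrow> real ^ 'd"
  assumes flow: "sde_flow P \<phi>"
begin

text \<open>
  The \<open>i\<close>-th coordinate of the flow, which depends on the \<open>i\<close>-th coordinate of the starting point only; it is
  read off at the diagonal point.
\<close>

definition X :: "'d \<Rightarrow> real \<Rightarrow> real \<Rightarrow> 'd path \<Rightarrow> real" where
  "X i y t \<omega> = \<phi> t \<omega> (\<chi> j. y) $ i"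

lemma diagonal_in_cube: "y \<in> {0..1} \<Longrightarrow> (\<chi> j. y) \<in> unit_cube"
  by (simp add: unit_cube_def)

lemma coordinate_bijection:
  assumes "\<omega> \<in> space P"
  shows "bij_betw (\<lambda>y. X i y t \<omega>) {0..1} {0..1} \<and> strict_mono_on {0..1} (\<lambda>y. X i y t \<omega>) \<and>
    (\<forall>x\<in>unit_cube. \<phi> t \<omega> x $ i = X i (x $ i) t \<omega>)"
proof -
  obtain f where f: "bij_betw f {0..1} {0..1}" "strict_mono_on {0..1} f" "\<And>x. x \<in> unit_cube \<Longrightarrow> \<phi> t \<omega> x $ i = f (x $ i)"
    using flow assms unfolding sde_flow_def by metis
  have eq: "X i y t \<omega> = f y" if "y \<in> {0..1}" for y
    unfolding X_def using f(3)[OF diagonal_in_cube[OF that]] by simp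
  have "bij_betw (\<lambda>y. X i y t \<omega>) {0..1} {0..1}"
    using f(1) by (subst bij_betw_cong[OF eq]) auto
  moreover have "strict_mono_on {0..1} (\<lambda>y. X i y t \<omega>)"
    by (rule strict_mono_onI) (use eq f(2) in \<open>auto simp: strict_mono_on_def\<close>)
  moreover have "\<phi> t \<omega> x $ i = X i (x $ i) t \<omega>" if "x \<in> unit_cube" for x
    using f(3)[OF that] eq[of "x $ i"] that by (auto simp: unit_cube_def)
  ultimately show ?thesis by blast
qed

lemma X_bounds:
  assumes "\<omega> \<in> space P" "y \<in> {0..1}" shows "0 \<le> X i y t \<omega>" "X i y t \<omega> \<le> 1"
  using coordinate_bijection[OF assms(1), of i t] assms(2) unfolding bij_betw_def by auto

lemma X_mono:
  assumes "\<omega> \<in> space P" "0 \<le> y" "y \<le> z" "z \<le> 1" shows "X i y t \<omega> \<le> X i z t \<omega>"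
proof (cases "y = z")
  case False
  then have "X i y t \<omega> < X i z t \<omega>"
    using coordinate_bijection[OF assms(1), of i t] assms by (intro strict_mono_onD[of "{0..1}" "\<lambda>y. X i y t \<omega>"]) auto
  then show ?thesis by simp
qed simp

lemma rds: "random_dynamical_system P wiener_shift unit_cube \<phi>"
  using flow by (simp add: sde_flow_def)

lemma X_start: "\<omega> \<in> space P \<Longrightarrow> y \<in> {0..1} \<Longrightarrow> X i y 0 \<omega> = y"
proof -
  assume "\<omega> \<in> space P" "y \<in> {0..1}"
  then have "\<phi> 0 \<omega> (\<chi> j. y) = (\<chi> j. y)"
    using rds diagonal_in_cube[of y] unfolding random_dynamical_system_def by blast
  then show ?thesis by (simp add: X_def)
qed

lemma X_continuous:
  assumes "\<omega> \<in> space P" "y \<in> {0..1}" shows "continuous_on UNIV (\<lambda>t. X i y t \<omega>)"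
proof -
  have "continuous_on (UNIV \<times> unit_cube) (\<lambda>(t, x). \<phi> t \<omega> x)"
    using flow assms(1) by (simp add: sde_flow_def)
  then have "continuous_on UNIV (\<lambda>t. (\<lambda>(t, x). \<phi> t \<omega> x) (t, \<chi> j. y))"
    by (rule continuous_on_compose2) (use diagonal_in_cube[OF assms(2)] in \<open>auto intro!: continuous_intros\<close>)
  then show ?thesis unfolding X_def by (auto intro!: continuous_intros)
qed

lemma solves:
  assumes "y \<in> {0..1}"
  shows "solves_ito_sde P F (\<lambda>t \<omega>. \<omega> t $ i) (\<lambda>y. y * (1 - y)) y (X i y)"
proof -
  have "solves_ito_sde P F (\<lambda>t \<omega>. \<omega> t $ i) (\<lambda>y. y * (1 - y)) ((\<chi> j. y) $ i) (\<lambda>t \<omega>. \<phi> t \<omega> (\<chi> j. y) $ i)"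
    using flow diagonal_in_cube[OF assms] unfolding sde_flow_def by blast
  then show ?thesis by (simp add: X_def[abs_def])
qed

lemma X_bounded_F:
  assumes "y \<in> {0..1}" "0 \<le> t" shows "X i y t \<in> bounded_F t"
proof -
  have "X i y t \<in> borel_measurable (F t)"
    using solves[OF assms(1)] assms(2) by (simp add: solves_ito_sde_def)
  then show ?thesis
    unfolding bounded_F_def using X_bounds[OF _ assms(1)] by (auto intro!: exI[of _ 1])
qed

lemma X_joint_measurable:
  assumes "y \<in> {0..1}" shows "(\<lambda>p. X i y (snd p) (fst p)) \<in> borel_measurable Q"
proof -
  have m: "(\<lambda>(t, \<omega>, x). \<phi> t \<omega> x) \<in> (borel \<Otimes>\<^sub>M (P \<Otimes>\<^sub>M restrict_space borel unit_cube)) \<rightarrow>\<^sub>M restrict_space borel unit_cube"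
    using rds by (simp add: random_dynamical_system_def)
  have c: "(\<chi> j. y) \<in> space (restrict_space borel unit_cube)"
    using diagonal_in_cube[OF assms] by (simp add: space_restrict_space)
  have "(\<lambda>p. (snd p, fst p, \<chi> j. y)) \<in> Q \<rightarrow>\<^sub>M (borel \<Otimes>\<^sub>M (P \<Otimes>\<^sub>M restrict_space borel unit_cube))"
    using measurable_const[OF c, of Q] by measurable
  from measurable_compose[OF this m]
  have "(\<lambda>p. \<phi> (snd p) (fst p) (\<chi> j. y)) \<in> Q \<rightarrow>\<^sub>M restrict_space borel unit_cube" by simp
  then have "(\<lambda>p. \<phi> (snd p) (fst p) (\<chi> j. y)) \<in> borel_measurable Q"
    by (rule measurable_restrict_space2_iff[THEN iffD1, THEN conjunct1])
  then show ?thesis unfolding X_def by measurable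
qed

lemma X_measurable [measurable]: "y \<in> {0..1} \<Longrightarrow> X i y t \<in> borel_measurable P"
proof -
  assume y: "y \<in> {0..1}"
  have "(\<lambda>\<omega>. (\<omega>, t)) \<in> P \<rightarrow>\<^sub>M Q" by measurable
  from measurable_compose[OF this X_joint_measurable[OF y]] show ?thesis by simp
qed

text \<open>
  The diffusion coefficient along the flow. It also measures the distance to the endpoints 0 and 1, at which it
  vanishes.
\<close>

definition V :: "'d \<Rightarrow> real \<Rightarrow> real \<Rightarrow> 'd path \<Rightarrow> real" where
  "V i y t \<omega> = X i y t \<omega> * (1 - X i y t \<omega>)"

lemma V_bounds: "\<omega> \<in> space P \<Longrightarrow> y \<in> {0..1} \<Longrightarrow> 0 \<le> V i y t \<omega>" "\<omega> \<in> space P \<Longrightarrow> y \<in> {0..1} \<Longrightarrow> V i y t \<omega> \<le> 1"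
  unfolding V_def by (auto intro!: logistic_bounds X_bounds)

lemma V_measurable [measurable]: "y \<in> {0..1} \<Longrightarrow> V i y t \<in> borel_measurable P"
  unfolding V_def by measurable

lemma V_joint_measurable:
  assumes "y \<in> {0..1}" shows "(\<lambda>p. V i y (snd p) (fst p)) \<in> borel_measurable Q"
  unfolding V_def using X_joint_measurable[OF assms] by measurable

lemma V_bounded_F:
  assumes "y \<in> {0..1}" "0 \<le> t" shows "V i y t \<in> bounded_F t"
proof -
  have [measurable]: "X i y t \<in> borel_measurable (F t)" using X_bounded_F[OF assms] by (rule bounded_F_measurable)
  show ?thesis unfolding bounded_F_def
    using V_bounds[OF _ assms(1)] by (auto simp: V_def[abs_def] intro!: exI[of _ 1])
qed

abbreviation integrand :: "'d \<Rightarrow> real \<Rightarrow> real set \<Rightarrow> 'd path \<times> real \<Rightarrow> real" where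
  "integrand i y A \<equiv> (\<lambda>p. V i y (snd p) (fst p) * indicator A (snd p))"

lemma simple_approximation_from_0:
  assumes y: "y \<in> {0..1}" and t: "0 \<le> t"
  shows "\<exists>L. (\<forall>j. adapted_list (L j)) \<and>
    (\<lambda>j. l2_dist P (ito_sum i (L j)) (\<lambda>\<omega>. X i y t \<omega> - y)) \<longlonglongrightarrow> 0 \<and>
    (\<lambda>j. l2_dist Q (step_fun (L j)) (integrand i y {0..t})) \<longlonglongrightarrow> 0"
proof -
  have "has_ito_integral P F (\<lambda>t \<omega>. \<omega> t $ i) t (\<lambda>s \<omega>. V i y s \<omega>) (\<lambda>\<omega>. X i y t \<omega> - y)"
    using solves[OF y, of i] t unfolding solves_ito_sde_def V_def by blast
  then obtain n :: "nat \<Rightarrow> nat" and \<tau> \<xi> where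
    el: "\<And>j. elementary_integrand F t (n j) (\<tau> j) (\<xi> j)" and
    l1: "(\<lambda>j. \<integral>\<^sup>+ \<omega>. (\<integral>\<^sup>+ s\<in>{0..t}. ennreal ((elementary_process (n j) (\<tau> j) (\<xi> j) s \<omega> - V i y s \<omega>)\<^sup>2)
               \<partial>lborel) \<partial>P) \<longlonglongrightarrow> 0" and
    l2: "(\<lambda>j. \<integral>\<^sup>+ \<omega>. ennreal ((elementary_integral (\<lambda>t \<omega>. \<omega> t $ i) (n j) (\<tau> j) (\<xi> j) \<omega> - (X i y t \<omega> - y))\<^sup>2) \<partial>P) \<longlonglongrightarrow> 0"
    unfolding has_ito_integral_def by blast
  define L where "L j = map (\<lambda>k. (\<tau> j k, \<tau> j (Suc k), \<xi> j k)) [0..<n j]" for j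
  have \<tau>: "0 \<le> \<tau> j k" "\<tau> j k \<le> t" if "k \<le> n j" for j k
    using el[of j] that by (auto simp: elementary_integrand_def)
  have ad: "adapted_list (L j)" for j
    using el[of j] unfolding adapted_list_def L_def elementary_integrand_def bounded_F_def by auto
  have ito: "ito_sum i (L j) = elementary_integral (\<lambda>t \<omega>. \<omega> t $ i) (n j) (\<tau> j) (\<xi> j)" for j
    by (simp add: fun_eq_iff ito_sum_def L_def elementary_integral_def incr_def comp_def
        interv_sum_list_conv_sum_set_nat lessThan_atLeast0)
  have step: "step_fun (L j) (\<omega>, s) = elementary_process (n j) (\<tau> j) (\<xi> j) s \<omega>" for j \<omega> s
    by (simp add: step_fun_def L_def elementary_process_def comp_def
        interv_sum_list_conv_sum_set_nat lessThan_atLeast0)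
  have off: "step_fun (L j) (\<omega>, s) = 0" if "s \<notin> {0..t}" for j \<omega> s
    unfolding step elementary_process_def
  proof (rule sum.neutral, intro ballI)
    fix k assume "k \<in> {..<n j}"
    then have "0 \<le> \<tau> j k" "\<tau> j (Suc k) \<le> t" using \<tau>[of k j] \<tau>[of "Suc k" j] by auto
    then show "\<xi> j k \<omega> * indicator {\<tau> j k<..\<tau> j (Suc k)} s = 0" using that by (auto simp: indicator_def)
  qed
  have "l2_dist Q (step_fun (L j)) (integrand i y {0..t}) =
    (\<integral>\<^sup>+ \<omega>. (\<integral>\<^sup>+ s\<in>{0..t}. ennreal ((elementary_process (n j) (\<tau> j) (\<xi> j) s \<omega> - V i y s \<omega>)\<^sup>2) \<partial>lborel) \<partial>P)" for j
  proof -
    have "(integrand i y {0..t}) \<in> borel_measurable Q"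
      by (intro borel_measurable_times V_joint_measurable[OF y]) measurable
    then have m: "(\<lambda>p. ennreal ((step_fun (L j) p - V i y (snd p) (fst p) * indicator {0..t} (snd p))\<^sup>2)) \<in> borel_measurable Q"
      using step_fun_measurable[OF ad] by measurable
    have "l2_dist Q (step_fun (L j)) (integrand i y {0..t}) =
      (\<integral>\<^sup>+ \<omega>. (\<integral>\<^sup>+ s. ennreal ((step_fun (L j) (\<omega>, s) - V i y s \<omega> * indicator {0..t} s)\<^sup>2) \<partial>lborel) \<partial>P)"
      unfolding l2_dist_def lborel.nn_integral_fst[OF m, symmetric] by simp
    also have "\<dots> = (\<integral>\<^sup>+ \<omega>. (\<integral>\<^sup>+ s\<in>{0..t}. ennreal ((elementary_process (n j) (\<tau> j) (\<xi> j) s \<omega> - V i y s \<omega>)\<^sup>2) \<partial>lborel) \<partial>P)"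
    proof (intro nn_integral_cong)
      fix \<omega> s
      show "ennreal ((step_fun (L j) (\<omega>, s) - V i y s \<omega> * indicator {0..t} s)\<^sup>2) =
          ennreal ((elementary_process (n j) (\<tau> j) (\<xi> j) s \<omega> - V i y s \<omega>)\<^sup>2) * indicator {0..t} s"
        using off[of s j \<omega>] by (cases "s \<in> {0..t}") (simp_all add: step)
    qed
    finally show ?thesis .
  qed
  then show ?thesis using ad l1 l2 by (intro exI[of _ L]) (simp add: ito l2_dist_def)
qed

text \<open>
  The integrals over \<open>[0, t]\<close> and \<open>[0, s]\<close> come with unrelated approximating sequences; the concatenation of one
  with the negative of the other approximates the integral over \<open>(s, t]\<close>.
\<close>

lemma simple_approximation:
  assumes y: "y \<in> {0..1}" and st: "0 \<le> s" "s \<le> t"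
  shows "\<exists>L. (\<forall>j. adapted_list (L j)) \<and>
    (\<lambda>j. l2_dist P (ito_sum i (L j)) (\<lambda>\<omega>. X i y t \<omega> - X i y s \<omega>)) \<longlonglongrightarrow> 0 \<and>
    (\<lambda>j. l2_dist Q (step_fun (L j)) (integrand i y {s<..t})) \<longlonglongrightarrow> 0"
proof -
  obtain L where L: "\<And>j. adapted_list (L j)"
    "(\<lambda>j. l2_dist P (ito_sum i (L j)) (\<lambda>\<omega>. X i y t \<omega> - y)) \<longlonglongrightarrow> 0"
    "(\<lambda>j. l2_dist Q (step_fun (L j)) (integrand i y {0..t})) \<longlonglongrightarrow> 0"
    using simple_approximation_from_0[OF y, of t i] st by auto
  obtain K where K: "\<And>j. adapted_list (K j)"
    "(\<lambda>j. l2_dist P (ito_sum i (K j)) (\<lambda>\<omega>. X i y s \<omega> - y)) \<longlonglongrightarrow> 0"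
    "(\<lambda>j. l2_dist Q (step_fun (K j)) (integrand i y {0..s})) \<longlonglongrightarrow> 0"
    using simple_approximation_from_0[OF y, of s i] st by auto
  note [measurable] = step_fun_measurable V_joint_measurable[OF y] ito_sum_measurable X_measurable[OF y]
  have e1: "ito_sum i (L j @ negate (K j)) = (\<lambda>\<omega>. ito_sum i (L j) \<omega> - ito_sum i (K j) \<omega>)" for j
    by (simp add: fun_eq_iff)
  have e2: "step_fun (L j @ negate (K j)) = (\<lambda>\<omega>. step_fun (L j) \<omega> - step_fun (K j) \<omega>)" for j
    by (simp add: fun_eq_iff)
  have "(\<lambda>j. l2_dist P (ito_sum i (L j @ negate (K j))) (\<lambda>\<omega>. (X i y t \<omega> - y) - (X i y s \<omega> - y))) \<longlonglongrightarrow> 0"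
    unfolding e1 by (rule l2_tendsto_diff[OF _ _ _ _ L(2) K(2)]) (use L(1) K(1) in measurable)
  moreover have "(\<lambda>j. l2_dist Q (step_fun (L j @ negate (K j))) (\<lambda>p. V i y (snd p) (fst p) * indicator {0..t} (snd p)
     - V i y (snd p) (fst p) * indicator {0..s} (snd p))) \<longlonglongrightarrow> 0"
    unfolding e2 by (rule l2_tendsto_diff[OF _ _ _ _ L(3) K(3)]) (use L(1) K(1) in measurable)
  moreover have "(\<lambda>p. V i y (snd p) (fst p) * indicator {0..t} (snd p) - V i y (snd p) (fst p) * indicator {0..s} (snd p)) =
     (integrand i y {s<..t})"
    using st by (auto simp: fun_eq_iff indicator_def)
  ultimately show ?thesis
    using L(1) K(1) by (intro exI[of _ "\<lambda>j. L j @ negate (K j)"]) (simp add: adapted_negate)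
qed

text \<open>
  With \<open>Z = 0\<close> this is the Ito isometry for the increment of the flow. A nonzero \<open>Z\<close> measures the error
  of replacing the integrand by a constant over the interval, as an Euler step does.
\<close>

lemma flow_increment_isometry:
  assumes y: "y \<in> {0..1}" and st: "0 \<le> s" "s \<le> t" and Z: "Z \<in> bounded_F s"
  shows "l2_dist P (\<lambda>\<omega>. X i y t \<omega> - X i y s \<omega> - Z \<omega> * incr i s t \<omega>) (\<lambda>_. 0) =
    (\<integral>\<^sup>+r. l2_dist P (V i y r) Z * indicator {s<..t} r \<partial>lborel)"
proof -
  obtain L where L: "\<And>j. adapted_list (L j)"
    "(\<lambda>j. l2_dist P (ito_sum i (L j)) (\<lambda>\<omega>. X i y t \<omega> - X i y s \<omega>)) \<longlonglongrightarrow> 0"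
    "(\<lambda>j. l2_dist Q (step_fun (L j)) (integrand i y {s<..t})) \<longlonglongrightarrow> 0"
    using simple_approximation[OF y st, of i] by auto
  note [measurable] = step_fun_measurable V_joint_measurable[OF y] ito_sum_measurable X_measurable[OF y]
    F_imp_P[OF bounded_F_measurable[OF Z]]
  \<comment> \<open>Subtracting the constant integrand \<open>Z\<close> on \<open>(s, t]\<close> changes the integral by exactly \<open>Z\<close> times the increment.\<close>
  define K where "K j = L j @ negate [(s, t, Z)]" for j
  have K: "adapted_list (K j)" for j using L(1) st Z by (simp add: K_def adapted_negate)
  have e1: "ito_sum i (K j) = (\<lambda>\<omega>. ito_sum i (L j) \<omega> - Z \<omega> * incr i s t \<omega>)" for j
    by (simp add: fun_eq_iff K_def)
  have e2: "step_fun (K j) = (\<lambda>p. step_fun (L j) p - Z (fst p) * indicator {s<..t} (snd p))" for j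
    by (simp add: fun_eq_iff K_def)
  have m: "\<And>j. ito_sum i (K j) \<in> borel_measurable P" "\<And>j. step_fun (K j) \<in> borel_measurable Q"
    by (intro ito_sum_measurable step_fun_measurable K)+
  have m0: "(\<lambda>\<omega>. X i y t \<omega> - X i y s \<omega> - Z \<omega> * incr i s t \<omega>) \<in> borel_measurable P"
    by measurable
  have m1: "(\<lambda>p. V i y (snd p) (fst p) * indicator {s<..t} (snd p) - Z (fst p) * indicator {s<..t} (snd p)) \<in> borel_measurable Q"
    by (intro borel_measurable_diff borel_measurable_times V_joint_measurable[OF y]) measurable
  have lim1: "(\<lambda>j. l2_dist P (ito_sum i (K j)) (\<lambda>\<omega>. X i y t \<omega> - X i y s \<omega> - Z \<omega> * incr i s t \<omega>)) \<longlonglongrightarrow> 0"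
    unfolding e1
    by (rule l2_tendsto_diff[OF _ _ _ _ L(2)]) (use L(1) in \<open>measurable, simp add: l2_dist_def\<close>)
  have lim2: "(\<lambda>j. l2_dist Q (step_fun (K j)) (\<lambda>p. V i y (snd p) (fst p) * indicator {s<..t} (snd p) - Z (fst p) * indicator {s<..t} (snd p))) \<longlonglongrightarrow> 0"
    unfolding e2
    by (rule l2_tendsto_diff[OF _ _ _ _ L(3)]) (use L(1) in \<open>measurable, simp add: l2_dist_def\<close>)
  have "l2_dist P (\<lambda>\<omega>. X i y t \<omega> - X i y s \<omega> - Z \<omega> * incr i s t \<omega>) (\<lambda>_. 0) =
      l2_dist Q (\<lambda>p. V i y (snd p) (fst p) * indicator {s<..t} (snd p) - Z (fst p) * indicator {s<..t} (snd p)) (\<lambda>_. 0)"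
    by (rule l2_limit_norm_eq[OF m(1) m0 m(2) m1 lim1 lim2 ito_isometry(2)[OF K]])
  also have "\<dots> = (\<integral>\<^sup>+p. ennreal ((V i y (snd p) (fst p) - Z (fst p))\<^sup>2) * indicator {s<..t} (snd p) \<partial>Q)"
    unfolding l2_dist_def by (intro nn_integral_cong) (simp add: indicator_def)
  also have "\<dots> = (\<integral>\<^sup>+r. (\<integral>\<^sup>+\<omega>. ennreal ((V i y r \<omega> - Z \<omega>)\<^sup>2) * indicator {s<..t} r \<partial>P) \<partial>lborel)"
  proof -
    have "(\<lambda>p. V i y (snd p) (fst p) - Z (fst p)) \<in> borel_measurable Q"
      by (intro borel_measurable_diff V_joint_measurable[OF y]) measurable
    then have m: "(\<lambda>p. ennreal ((V i y (snd p) (fst p) - Z (fst p))\<^sup>2) * indicator {s<..t} (snd p)) \<in> borel_measurable Q"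
      by measurable
    show ?thesis unfolding PQ.nn_integral_snd[OF m, symmetric] by simp
  qed
  also have "\<dots> = (\<integral>\<^sup>+r. l2_dist P (V i y r) Z * indicator {s<..t} r \<partial>lborel)"
    unfolding l2_dist_def by (intro nn_integral_cong nn_integral_multc) (use y in measurable)
  finally show ?thesis .
qed

text \<open>
  The approximating integrals are tested against the past of \<open>s\<close>, so only their parts up to time \<open>s\<close> matter. By the
  isometry these parts tend to 0, because the limiting integrand vanishes before \<open>s\<close>.
\<close>

lemma flow_martingale:
  assumes y: "y \<in> {0..1}" and st: "0 \<le> s" "s \<le> t" and Z: "Z \<in> bounded_F s"
  shows "expectation (\<lambda>\<omega>. Z \<omega> * (X i y t \<omega> - X i y s \<omega>)) = 0"
proof -
  obtain L where L: "\<And>j. adapted_list (L j)"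
    "(\<lambda>j. l2_dist P (ito_sum i (L j)) (\<lambda>\<omega>. X i y t \<omega> - X i y s \<omega>)) \<longlonglongrightarrow> 0"
    "(\<lambda>j. l2_dist Q (step_fun (L j)) (integrand i y {s<..t})) \<longlonglongrightarrow> 0"
    using simple_approximation[OF y st, of i] by auto
  obtain c where c: "\<And>\<omega>. \<omega> \<in> space P \<Longrightarrow> \<bar>Z \<omega>\<bar> \<le> c" using Z by (auto simp: bounded_F_def)
  note [measurable] = step_fun_measurable V_joint_measurable[OF y] ito_sum_measurable X_measurable[OF y]
    F_imp_P[OF bounded_F_measurable[OF Z]]
  have bX: "\<bar>X i y t \<omega> - X i y s \<omega>\<bar> \<le> 1" if "\<omega> \<in> space P" for \<omega>
    using X_bounds[OF that y, of i t] X_bounds[OF that y, of i s] by auto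
  have "integrable P (\<lambda>\<omega>. (X i y t \<omega> - X i y s \<omega>)\<^sup>2)"
    by (rule integrable_const_bound[of _ 1]) (use bX in \<open>auto simp: abs_square_le_1\<close>)
  then have lim1: "(\<lambda>j. expectation (\<lambda>\<omega>. Z \<omega> * ito_sum i (L j) \<omega>)) \<longlonglongrightarrow> expectation (\<lambda>\<omega>. Z \<omega> * (X i y t \<omega> - X i y s \<omega>))"
    by (intro l2_tendsto_expectation[where c=c] L ito_isometry c) (use L(1) in auto)
  have bnd: "l2_dist P (ito_sum i (stop_at s (L j))) (\<lambda>_. 0)
      \<le> l2_dist Q (step_fun (L j)) (integrand i y {s<..t})" for j
  proof -
    have "l2_dist P (ito_sum i (stop_at s (L j))) (\<lambda>_. 0) = l2_dist Q (step_fun (stop_at s (L j))) (\<lambda>_. 0)"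
      by (intro ito_isometry adapted_stop_at L)
    also have "\<dots> \<le> l2_dist Q (step_fun (L j)) (integrand i y {s<..t})"
      unfolding l2_dist_def by (intro nn_integral_mono) (auto simp: step_fun_stop_at indicator_def)
    finally show ?thesis .
  qed
  have "(\<lambda>j. l2_dist P (ito_sum i (stop_at s (L j))) (\<lambda>_. 0)) \<longlonglongrightarrow> 0"
    by (rule tendsto_0_ennreal_le[OF L(3) bnd])
  then have "(\<lambda>j. expectation (\<lambda>\<omega>. Z \<omega> * ito_sum i (stop_at s (L j)) \<omega>)) \<longlonglongrightarrow> expectation (\<lambda>\<omega>. Z \<omega> * 0)"
    by (intro l2_tendsto_expectation[where c=c] ito_isometry c) (use L(1) adapted_stop_at in auto)
  then have "(\<lambda>j. expectation (\<lambda>\<omega>. Z \<omega> * ito_sum i (L j) \<omega>)) \<longlonglongrightarrow> 0"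
    using expectation_stop_at[OF L(1) Z st(1), of i] by simp
  from LIMSEQ_unique[OF lim1 this] show ?thesis .
qed

end

section \<open>Every coordinate tends to an endpoint\<close>

text \<open>
  Once \<open>f (1 - f)\<close> stays below \<open>1/4\<close>, the continuous function \<open>f\<close> cannot cross the value \<open>1/2\<close> any more,
  so it remains in one half of the interval and is there comparable to \<open>f (1 - f)\<close>.
\<close>

lemma two_well_limit:
  fixes f :: "real \<Rightarrow> real"
  assumes cont: "continuous_on UNIV f" and bnd: "\<And>t. 0 \<le> f t" "\<And>t. f t \<le> 1"
    and lim: "((\<lambda>t. f t * (1 - f t)) \<longlongrightarrow> 0) at_top"
  shows "(f \<longlongrightarrow> 0) at_top \<or> (f \<longlongrightarrow> 1) at_top"
proof -
  have "\<forall>\<^sub>F t in at_top. f t * (1 - f t) < 1/4" by (rule order_tendstoD(2)[OF lim]) simp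
  then obtain N where N: "\<And>t. N \<le> t \<Longrightarrow> f t * (1 - f t) < 1/4" by (auto simp: eventually_at_top_linorder)
  have ne: "f t \<noteq> 1/2" if "N \<le> t" for t
  proof
    assume "f t = 1/2"
    then show False using N[OF that] by (simp only:) simp
  qed
  have lim2: "((\<lambda>t. 2 * (f t * (1 - f t))) \<longlongrightarrow> 0) at_top"
    using tendsto_mult_right_zero[OF lim, of 2] .
  show ?thesis
  proof (cases "f N < 1/2")
    case True
    have lt: "f t < 1/2" if "N \<le> t" for t
    proof (rule ccontr)
      assume "\<not> f t < 1/2"
      then obtain s where "N \<le> s" "s \<le> t" "f s = 1/2"
        using IVT'[of f N "1/2" t] True \<open>N \<le> t\<close> continuous_on_subset[OF cont] by auto
      then show False using ne by auto
    qed
    have "\<bar>f t\<bar> \<le> 2 * (f t * (1 - f t))" if "N \<le> t" for t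
      using mult_left_mono[of "1/2" "1 - f t" "f t"] lt[OF that] bnd[of t] by simp
    then have "\<forall>\<^sub>F t in at_top. norm (f t) \<le> 2 * (f t * (1 - f t))"
      by (auto simp: eventually_at_top_linorder intro!: exI[of _ N])
    then have "(f \<longlongrightarrow> 0) at_top" by (rule Lim_null_comparison[OF _ lim2])
    then show ?thesis ..
  next
    case False
    have lt: "f t > 1/2" if "N \<le> t" for t
    proof (rule ccontr)
      assume "\<not> f t > 1/2"
      then obtain s where "N \<le> s" "s \<le> t" "f s = 1/2"
        using IVT2'[of f t "1/2" N] False \<open>N \<le> t\<close> continuous_on_subset[OF cont] by auto
      then show False using ne by auto
    qed
    have "\<bar>f t - 1\<bar> \<le> 2 * (f t * (1 - f t))" if "N \<le> t" for t
      using mult_right_mono[of "1/2" "f t" "1 - f t"] lt[OF that] bnd[of t] by simp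
    then have "\<forall>\<^sub>F t in at_top. norm (f t - 1) \<le> 2 * (f t * (1 - f t))"
      by (auto simp: eventually_at_top_linorder intro!: exI[of _ N])
    then have "((\<lambda>t. f t - 1) \<longlongrightarrow> 0) at_top" by (rule Lim_null_comparison[OF _ lim2])
    then show ?thesis using LIM_zero_cancel by blast
  qed
qed

context logistic_flow
begin

lemma integrable_bounded_by:
  fixes f :: "'d path \<Rightarrow> real"
  assumes "f \<in> borel_measurable P" "\<And>\<omega>. \<omega> \<in> space P \<Longrightarrow> \<bar>f \<omega>\<bar> \<le> c"
  shows "integrable P f"
  by (rule integrable_const_bound[of _ c]) (use assms in auto)

lemma zero_bounded_F: "(\<lambda>_. 0) \<in> bounded_F s"
  by (auto simp: bounded_F_def)

lemma flow_increment_norm: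
  assumes "y \<in> {0..1}" "0 \<le> s" "s \<le> t"
  shows "l2_dist P (\<lambda>\<omega>. X i y t \<omega> - X i y s \<omega>) (\<lambda>_. 0) = (\<integral>\<^sup>+r. l2_dist P (V i y r) (\<lambda>_. 0) * indicator {s<..t} r \<partial>lborel)"
  using flow_increment_isometry[OF assms zero_bounded_F, of i] by simp

lemma l2_dist_bounded:
  assumes "\<And>\<omega>. \<omega> \<in> space P \<Longrightarrow> \<bar>f \<omega> - g \<omega>\<bar> \<le> 1" shows "l2_dist P f g \<le> 1"
proof -
  have "l2_dist P f g \<le> (\<integral>\<^sup>+\<omega>. 1 \<partial>P)"
    unfolding l2_dist_def using assms by (intro nn_integral_mono) (simp add: abs_square_le_1)
  then show ?thesis by (simp add: emeasure_space_1)
qed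

lemma flow_increment_norm_le:
  assumes y: "y \<in> {0..1}" and st: "0 \<le> s" "s \<le> t"
  shows "l2_dist P (X i y t) (X i y s) \<le> ennreal (t - s)"
proof -
  have "l2_dist P (X i y t) (X i y s) = (\<integral>\<^sup>+r. l2_dist P (V i y r) (\<lambda>_. 0) * indicator {s<..t} r \<partial>lborel)"
    using flow_increment_norm[OF assms, of i] by (simp add: l2_dist_def)
  also have "\<dots> \<le> (\<integral>\<^sup>+r. indicator {s<..t} r \<partial>lborel)"
    by (intro nn_integral_mono) (auto simp: indicator_def V_bounds[OF _ y] intro!: l2_dist_bounded)
  also have "\<dots> = ennreal (t - s)" using st by simp
  finally show ?thesis .
qed

text \<open>
  The function \<open>x (1 - x)\<close> is concave. Concretely, with \<open>D\<close> the increment of the flow,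
  \<open>V\<^sub>s - V\<^sub>t = D\<^sup>2 - D + 2 X\<^sub>s D\<close>, and the last two terms have mean 0 against the past of \<open>s\<close>.
\<close>

lemma V_supermartingale:
  assumes y: "y \<in> {0..1}" and st: "0 \<le> s" "s \<le> t" and Z: "Z \<in> bounded_F s" "\<And>\<omega>. 0 \<le> Z \<omega>"
  shows "expectation (\<lambda>\<omega>. Z \<omega> * V i y t \<omega>) \<le> expectation (\<lambda>\<omega>. Z \<omega> * V i y s \<omega>)"
proof -
  have t: "0 \<le> t" using st by simp
  have Xs: "X i y s \<in> bounded_F t" and Xt: "X i y t \<in> bounded_F t" and Zt: "Z \<in> bounded_F t"
    using X_bounded_F[OF y t] bounded_F_mono[OF X_bounded_F[OF y st(1)] st(2)] bounded_F_mono[OF Z(1) st(2)] by auto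
  have mult: "(\<lambda>\<omega>. f \<omega> * g \<omega>) \<in> bounded_F t" if "f \<in> bounded_F t" "g \<in> bounded_F t" for f g
    using bounded_F_mult[OF that] by simp
  note int = bounded_F_integrable[where s=t]
  define D where "D \<omega> = X i y t \<omega> - X i y s \<omega>" for \<omega>
  have D: "D \<in> bounded_F t"
  proof -
    obtain c c' where "\<And>\<omega>. \<omega> \<in> space P \<Longrightarrow> \<bar>X i y t \<omega>\<bar> \<le> c" "\<And>\<omega>. \<omega> \<in> space P \<Longrightarrow> \<bar>X i y s \<omega>\<bar> \<le> c'"
      using Xs Xt by (auto simp: bounded_F_def)
    then have "\<forall>\<omega>\<in>space P. \<bar>D \<omega>\<bar> \<le> c + c'"
      unfolding D_def by (smt (verit))
    moreover have "D \<in> borel_measurable (F t)"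
      unfolding D_def using Xs Xt by (intro borel_measurable_diff bounded_F_measurable)
    ultimately show ?thesis by (auto simp: bounded_F_def)
  qed
  have i1: "integrable P (\<lambda>\<omega>. Z \<omega> * D \<omega>)" by (intro int mult Zt D)
  have i2: "integrable P (\<lambda>\<omega>. Z \<omega> * (D \<omega> * D \<omega>))" by (intro int mult Zt D)
  have i3: "integrable P (\<lambda>\<omega>. (Z \<omega> * X i y s \<omega>) * D \<omega>)" by (intro int mult Zt D Xs)
  have iV: "integrable P (\<lambda>\<omega>. Z \<omega> * V i y t \<omega>)" "integrable P (\<lambda>\<omega>. Z \<omega> * V i y s \<omega>)"
    using V_bounded_F[OF y t] bounded_F_mono[OF V_bounded_F[OF y st(1)] st(2)] by (intro int mult Zt; simp)+
  have m1: "expectation (\<lambda>\<omega>. Z \<omega> * D \<omega>) = 0"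
    unfolding D_def by (rule flow_martingale[OF y st Z(1)])
  have m3: "expectation (\<lambda>\<omega>. (Z \<omega> * X i y s \<omega>) * D \<omega>) = 0"
    unfolding D_def by (rule flow_martingale[OF y st]) (use bounded_F_mult[OF Z(1) X_bounded_F[OF y st(1)]] in simp)
  have "expectation (\<lambda>\<omega>. Z \<omega> * V i y s \<omega>) - expectation (\<lambda>\<omega>. Z \<omega> * V i y t \<omega>)
      = expectation (\<lambda>\<omega>. Z \<omega> * V i y s \<omega> - Z \<omega> * V i y t \<omega>)"
    using iV by simp
  also have "\<dots> = expectation (\<lambda>\<omega>. Z \<omega> * (D \<omega> * D \<omega>) - Z \<omega> * D \<omega> + 2 * ((Z \<omega> * X i y s \<omega>) * D \<omega>))"
    by (intro Bochner_Integration.integral_cong) (auto simp: V_def D_def algebra_simps)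
  also have "\<dots> = expectation (\<lambda>\<omega>. Z \<omega> * (D \<omega> * D \<omega>))"
    using i1 i2 i3 m1 m3 by simp
  also have "\<dots> \<ge> 0" using Z(2) by (intro integral_nonneg_AE) auto
  finally show ?thesis by simp
qed

lemma expectation_V_antimono:
  assumes y: "y \<in> {0..1}" and st: "0 \<le> s" "s \<le> t"
  shows "expectation (V i y t) \<le> expectation (V i y s)"
proof -
  have "(\<lambda>_. 1) \<in> bounded_F s" by (auto simp: bounded_F_def)
  from V_supermartingale[OF y st this] show ?thesis by simp
qed

lemma expectation_V_nonneg: "y \<in> {0..1} \<Longrightarrow> 0 \<le> expectation (V i y t)"
  by (intro integral_nonneg_AE AE_I2 V_bounds)

text \<open>
  Since the mean of \<open>V\<close> decreases in time, \<open>t (E V\<^sub>t)\<^sup>2\<close> is at most the integral of \<open>E (V\<^sup>2)\<close> over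
  \<open>[0, t]\<close>, which equals the second moment of \<open>X\<^sub>t - X\<^sub>0\<close> and thus at most 1.
\<close>

lemma expectation_V_decay:
  assumes y: "y \<in> {0..1}" and t: "0 < t"
  shows "expectation (V i y t) \<le> 1 / sqrt t"
proof -
  define v where "v = expectation (V i y t)"
  have v0: "0 \<le> v" unfolding v_def by (rule expectation_V_nonneg[OF y])
  have "ennreal (v\<^sup>2) \<le> l2_dist P (V i y r) (\<lambda>_. 0)" if "r \<in> {0<..t}" for r
  proof -
    have i: "integrable P (\<lambda>\<omega>. (V i y r \<omega> - 0)\<^sup>2)"
    proof (rule integrable_bounded_by[of _ 1])
      show "(\<lambda>\<omega>. (V i y r \<omega> - 0)\<^sup>2) \<in> borel_measurable P"
        using V_measurable[OF y] by measurable
    qed (use V_bounds[OF _ y] in \<open>auto simp: abs_square_le_1\<close>)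
    have "v \<le> expectation (V i y r)" unfolding v_def by (rule expectation_V_antimono[OF y]) (use that in auto)
    then have "v\<^sup>2 \<le> (expectation (V i y r))\<^sup>2" using v0 by (intro power_mono) auto
    also have "\<dots> \<le> expectation (\<lambda>\<omega>. (V i y r \<omega> - 0)\<^sup>2)"
      using expectation_square_le(2)[OF V_measurable[OF y]] i by simp
    finally show ?thesis unfolding l2_dist_eq_expectation[OF i] by (rule ennreal_leI)
  qed
  then have "(\<integral>\<^sup>+r. ennreal (v\<^sup>2) * indicator {0<..t} r \<partial>lborel) \<le> (\<integral>\<^sup>+r. l2_dist P (V i y r) (\<lambda>_. 0) * indicator {0<..t} r \<partial>lborel)"
    by (intro nn_integral_mono) (auto simp: indicator_def)
  also have "\<dots> = l2_dist P (\<lambda>\<omega>. X i y t \<omega> - X i y 0 \<omega>) (\<lambda>_. 0)"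
    by (rule flow_increment_norm[symmetric]) (use y t in auto)
  also have "\<dots> \<le> 1"
  proof (rule l2_dist_bounded)
    fix \<omega> assume "\<omega> \<in> space P"
    then show "\<bar>X i y t \<omega> - X i y 0 \<omega> - 0\<bar> \<le> 1"
      using X_bounds[of \<omega> y i t] X_bounds[of \<omega> y i 0] y by auto
  qed
  also have "(\<integral>\<^sup>+r. ennreal (v\<^sup>2) * indicator {0<..t} r \<partial>lborel) = ennreal (v\<^sup>2 * t)"
    using t by (simp add: nn_integral_cmult_indicator ennreal_mult)
  finally have "v\<^sup>2 * t \<le> 1" by simp
  then have "v\<^sup>2 \<le> (1 / sqrt t)\<^sup>2" using t by (simp add: power_divide field_simps)
  then show ?thesis using v0 t unfolding v_def by (metis power2_le_imp_le real_sqrt_ge_zero less_imp_le divide_nonneg_nonneg zero_le_one)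
qed

text \<open>
  Doob's maximal inequality for a nonnegative supermartingale: the mean of the process frozen at the level
  \<open>\<epsilon>\<close> once it has reached that level does not increase.
\<close>

lemma V_maximal_inequality:
  assumes y: "y \<in> {0..1}" and u: "mono u" "0 \<le> u 0" and \<epsilon>: "0 < \<epsilon>"
  shows "\<epsilon> * prob {\<omega>\<in>space P. \<exists>k\<le>n::nat. \<epsilon> \<le> V i y (u k) \<omega>} \<le> expectation (V i y (u 0))"
proof -
  \<comment> \<open>\<open>B n\<close> is the event that the level has not been reached, and \<open>M n\<close> is the process frozen at it.\<close>
  define B where "B n = {\<omega>\<in>space P. \<forall>k\<le>n. V i y (u k) \<omega> < \<epsilon>}" for n :: nat
  have u0: "0 \<le> u n" for n using u monoD[OF u(1), of 0 n] by simp
  have BF: "B n \<in> sets (F (u n))" for n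
  proof -
    have m: "V i y (u k) \<in> borel_measurable (F (u n))" if "k \<le> n" for k
      using bounded_F_measurable[OF bounded_F_mono[OF V_bounded_F[OF y u0] monoD[OF u(1) that]]] .
    have "B n = (\<Inter>k\<in>{..n}. {\<omega>\<in>space (F (u n)). V i y (u k) \<omega> < \<epsilon>})" by (auto simp: B_def)
    also have "\<dots> \<in> sets (F (u n))"
    proof (intro sets.finite_INT)
      fix k assume "k \<in> {..n}"
      then have [measurable]: "V i y (u k) \<in> borel_measurable (F (u n))" using m by simp
      show "{\<omega>\<in>space (F (u n)). V i y (u k) \<omega> < \<epsilon>} \<in> sets (F (u n))" by measurable
    qed auto
    finally show ?thesis .
  qed
  then have BP [measurable]: "B n \<in> sets P" for n using sets_F_events by blast
  note [measurable] = V_measurable[OF y]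
  define M where "M n \<omega> = indicator (B n) \<omega> * V i y (u n) \<omega> + \<epsilon> * indicator (space P - B n) \<omega>" for n \<omega>
  have int: "integrable P (\<lambda>\<omega>. indicator (B k) \<omega> * V i y (u n) \<omega>)" for k n
    by (rule integrable_bounded_by[of _ 1]) (auto simp: indicator_def V_bounds[OF _ y])
  have int2: "integrable P (\<lambda>\<omega>. \<epsilon> * indicator (space P - B n) \<omega>)" for n
    by (rule integrable_bounded_by[of _ "\<epsilon>"]) (use \<epsilon> in \<open>auto simp: indicator_def\<close>)
  have M: "expectation (M n) \<le> expectation (V i y (u 0))" for n
  proof (induction n)
    case 0
    show ?case
    proof (rule integral_mono)
      show "integrable P (V i y (u 0))" by (rule integrable_bounded_by[of _ 1]) (auto simp: V_bounds[OF _ y])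
      show "M 0 \<omega> \<le> V i y (u 0) \<omega>" if "\<omega> \<in> space P" for \<omega>
        using that by (auto simp: M_def B_def indicator_def)
    qed (use int int2 in \<open>simp add: M_def[abs_def]\<close>)
  next
    case (Suc n)
    have "expectation (M (Suc n)) \<le> expectation (\<lambda>\<omega>. indicator (B n) \<omega> * V i y (u (Suc n)) \<omega> + \<epsilon> * indicator (space P - B n) \<omega>)"
    proof (rule integral_mono)
      fix \<omega> assume w: "\<omega> \<in> space P"
      have "B (Suc n) = B n \<inter> {\<omega>. V i y (u (Suc n)) \<omega> < \<epsilon>}" by (auto simp: B_def le_Suc_eq)
      then show "M (Suc n) \<omega> \<le> indicator (B n) \<omega> * V i y (u (Suc n)) \<omega> + \<epsilon> * indicator (space P - B n) \<omega>"
        using w by (auto simp: M_def indicator_def)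
    qed (use int int2 in \<open>simp_all add: M_def[abs_def]\<close>)
    also have "\<dots> = expectation (\<lambda>\<omega>. indicator (B n) \<omega> * V i y (u (Suc n)) \<omega>) + expectation (\<lambda>\<omega>. \<epsilon> * indicator (space P - B n) \<omega>)"
      using int int2 by simp
    also have "expectation (\<lambda>\<omega>. indicator (B n) \<omega> * V i y (u (Suc n)) \<omega>) \<le> expectation (\<lambda>\<omega>. indicator (B n) \<omega> * V i y (u n) \<omega>)"
    proof (rule V_supermartingale[OF y u0])
      show "indicator (B n) \<in> bounded_F (u n)" using BF[of n] by (auto simp: bounded_F_def indicator_def intro!: exI[of _ 1])
    qed (use monoD[OF u(1)] in auto)
    also have "expectation (\<lambda>\<omega>. indicator (B n) \<omega> * V i y (u n) \<omega>) + expectation (\<lambda>\<omega>. \<epsilon> * indicator (space P - B n) \<omega>) = expectation (M n)"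
      using int int2 by (simp add: M_def[abs_def])
    finally show ?case using Suc by simp
  qed
  have eq: "{\<omega>\<in>space P. \<exists>k\<le>n. \<epsilon> \<le> V i y (u k) \<omega>} = space P - B n" by (auto simp: B_def not_less)
  have "\<epsilon> * prob (space P - B n) = expectation (\<lambda>\<omega>. \<epsilon> * indicator (space P - B n) \<omega>)" by simp
  also have "\<dots> \<le> expectation (M n)"
    by (rule integral_mono) (use int int2 V_bounds[OF _ y] in \<open>auto simp: M_def[abs_def] indicator_def\<close>)
  finally show ?thesis using M[of n] eq by simp
qed

text \<open>
  By continuity an excursion above \<open>\<epsilon>\<close> lasts for a positive time, so it is noticed by all sufficiently fine grids
  of mesh \<open>1 / p\<close>; the grids have \<open>p * p\<close> steps so that they cover every bounded interval eventually.
\<close>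

lemma exceed_on_grid:
  assumes w: "\<omega> \<in> space P" and y: "y \<in> {0..1}" and ex: "s \<le> t" "\<epsilon> < V i y t \<omega>"
  shows "\<forall>\<^sub>F p in sequentially. \<exists>k\<le>p * p. \<epsilon> \<le> V i y (s + real k / real p) \<omega>"
proof -
  have "continuous_on UNIV (\<lambda>t. V i y t \<omega>)"
    unfolding V_def by (intro continuous_intros X_continuous[OF w y])
  then have "isCont (\<lambda>t. V i y t \<omega>) t" by (simp add: continuous_on_eq_continuous_at)
  then have "\<forall>\<^sub>F r in at t. \<epsilon> < V i y r \<omega>" using ex(2) by (auto simp: isCont_def intro: order_tendstoD)
  then obtain \<delta> where \<delta>: "0 < \<delta>" "\<And>r. \<bar>r - t\<bar> < \<delta> \<Longrightarrow> \<epsilon> < V i y r \<omega>"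
    using ex(2) by (auto simp: eventually_at dist_real_def) metis
  have "\<forall>\<^sub>F p in sequentially. 1 / real p < \<delta>" by (rule order_tendstoD(2)[OF lim_1_over_n \<delta>(1)])
  moreover have "\<forall>\<^sub>F p in sequentially. t - s \<le> real p"
    using filterlim_real_sequentially by (simp add: filterlim_at_top)
  moreover have "\<forall>\<^sub>F p in sequentially. (0::nat) < p" by (rule eventually_gt_at_top)
  ultimately show ?thesis
  proof eventually_elim
    case (elim p)
    define k where "k = nat \<lfloor>(t - s) * real p\<rfloor>"
    have ts: "0 \<le> (t - s) * real p" using ex(1) by simp
    have k: "real k \<le> (t - s) * real p" "(t - s) * real p < real k + 1" unfolding k_def using ts by linarith+
    have "(t - s) * real p \<le> real p * real p" using elim by (intro mult_right_mono) auto
    then have "real k \<le> real (p * p)" using k(1) by simp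
    then have "k \<le> p * p" by (simp only: of_nat_le_iff)
    moreover have "\<bar>s + real k / real p - t\<bar> < \<delta>"
    proof -
      have "real k / real p \<le> t - s" using k(1) elim by (simp add: field_simps)
      moreover have "t - s < real k / real p + 1 / real p" using k(2) elim by (simp add: field_simps)
      ultimately show ?thesis using elim by (simp add: abs_if)
    qed
    then have "\<epsilon> < V i y (s + real k / real p) \<omega>" by (rule \<delta>(2))
    ultimately show ?case by (intro exI[of _ k]) auto
  qed
qed

text \<open>
  Fatou's lemma passes from the grids to all times: the probability that \<open>V\<close> exceeds \<open>\<epsilon>\<close> after time
  \<open>s\<close> is at most \<open>1 / (\<epsilon> sqrt s)\<close>.
\<close>

lemma AE_V_eventually_small:
  assumes y: "y \<in> {0..1}" and \<epsilon>: "0 < \<epsilon>"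
  shows "AE \<omega> in P. \<exists>N. \<forall>t\<ge>N. V i y t \<omega> \<le> \<epsilon>"
proof -
  note [measurable] = V_measurable[OF y]
  define G where "G s p = {\<omega>\<in>space P. \<exists>k\<le>p * p. \<epsilon> \<le> V i y (s + real k / real p) \<omega>}" for s and p :: nat
  have Gm [measurable]: "G s p \<in> sets P" for s p unfolding G_def by measurable
  define h where "h s \<omega> = liminf (\<lambda>p. indicator (G s p) \<omega> :: ennreal)" for s \<omega>
  have hm [measurable]: "h s \<in> borel_measurable P" for s unfolding h_def by measurable
  have hint: "(\<integral>\<^sup>+\<omega>. h s \<omega> \<partial>P) \<le> ennreal (1 / sqrt s / \<epsilon>)" if "0 < s" for s
  proof -
    have "emeasure P (G s p) \<le> ennreal (1 / sqrt s / \<epsilon>)" for p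
    proof -
      have "\<epsilon> * prob (G s p) \<le> expectation (V i y s)"
        using V_maximal_inequality[OF y _ _ \<epsilon>, of "\<lambda>k. s + real k / real p" "p * p" i] that
        by (simp add: G_def mono_def divide_right_mono)
      also have "\<dots> \<le> 1 / sqrt s" by (rule expectation_V_decay[OF y that])
      finally have "prob (G s p) \<le> 1 / sqrt s / \<epsilon>" using \<epsilon> by (simp only: pos_le_divide_eq mult.commute)
      then show ?thesis unfolding emeasure_eq_measure by (rule ennreal_leI)
    qed
    then have "liminf (\<lambda>p. emeasure P (G s p)) \<le> ennreal (1 / sqrt s / \<epsilon>)"
      by (intro Liminf_le) auto
    moreover have "(\<integral>\<^sup>+\<omega>. h s \<omega> \<partial>P) \<le> liminf (\<lambda>p. \<integral>\<^sup>+\<omega>. indicator (G s p) \<omega> \<partial>P)"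
      unfolding h_def by (rule nn_integral_liminf) measurable
    ultimately show ?thesis by simp
  qed
  define H where "H \<omega> = (INF N. h (real (Suc N)) \<omega>)" for \<omega>
  have "(\<integral>\<^sup>+\<omega>. H \<omega> \<partial>P) \<le> ennreal (1 / sqrt (real (Suc N)) / \<epsilon>)" for N
    by (rule order_trans[OF nn_integral_mono hint]) (auto simp: H_def intro: INF_lower)
  moreover have "(\<lambda>N. ennreal (1 / sqrt (real (Suc N)) / \<epsilon>)) \<longlonglongrightarrow> ennreal 0"
  proof (intro tendsto_ennrealI)
    have "(\<lambda>N. sqrt (1 / real (Suc N)) / \<epsilon>) \<longlonglongrightarrow> sqrt 0 / \<epsilon>"
      by (intro tendsto_intros LIMSEQ_Suc[OF lim_1_over_n]) (use \<epsilon> in auto)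
    then show "(\<lambda>N. 1 / sqrt (real (Suc N)) / \<epsilon>) \<longlonglongrightarrow> 0" by (simp add: real_sqrt_divide)
  qed
  ultimately have "(\<integral>\<^sup>+\<omega>. H \<omega> \<partial>P) \<le> ennreal 0" by (intro LIMSEQ_le_const) auto
  moreover have "H \<in> borel_measurable P" unfolding H_def by measurable
  ultimately have "AE \<omega> in P. H \<omega> = 0" by (simp add: nn_integral_0_iff_AE)
  then show ?thesis
  proof (rule AE_mp, intro AE_I2 impI)
    fix \<omega> assume w: "\<omega> \<in> space P" and "H \<omega> = 0"
    then have "H \<omega> < 1" by simp
    then obtain N where N: "h (real (Suc N)) \<omega> < 1" by (auto simp: H_def INF_less_iff)
    have "V i y t \<omega> \<le> \<epsilon>" if "real (Suc N) \<le> t" for t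
    proof (rule ccontr)
      assume "\<not> V i y t \<omega> \<le> \<epsilon>"
      then have "\<forall>\<^sub>F p in sequentially. \<exists>k\<le>p * p. \<epsilon> \<le> V i y (real (Suc N) + real k / real p) \<omega>"
        using exceed_on_grid[OF w y that] by simp
      then have "\<forall>\<^sub>F p in sequentially. (1::ennreal) \<le> indicator (G (real (Suc N)) p) \<omega>"
        by eventually_elim (use w in \<open>auto simp: G_def\<close>)
      then have "1 \<le> h (real (Suc N)) \<omega>" unfolding h_def by (rule Liminf_bounded)
      then show False using N by simp
    qed
    then show "\<exists>N. \<forall>t\<ge>N. V i y t \<omega> \<le> \<epsilon>" by blast
  qed
qed

abbreviation ends_in :: "'d \<Rightarrow> real \<Rightarrow> real \<Rightarrow> 'd path \<Rightarrow> bool" where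
  "ends_in i y c \<omega> \<equiv> ((\<lambda>t. X i y t \<omega>) \<longlongrightarrow> c) at_top"

lemma AE_flow_converges:
  assumes y: "y \<in> {0..1}"
  shows "AE \<omega> in P. ends_in i y 0 \<omega> \<or> ends_in i y 1 \<omega>"
proof -
  have "AE \<omega> in P. \<forall>m. \<exists>N. \<forall>t\<ge>N. V i y t \<omega> \<le> 1 / real (Suc m)"
    unfolding AE_all_countable by (intro allI AE_V_eventually_small y) simp
  then show ?thesis
  proof (rule AE_mp, intro AE_I2 impI)
    fix \<omega> assume w: "\<omega> \<in> space P" and small: "\<forall>m. \<exists>N. \<forall>t\<ge>N. V i y t \<omega> \<le> 1 / real (Suc m)"
    have "((\<lambda>t. V i y t \<omega>) \<longlongrightarrow> 0) at_top"
    proof (rule tendstoI)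
      fix e :: real assume "0 < e"
      then obtain m where m: "1 / real (Suc m) < e" using nat_approx_posE by metis
      obtain N where "\<forall>t\<ge>N. V i y t \<omega> \<le> 1 / real (Suc m)" using small by blast
      then have "\<forall>t\<ge>N. dist (V i y t \<omega>) 0 < e"
        using m V_bounds(1)[OF w y, of i] by (auto intro: le_less_trans)
      then show "\<forall>\<^sub>F t in at_top. dist (V i y t \<omega>) 0 < e" by (auto simp: eventually_at_top_linorder)
    qed
    then show "ends_in i y 0 \<omega> \<or> ends_in i y 1 \<omega>"
      unfolding V_def by (intro two_well_limit X_continuous[OF w y] X_bounds[OF w y])
  qed
qed

end

section \<open>Independence of the coordinates\<close>

text \<open>
  The projection to the unit interval. It does not increase the distance to points of that interval, so clipping
  keeps the Euler scheme bounded without enlarging its error.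
\<close>

definition clip :: "real \<Rightarrow> real" where "clip x = max 0 (min 1 x)"

lemma clip_bounds: "0 \<le> clip x" "clip x \<le> 1"
  by (auto simp: clip_def)

lemma clip_nonexpansive: "0 \<le> z \<Longrightarrow> z \<le> 1 \<Longrightarrow> \<bar>z - clip x\<bar> \<le> \<bar>z - x\<bar>"
  by (auto simp: clip_def)

lemma measurable_clip [measurable]: "clip \<in> borel_measurable borel"
  unfolding clip_def by measurable

text \<open>
  The clipped Euler scheme for the equation, as a function of the sequence of increments of the driving
  path.
\<close>

fun euler :: "real \<Rightarrow> (nat \<Rightarrow> real) \<Rightarrow> nat \<Rightarrow> real" where
  "euler y w 0 = y"
| "euler y w (Suc k) = clip (euler y w k + euler y w k * (1 - euler y w k) * w k)"

lemma euler_bounds: "y \<in> {0..1} \<Longrightarrow> 0 \<le> euler y w k" "y \<in> {0..1} \<Longrightarrow> euler y w k \<le> 1"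
  by (cases k; simp add: clip_bounds)+

lemma measurable_euler:
  assumes "n \<le> N" "{..<N} \<times> {i} \<subseteq> J"
  shows "(\<lambda>v. euler y (\<lambda>k. v (k, i)) n) \<in> borel_measurable (Pi\<^sub>M J (\<lambda>_. borel))"
  using assms(1)
proof (induction n)
  case (Suc n)
  then have [measurable]: "(\<lambda>v. euler y (\<lambda>k. v (k, i)) n) \<in> borel_measurable (Pi\<^sub>M J (\<lambda>_. borel))" by simp
  have [measurable]: "(\<lambda>v. v (n, i)) \<in> borel_measurable (Pi\<^sub>M J (\<lambda>_. borel :: real measure))"
    by (rule measurable_component_singleton) (use assms(2) Suc.prems in auto)
  show ?case by simp
qed simp

lemma euler_cong: "(\<And>k. k < n \<Longrightarrow> v k = w k) \<Longrightarrow> euler y v n = euler y w n"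
  by (induction n) auto

context logistic_flow
begin

lemma expectation_X:
  assumes y: "y \<in> {0..1}" and t: "0 \<le> t"
  shows "expectation (X i y t) = y"
proof -
  have one: "(\<lambda>_. 1) \<in> bounded_F 0" by (auto simp: bounded_F_def)
  have int: "integrable P (X i y t)" "integrable P (X i y 0)"
    by (rule bounded_F_integrable[OF X_bounded_F[OF y t]], rule bounded_F_integrable[OF X_bounded_F[OF y order_refl]])
  have "expectation (\<lambda>\<omega>. X i y t \<omega> - X i y 0 \<omega>) = 0"
    using flow_martingale[OF y order_refl t one, of i] by simp
  then have "expectation (X i y t) = expectation (X i y 0)" using int by simp
  also have "\<dots> = expectation (\<lambda>_. y)"
    by (intro Bochner_Integration.integral_cong) (use X_start[OF _ y] in auto)
  finally show ?thesis by (simp add: prob_space)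
qed

text \<open>
  The new error is at most the old error \<open>e\<close> plus a martingale increment \<open>M\<close>, which are orthogonal. The second
  moment of \<open>M\<close> is controlled by \<open>flow_increment_isometry\<close> and the Lipschitz property of the coefficient.
\<close>

lemma euler_step_error:
  assumes y: "y \<in> {0..1}" and s: "0 \<le> s" and h: "0 \<le> h"
    and Z: "Z \<in> bounded_F s" and Zb: "\<And>\<omega>. 0 \<le> Z \<omega>" "\<And>\<omega>. Z \<omega> \<le> 1"
  shows "expectation (\<lambda>\<omega>. (X i y (s + h) \<omega> - clip (Z \<omega> + Z \<omega> * (1 - Z \<omega>) * incr i s (s + h) \<omega>))\<^sup>2)
    \<le> (1 + 2 * h) * expectation (\<lambda>\<omega>. (X i y s \<omega> - Z \<omega>)\<^sup>2) + 2 * h\<^sup>2"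
proof -
  have sh: "s \<le> s + h" "0 \<le> s + h" using s h by auto
  have ZF [measurable]: "Z \<in> borel_measurable (F s)" using Z by (rule bounded_F_measurable)
  have [measurable]: "X i y s \<in> borel_measurable (F s)" using X_bounded_F[OF y s] by (rule bounded_F_measurable)
  have [measurable]: "Z \<in> borel_measurable P" using F_imp_P[OF ZF] .
  note [measurable] = X_measurable[OF y] V_measurable[OF y]
  define S where "S \<omega> = Z \<omega> * (1 - Z \<omega>)" for \<omega>
  define e where "e \<omega> = X i y s \<omega> - Z \<omega>" for \<omega>
  define M where "M \<omega> = X i y (s + h) \<omega> - X i y s \<omega> - S \<omega> * incr i s (s + h) \<omega>" for \<omega>
  define \<epsilon> where "\<epsilon> = expectation (\<lambda>\<omega>. (e \<omega>)\<^sup>2)"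
  have \<epsilon>0: "0 \<le> \<epsilon>" unfolding \<epsilon>_def by simp
  have eb: "\<bar>e \<omega>\<bar> \<le> 1" if "\<omega> \<in> space P" for \<omega>
    using X_bounds[OF that y, of i s] Zb[of \<omega>] by (auto simp: e_def)
  have S: "S \<in> bounded_F s"
    unfolding bounded_F_def S_def using logistic_bounds[OF Zb] by (auto intro!: exI[of _ 1])
  have e: "e \<in> bounded_F s"
    unfolding bounded_F_def using eb by (auto simp: e_def[abs_def] intro!: exI[of _ 1])
  have [measurable]: "S \<in> borel_measurable P" "e \<in> borel_measurable P" "M \<in> borel_measurable P"
    unfolding S_def e_def M_def by measurable
  have ei: "integrable P (\<lambda>\<omega>. (e \<omega>)\<^sup>2)"
    by (rule integrable_bounded_by[of _ 1]) (use eb in \<open>auto simp: abs_square_le_1\<close>)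
  have inner: "l2_dist P (V i y r) S \<le> ennreal (2 * h + 2 * \<epsilon>)" if r: "r \<in> {s<..s + h}" for r
  proof -
    have "l2_dist P (V i y r) S \<le> l2_dist P (\<lambda>\<omega>. X i y r \<omega> - Z \<omega>) (\<lambda>\<omega>. X i y s \<omega> - X i y s \<omega>)"
      unfolding l2_dist_def
    proof (intro nn_integral_mono ennreal_leI)
      fix \<omega> assume w: "\<omega> \<in> space P"
      have "\<bar>V i y r \<omega> - S \<omega>\<bar> \<le> \<bar>X i y r \<omega> - Z \<omega>\<bar>"
        unfolding V_def S_def by (intro logistic_lipschitz X_bounds[OF w y] Zb)
      then show "(V i y r \<omega> - S \<omega>)\<^sup>2 \<le> (X i y r \<omega> - Z \<omega> - (X i y s \<omega> - X i y s \<omega>))\<^sup>2"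
        by (simp add: abs_le_square_iff)
    qed
    also have "\<dots> \<le> 2 * l2_dist P (X i y r) (X i y s) + 2 * l2_dist P Z (X i y s)"
      by (rule l2_dist_diff_le) measurable
    also have "\<dots> \<le> 2 * ennreal h + 2 * ennreal \<epsilon>"
    proof (intro add_mono mult_left_mono)
      have "l2_dist P (X i y r) (X i y s) \<le> ennreal (r - s)"
        by (rule flow_increment_norm_le[OF y s]) (use r in auto)
      also have "\<dots> \<le> ennreal h" by (rule ennreal_leI) (use r in auto)
      finally show "l2_dist P (X i y r) (X i y s) \<le> ennreal h" .
      have "l2_dist P (X i y s) Z = ennreal \<epsilon>"
        using l2_dist_eq_expectation[of "X i y s" Z] ei by (simp add: e_def \<epsilon>_def)
      then show "l2_dist P Z (X i y s) \<le> ennreal \<epsilon>" by (simp add: l2_dist_commute[of P Z])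
    qed auto
    also have "\<dots> = ennreal (2 * h + 2 * \<epsilon>)" using h \<epsilon>0 by (simp add: ennreal_mult)
    finally show ?thesis .
  qed
  have "l2_dist P M (\<lambda>_. 0) = (\<integral>\<^sup>+r. l2_dist P (V i y r) S * indicator {s<..s + h} r \<partial>lborel)"
    unfolding M_def by (rule flow_increment_isometry[OF y s sh(1) S])
  also have "\<dots> \<le> (\<integral>\<^sup>+r. ennreal (2 * h + 2 * \<epsilon>) * indicator {s<..s + h} r \<partial>lborel)"
    by (intro nn_integral_mono) (auto simp: indicator_def intro!: inner)
  also have "\<dots> = ennreal ((2 * h + 2 * \<epsilon>) * h)"
    using h \<epsilon>0 by (simp add: nn_integral_cmult_indicator ennreal_mult del: ennreal_plus)
  finally have Mn: "l2_dist P M (\<lambda>_. 0) \<le> ennreal ((2 * h + 2 * \<epsilon>) * h)" .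
  then have Mi: "integrable P (\<lambda>\<omega>. (M \<omega>)\<^sup>2)"
    by (subst integrable_square_iff) (auto intro: le_less_trans)
  have ME: "expectation (\<lambda>\<omega>. (M \<omega>)\<^sup>2) \<le> (2 * h + 2 * \<epsilon>) * h"
  proof -
    have "ennreal (expectation (\<lambda>\<omega>. (M \<omega>)\<^sup>2)) \<le> ennreal ((2 * h + 2 * \<epsilon>) * h)"
      using Mn l2_dist_eq_expectation[of M "\<lambda>_. 0"] Mi by simp
    then show ?thesis using h \<epsilon>0 by (subst (asm) ennreal_le_iff) auto
  qed
  have eS: "(\<lambda>\<omega>. e \<omega> * S \<omega>) \<in> bounded_F s" using bounded_F_mult[OF e S] by simp
  note eSW = past_times_increment(1,2)[OF bounded_F_measurable[OF eS] bounded_F_integrable[OF eS] s sh(1), of i]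
  have eX: "integrable P (\<lambda>\<omega>. e \<omega> * (X i y (s + h) \<omega> - X i y s \<omega>))"
  proof (rule integrable_bounded_by[of _ 1])
    fix \<omega> assume w: "\<omega> \<in> space P"
    have "\<bar>X i y (s + h) \<omega> - X i y s \<omega>\<bar> \<le> 1"
      using X_bounds[OF w y, of i s] X_bounds[OF w y, of i "s + h"] by auto
    then show "\<bar>e \<omega> * (X i y (s + h) \<omega> - X i y s \<omega>)\<bar> \<le> 1"
      using eb[OF w] by (simp add: abs_mult mult_le_one)
  qed measurable
  have eM_eq: "(\<lambda>\<omega>. e \<omega> * M \<omega>) = (\<lambda>\<omega>. e \<omega> * (X i y (s + h) \<omega> - X i y s \<omega>) - e \<omega> * S \<omega> * incr i s (s + h) \<omega>)"
    by (simp add: M_def fun_eq_iff algebra_simps)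
  have eM: "integrable P (\<lambda>\<omega>. e \<omega> * M \<omega>)" "expectation (\<lambda>\<omega>. e \<omega> * M \<omega>) = 0"
    unfolding eM_eq using eX eSW flow_martingale[OF y s sh(1) e, of i] by auto
  have sq: "(\<lambda>\<omega>. (e \<omega> + M \<omega>)\<^sup>2) = (\<lambda>\<omega>. (e \<omega>)\<^sup>2 + (M \<omega>)\<^sup>2 + 2 * (e \<omega> * M \<omega>))"
    by (simp add: fun_eq_iff power2_eq_square algebra_simps)
  have "expectation (\<lambda>\<omega>. (X i y (s + h) \<omega> - clip (Z \<omega> + S \<omega> * incr i s (s + h) \<omega>))\<^sup>2)
      \<le> expectation (\<lambda>\<omega>. (e \<omega> + M \<omega>)\<^sup>2)"
  proof (rule integral_mono)
    show "integrable P (\<lambda>\<omega>. (e \<omega> + M \<omega>)\<^sup>2)" unfolding sq using ei Mi eM by auto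
    show "integrable P (\<lambda>\<omega>. (X i y (s + h) \<omega> - clip (Z \<omega> + S \<omega> * incr i s (s + h) \<omega>))\<^sup>2)"
    proof (rule integrable_bounded_by[of _ 1])
      fix \<omega> assume w: "\<omega> \<in> space P"
      have "\<bar>X i y (s + h) \<omega> - clip (Z \<omega> + S \<omega> * incr i s (s + h) \<omega>)\<bar> \<le> 1"
        using X_bounds[OF w y, of i "s + h"] clip_bounds[of "Z \<omega> + S \<omega> * incr i s (s + h) \<omega>"]
        unfolding abs_le_iff by linarith
      then show "\<bar>(X i y (s + h) \<omega> - clip (Z \<omega> + S \<omega> * incr i s (s + h) \<omega>))\<^sup>2\<bar> \<le> 1"
        by (simp add: abs_square_le_1)
    qed measurable
    fix \<omega> assume w: "\<omega> \<in> space P"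
    have "\<bar>X i y (s + h) \<omega> - clip (Z \<omega> + S \<omega> * incr i s (s + h) \<omega>)\<bar>
        \<le> \<bar>X i y (s + h) \<omega> - (Z \<omega> + S \<omega> * incr i s (s + h) \<omega>)\<bar>"
      by (rule clip_nonexpansive) (rule X_bounds[OF w y])+
    also have "\<dots> = \<bar>e \<omega> + M \<omega>\<bar>" by (simp add: e_def M_def algebra_simps)
    finally show "(X i y (s + h) \<omega> - clip (Z \<omega> + S \<omega> * incr i s (s + h) \<omega>))\<^sup>2 \<le> (e \<omega> + M \<omega>)\<^sup>2"
      by (simp add: abs_le_square_iff)
  qed
  also have "\<dots> = \<epsilon> + expectation (\<lambda>\<omega>. (M \<omega>)\<^sup>2)"
    unfolding sq using ei Mi eM by (simp add: \<epsilon>_def)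
  also have "\<dots> \<le> \<epsilon> + (2 * h + 2 * \<epsilon>) * h" using ME by simp
  also have "\<dots> = (1 + 2 * h) * \<epsilon> + 2 * h\<^sup>2" by (simp add: algebra_simps power2_eq_square)
  finally show ?thesis unfolding S_def \<epsilon>_def e_def .
qed

definition scheme :: "'d \<Rightarrow> real \<Rightarrow> real \<Rightarrow> nat \<Rightarrow> 'd path \<Rightarrow> real" where
  "scheme i y h n \<omega> = euler y (\<lambda>k. incr i (real k * h) (real (Suc k) * h) \<omega>) n"

lemma scheme_bounded_F:
  assumes "y \<in> {0..1}" "0 \<le> h" shows "scheme i y h n \<in> bounded_F (real n * h)"
proof -
  have "scheme i y h n \<in> borel_measurable (F (real n * h))"
  proof (induction n)
    case 0 then show ?case by (simp add: scheme_def[abs_def])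
  next
    case (Suc n)
    have le: "real n * h \<le> real (Suc n) * h" using assms(2) by (intro mult_right_mono) auto
    have [measurable]: "scheme i y h n \<in> borel_measurable (F (real (Suc n) * h))" by (rule F_mono[OF le Suc])
    have [measurable]: "incr i (real n * h) (real (Suc n) * h) \<in> borel_measurable (F (real (Suc n) * h))"
      by (rule incr_measurable_F) (use assms(2) le in auto)
    have "scheme i y h (Suc n) = (\<lambda>\<omega>. clip (scheme i y h n \<omega> + scheme i y h n \<omega> * (1 - scheme i y h n \<omega>) * incr i (real n * h) (real (Suc n) * h) \<omega>))"
      by (simp add: fun_eq_iff scheme_def)
    also have "\<dots> \<in> borel_measurable (F (real (Suc n) * h))" by measurable
    finally show ?case .
  qed
  then show ?thesis unfolding bounded_F_def scheme_def using euler_bounds[OF assms(1)] by (auto intro!: exI[of _ 1])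
qed

lemma scheme_error:
  assumes y: "y \<in> {0..1}" and h: "0 \<le> h"
  shows "expectation (\<lambda>\<omega>. (X i y (real n * h) \<omega> - scheme i y h n \<omega>)\<^sup>2) \<le> 2 * real n * h\<^sup>2 * (1 + 2 * h) ^ n"
proof (induction n)
  case 0
  have "expectation (\<lambda>\<omega>. (X i y 0 \<omega> - scheme i y h 0 \<omega>)\<^sup>2) = expectation (\<lambda>\<omega>. 0)"
    by (intro Bochner_Integration.integral_cong) (use X_start[OF _ y] in \<open>auto simp: scheme_def\<close>)
  then show ?case by simp
next
  case (Suc n)
  have nh: "real (Suc n) * h = real n * h + h" "0 \<le> real n * h" using h by (auto simp: algebra_simps)
  have "expectation (\<lambda>\<omega>. (X i y (real (Suc n) * h) \<omega> - scheme i y h (Suc n) \<omega>)\<^sup>2)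
     \<le> (1 + 2 * h) * expectation (\<lambda>\<omega>. (X i y (real n * h) \<omega> - scheme i y h n \<omega>)\<^sup>2) + 2 * h\<^sup>2"
    using euler_step_error[OF y nh(2) h scheme_bounded_F[OF y h, of i n], of i] euler_bounds[OF y]
    unfolding nh(1) by (simp add: scheme_def nh(1)[simplified of_nat_Suc])
  also have "\<dots> \<le> (1 + 2 * h) * (2 * real n * h\<^sup>2 * (1 + 2 * h) ^ n) + 2 * h\<^sup>2 * (1 + 2 * h) ^ Suc n"
  proof (intro add_mono mult_left_mono)
    have "1 \<le> (1 + 2 * h) ^ Suc n" using h by (intro one_le_power) simp
    then show "2 * h\<^sup>2 \<le> 2 * h\<^sup>2 * (1 + 2 * h) ^ Suc n"
      using mult_left_mono[of 1 "(1 + 2 * h) ^ Suc n" "2 * h\<^sup>2"] by simp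
  qed (use Suc h in auto)
  also have "\<dots> = 2 * real (Suc n) * h\<^sup>2 * (1 + 2 * h) ^ Suc n" by (simp add: algebra_simps)
  finally show ?case .
qed

lemma scheme_converges:
  assumes y: "y \<in> {0..1}" and t: "0 < t"
  shows "(\<lambda>n. expectation (\<lambda>\<omega>. \<bar>X i y t \<omega> - scheme i y (t / real (Suc n)) (Suc n) \<omega>\<bar>)) \<longlonglongrightarrow> 0"
proof -
  have bnd: "expectation (\<lambda>\<omega>. (X i y t \<omega> - scheme i y (t / real (Suc n)) (Suc n) \<omega>)\<^sup>2) \<le> 2 * t\<^sup>2 * exp (2 * t) * (1 / real (Suc n))" for n
  proof -
    define h where "h = t / real (Suc n)"
    have h: "0 \<le> h" "real (Suc n) * h = t" using t by (auto simp: h_def)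
    \<comment> \<open>With \<open>n + 1\<close> steps of length \<open>h\<close> the error constant stays bounded, as in the discrete Gronwall lemma.\<close>
    have "(1 + 2 * h) ^ Suc n \<le> exp (2 * h) ^ Suc n" using h by (intro power_mono exp_ge_add_one_self) auto
    also have "\<dots> = exp (real (Suc n) * (2 * h))" by (rule exp_of_nat_mult[symmetric])
    also have "real (Suc n) * (2 * h) = 2 * t" using h(2) by simp
    finally have p: "(1 + 2 * h) ^ Suc n \<le> exp (2 * t)" .
    have "expectation (\<lambda>\<omega>. (X i y t \<omega> - scheme i y h (Suc n) \<omega>)\<^sup>2) \<le> 2 * real (Suc n) * h\<^sup>2 * (1 + 2 * h) ^ Suc n"
      using scheme_error[OF y h(1), of i "Suc n"] unfolding h(2) .
    also have "\<dots> \<le> 2 * real (Suc n) * h\<^sup>2 * exp (2 * t)" using p by (intro mult_left_mono) auto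
    also have "2 * real (Suc n) * h\<^sup>2 = 2 * t\<^sup>2 * (1 / real (Suc n))"
      unfolding h_def by (simp add: power2_eq_square field_simps del: of_nat_Suc)
    finally show ?thesis unfolding h_def by (simp add: mult_ac)
  qed
  have "(\<lambda>n. sqrt (2 * t\<^sup>2 * exp (2 * t) * (1 / real (Suc n)))) \<longlonglongrightarrow> sqrt (2 * t\<^sup>2 * exp (2 * t) * 0)"
    by (intro tendsto_intros LIMSEQ_Suc[OF lim_1_over_n])
  then have lim: "(\<lambda>n. sqrt (2 * t\<^sup>2 * exp (2 * t) * (1 / real (Suc n)))) \<longlonglongrightarrow> 0" by simp
  have "expectation (\<lambda>\<omega>. \<bar>X i y t \<omega> - scheme i y (t / real (Suc n)) (Suc n) \<omega>\<bar>) \<le> sqrt (2 * t\<^sup>2 * exp (2 * t) * (1 / real (Suc n)))" for n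
  proof -
    define f where "f \<omega> = \<bar>X i y t \<omega> - scheme i y (t / real (Suc n)) (Suc n) \<omega>\<bar>" for \<omega>
    have [measurable]: "X i y t \<in> borel_measurable P" "scheme i y (t / real (Suc n)) (Suc n) \<in> borel_measurable P"
      using X_measurable[OF y] F_imp_P[OF bounded_F_measurable[OF scheme_bounded_F[OF y]]] t by auto
    have m: "f \<in> borel_measurable P" unfolding f_def by measurable
    have "\<bar>f \<omega>\<bar> \<le> 1" if "\<omega> \<in> space P" for \<omega>
      using X_bounds[OF that y, of i t] euler_bounds[OF y] unfolding f_def scheme_def by (smt (verit))
    then have i2: "integrable P (\<lambda>\<omega>. (f \<omega>)\<^sup>2)"
      using m by (intro integrable_bounded_by[of _ 1]) (auto simp: abs_square_le_1)
    have "(expectation f)\<^sup>2 \<le> expectation (\<lambda>\<omega>. (f \<omega>)\<^sup>2)" by (rule expectation_square_le(2)[OF m i2])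
    also have "\<dots> \<le> 2 * t\<^sup>2 * exp (2 * t) * (1 / real (Suc n))" using bnd[of n] by (simp add: f_def)
    finally have "expectation f \<le> sqrt (2 * t\<^sup>2 * exp (2 * t) * (1 / real (Suc n)))" by (rule real_le_rsqrt)
    then show ?thesis by (simp add: f_def[abs_def])
  qed
  then show ?thesis
    by (intro Lim_null_comparison[OF _ lim] always_eventually allI) (simp add: integral_nonneg_AE)
qed

text \<open>
  The schemes of different coordinates are functions of disjoint families of increments.
\<close>

lemma scheme_independent:
  assumes t: "0 < h" and y: "\<And>i. a i \<in> {0..1}" "\<And>i. b i \<in> {0..1}"
  shows "expectation (\<lambda>\<omega>. \<Prod>i\<in>I. (scheme i (b i) h n \<omega> - scheme i (a i) h n \<omega>))
    = (\<Prod>i\<in>I. expectation (\<lambda>\<omega>. scheme i (b i) h n \<omega> - scheme i (a i) h n \<omega>))"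
proof -
  define W where "W p = incr (snd p) (real (fst p) * h) (real (Suc (fst p)) * h)" for p :: "nat \<times> 'd"
  have "strict_mono (\<lambda>k. real k * h)" using t by (auto simp: strict_mono_def)
  from indep_increments_grid[OF this, of n]
  have "indep_vars (\<lambda>_. borel) W ({..<n} \<times> UNIV)" by (simp add: W_def[abs_def])
  then have ind: "indep_vars (\<lambda>i. Pi\<^sub>M ({..<n} \<times> {i}) (\<lambda>_. borel)) (\<lambda>i \<omega>. restrict (\<lambda>p. W p \<omega>) ({..<n} \<times> {i})) I"
    by (rule indep_vars_restrict) (auto simp: disjoint_family_on_def)
  define g where "g i v = euler (b i) (\<lambda>k. v (k, i)) n - euler (a i) (\<lambda>k. v (k, i)) n" for i :: 'd and v
  have "indep_vars (\<lambda>_. borel) (\<lambda>i \<omega>. g i (restrict (\<lambda>p. W p \<omega>) ({..<n} \<times> {i}))) I"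
  proof (rule indep_vars_compose2[OF ind])
    fix i
    show "g i \<in> Pi\<^sub>M ({..<n} \<times> {i}) (\<lambda>_. borel) \<rightarrow>\<^sub>M borel"
      unfolding g_def by (intro borel_measurable_diff measurable_euler[of n n]) auto
  qed
  moreover have "g i (restrict (\<lambda>p. W p \<omega>) ({..<n} \<times> {i})) = scheme i (b i) h n \<omega> - scheme i (a i) h n \<omega>" for i \<omega>
  proof -
    have "euler c (\<lambda>k. restrict (\<lambda>p. W p \<omega>) ({..<n} \<times> {i}) (k, i)) n = scheme i c h n \<omega>" for c
      unfolding scheme_def by (rule euler_cong) (simp add: W_def)
    then show ?thesis by (simp add: g_def)
  qed
  ultimately have iv: "indep_vars (\<lambda>_. borel) (\<lambda>i \<omega>. scheme i (b i) h n \<omega> - scheme i (a i) h n \<omega>) I" by simp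
  have "integrable P (\<lambda>\<omega>. scheme i (b i) h n \<omega> - scheme i (a i) h n \<omega>)" for i
    using bounded_F_integrable[OF scheme_bounded_F[OF y(1)]] bounded_F_integrable[OF scheme_bounded_F[OF y(2)]] t by simp
  then show ?thesis by (intro indep_vars_lebesgue_integral iv) auto
qed

text \<open>
  For the Euler scheme the expectation factorizes; both sides converge as the mesh tends to 0, and the mean
  of \<open>X i y t\<close> is \<open>y\<close>.
\<close>

lemma expectation_prod_spread:
  assumes t: "0 < t" and y: "\<And>i. a i \<in> {0..1}" "\<And>i. b i \<in> {0..1}"
  shows "expectation (\<lambda>\<omega>. \<Prod>i\<in>I. (X i (b i) t \<omega> - X i (a i) t \<omega>)) = (\<Prod>i\<in>I. (b i - a i))"
proof -
  define A where "A i \<omega> = X i (b i) t \<omega> - X i (a i) t \<omega>" for i \<omega>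
  define Z where "Z n i \<omega> = scheme i (b i) (t / real (Suc n)) (Suc n) \<omega> - scheme i (a i) (t / real (Suc n)) (Suc n) \<omega>" for n i \<omega>
  have hpos: "0 \<le> t / real (Suc n)" "0 < t / real (Suc n)" for n using t by auto
  note Xm [measurable] = X_measurable[OF y(1)] X_measurable[OF y(2)]
  have [measurable]: "scheme i (a i) (t / real (Suc n)) (Suc n) \<in> borel_measurable P"
    "scheme i (b i) (t / real (Suc n)) (Suc n) \<in> borel_measurable P" for i n
    using F_imp_P[OF bounded_F_measurable[OF scheme_bounded_F[OF y(1) hpos(1)]]]
      F_imp_P[OF bounded_F_measurable[OF scheme_bounded_F[OF y(2) hpos(1)]]] by auto
  have Am [measurable]: "A i \<in> borel_measurable P" and Zm [measurable]: "Z n i \<in> borel_measurable P" for i n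
    unfolding A_def Z_def by measurable
  have Ab: "norm (A i \<omega>) \<le> 1" if "\<omega> \<in> space P" for i \<omega>
    using X_bounds[OF that y(1), of i i t] X_bounds[OF that y(2), of i i t] unfolding A_def real_norm_def abs_le_iff by linarith
  have Zb: "norm (Z n i \<omega>) \<le> 1" for n i \<omega>
    unfolding Z_def scheme_def real_norm_def using euler_bounds[OF y(1)] euler_bounds[OF y(2)] by (smt (verit))
  have Ai: "integrable P (A i)" and Zi: "integrable P (Z n i)" for n i
    using Ab Zb by (auto intro!: integrable_bounded_by[of _ 1])
  have pA: "\<bar>\<Prod>i\<in>I. A i \<omega>\<bar> \<le> 1" if "\<omega> \<in> space P" for \<omega>
    using Ab[OF that] by (simp add: abs_prod prod_le_1)
  have pZ: "\<bar>\<Prod>i\<in>I. Z n i \<omega>\<bar> \<le> 1" for n \<omega>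
    using Zb by (simp add: abs_prod prod_le_1)
  have pi: "integrable P (\<lambda>\<omega>. \<Prod>i\<in>I. A i \<omega>)" "integrable P (\<lambda>\<omega>. \<Prod>i\<in>I. Z n i \<omega>)" for n
    using pA pZ by (auto intro!: integrable_bounded_by[of _ 1])
  have lim_i: "(\<lambda>n. expectation (\<lambda>\<omega>. \<bar>Z n i \<omega> - A i \<omega>\<bar>)) \<longlonglongrightarrow> 0" for i
  proof (rule Lim_null_comparison)
    let ?d = "\<lambda>c n \<omega>. \<bar>X i c t \<omega> - scheme i c (t / real (Suc n)) (Suc n) \<omega>\<bar>"
    have "(\<lambda>n. expectation (?d (b i) n) + expectation (?d (a i) n)) \<longlonglongrightarrow> 0 + 0"
      by (intro tendsto_add scheme_converges t y)
    then show "(\<lambda>n. expectation (?d (b i) n) + expectation (?d (a i) n)) \<longlonglongrightarrow> 0" by simp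
    have di: "integrable P (?d c n)" if "c \<in> {0..1}" for c n
      using bounded_F_integrable[OF scheme_bounded_F[OF that hpos(1)[of n]]] bounded_F_integrable[OF X_bounded_F[OF that less_imp_le[OF t]]]
      by (intro integrable_abs Bochner_Integration.integrable_diff) 
    have "expectation (\<lambda>\<omega>. \<bar>Z n i \<omega> - A i \<omega>\<bar>) \<le> expectation (\<lambda>\<omega>. ?d (b i) n \<omega> + ?d (a i) n \<omega>)" for n
    proof (rule integral_mono)
      show "integrable P (\<lambda>\<omega>. \<bar>Z n i \<omega> - A i \<omega>\<bar>)" using Zi Ai by auto
      show "integrable P (\<lambda>\<omega>. ?d (b i) n \<omega> + ?d (a i) n \<omega>)" using di y by auto
    qed (auto simp: Z_def A_def)
    also have "expectation (\<lambda>\<omega>. ?d (b i) n \<omega> + ?d (a i) n \<omega>) = expectation (?d (b i) n) + expectation (?d (a i) n)" for n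
      using di y by simp
    finally show "\<forall>\<^sub>F n in sequentially. norm (expectation (\<lambda>\<omega>. \<bar>Z n i \<omega> - A i \<omega>\<bar>)) \<le> expectation (?d (b i) n) + expectation (?d (a i) n)"
      by (simp add: integral_nonneg_AE)
  qed
  have "(\<lambda>n. expectation (\<lambda>\<omega>. \<Prod>i\<in>I. Z n i \<omega>)) \<longlonglongrightarrow> expectation (\<lambda>\<omega>. \<Prod>i\<in>I. A i \<omega>)"
  proof (rule LIM_zero_cancel, rule Lim_null_comparison)
    have "(\<lambda>n. \<Sum>i\<in>I. expectation (\<lambda>\<omega>. \<bar>Z n i \<omega> - A i \<omega>\<bar>)) \<longlonglongrightarrow> (\<Sum>i\<in>I. 0)"
      by (intro tendsto_sum lim_i)
    then show "(\<lambda>n. \<Sum>i\<in>I. expectation (\<lambda>\<omega>. \<bar>Z n i \<omega> - A i \<omega>\<bar>)) \<longlonglongrightarrow> 0" by simp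
    have "norm (expectation (\<lambda>\<omega>. \<Prod>i\<in>I. Z n i \<omega>) - expectation (\<lambda>\<omega>. \<Prod>i\<in>I. A i \<omega>)) \<le> (\<Sum>i\<in>I. expectation (\<lambda>\<omega>. \<bar>Z n i \<omega> - A i \<omega>\<bar>))" for n
    proof -
      have "norm (expectation (\<lambda>\<omega>. \<Prod>i\<in>I. Z n i \<omega>) - expectation (\<lambda>\<omega>. \<Prod>i\<in>I. A i \<omega>))
          = norm (expectation (\<lambda>\<omega>. (\<Prod>i\<in>I. Z n i \<omega>) - (\<Prod>i\<in>I. A i \<omega>)))" using pi by simp
      also have "\<dots> \<le> expectation (\<lambda>\<omega>. \<Sum>i\<in>I. \<bar>Z n i \<omega> - A i \<omega>\<bar>)"
      proof (rule order_trans[OF integral_norm_bound], rule integral_mono)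
        fix \<omega> assume w: "\<omega> \<in> space P"
        show "norm ((\<Prod>i\<in>I. Z n i \<omega>) - (\<Prod>i\<in>I. A i \<omega>)) \<le> (\<Sum>i\<in>I. \<bar>Z n i \<omega> - A i \<omega>\<bar>)"
          using norm_prod_diff[of I "\<lambda>i. Z n i \<omega>" "\<lambda>i. A i \<omega>"] Zb Ab[OF w] by simp
      qed (use pi Zi Ai in auto)
      also have "\<dots> = (\<Sum>i\<in>I. expectation (\<lambda>\<omega>. \<bar>Z n i \<omega> - A i \<omega>\<bar>))"
        using Zi Ai by (subst Bochner_Integration.integral_sum) auto
      finally show ?thesis .
    qed
    then show "\<forall>\<^sub>F n in sequentially. norm (expectation (\<lambda>\<omega>. \<Prod>i\<in>I. Z n i \<omega>) - expectation (\<lambda>\<omega>. \<Prod>i\<in>I. A i \<omega>)) \<le> (\<Sum>i\<in>I. expectation (\<lambda>\<omega>. \<bar>Z n i \<omega> - A i \<omega>\<bar>))"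
      by simp
  qed
  moreover have "(\<lambda>n. expectation (\<lambda>\<omega>. \<Prod>i\<in>I. Z n i \<omega>)) \<longlonglongrightarrow> (\<Prod>i\<in>I. b i - a i)"
  proof -
    have "expectation (A i) = b i - a i" for i
      unfolding A_def using bounded_F_integrable[OF X_bounded_F[OF y(1) less_imp_le[OF t]]]
        bounded_F_integrable[OF X_bounded_F[OF y(2) less_imp_le[OF t]]] expectation_X[OF y(1), of t] expectation_X[OF y(2), of t] t
      by simp
    moreover have "(\<lambda>n. expectation (Z n i)) \<longlonglongrightarrow> expectation (A i)" for i
    proof (rule LIM_zero_cancel, rule Lim_null_comparison[OF _ lim_i[of i]])
      have "norm (expectation (Z n i) - expectation (A i)) \<le> expectation (\<lambda>\<omega>. \<bar>Z n i \<omega> - A i \<omega>\<bar>)" for n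
        using integral_norm_bound[of P "\<lambda>\<omega>. Z n i \<omega> - A i \<omega>"] Zi Ai by simp
      then show "\<forall>\<^sub>F n in sequentially. norm (expectation (Z n i) - expectation (A i)) \<le> expectation (\<lambda>\<omega>. \<bar>Z n i \<omega> - A i \<omega>\<bar>)" by simp
    qed
    ultimately have "(\<lambda>n. \<Prod>i\<in>I. expectation (Z n i)) \<longlonglongrightarrow> (\<Prod>i\<in>I. b i - a i)"
      by (intro tendsto_prod) simp
    moreover have "expectation (\<lambda>\<omega>. \<Prod>i\<in>I. Z n i \<omega>) = (\<Prod>i\<in>I. expectation (Z n i))" for n
      unfolding Z_def by (rule scheme_independent[OF hpos(2) y])
    ultimately show ?thesis by simp
  qed
  ultimately show ?thesis unfolding A_def by (rule LIMSEQ_unique)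
qed

end

section \<open>Critical points and attraction\<close>

context logistic_flow
begin

lemma X_endpoints:
  assumes "\<omega> \<in> space P" shows "X i 0 t \<omega> = 0" "X i 1 t \<omega> = 1"
  using increasing_bijection_endpoints[of "\<lambda>y. X i y t \<omega>"] coordinate_bijection[OF assms, of i t] by auto

text \<open>
  The threshold \<open>c\<^sub>i\<close> between the starts that are driven to 0 and those that are driven to 1. The supremum is
  taken over a nonempty set, since 0 is a fixed point of the flow.
\<close>

definition critical :: "'d \<Rightarrow> 'd path \<Rightarrow> real" where
  "critical i \<omega> = Sup {y \<in> {0..1}. ends_in i y 0 \<omega>}"

text \<open>
  Convergence for rational starting points only, which is a countable requirement; monotonicity extends it to all
  starting points other than the critical one.
\<close>

definition regular :: "'d path \<Rightarrow> bool" where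
  "regular \<omega> \<longleftrightarrow> \<omega> \<in> space P \<and> (\<forall>i. \<forall>q\<in>\<rat> \<inter> {0..1}.
     ends_in i q 0 \<omega> \<or> ends_in i q 1 \<omega>)"

lemma AE_regular: "AE \<omega> in P. regular \<omega>"
proof -
  have c: "countable (\<rat> \<inter> {0..1::real})" using countable_rat by (rule countable_Int1)
  have "AE \<omega> in P. \<forall>i. \<forall>q\<in>\<rat> \<inter> {0..1}.
     ends_in i q 0 \<omega> \<or> ends_in i q 1 \<omega>"
    unfolding AE_all_countable AE_ball_countable[OF c] by (intro allI ballI AE_flow_converges) auto
  with AE_space show ?thesis by eventually_elim (auto simp: regular_def)
qed

lemma critical_nonempty: "\<omega> \<in> space P \<Longrightarrow> 0 \<in> {y \<in> {0..1}. ends_in i y 0 \<omega>}"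
  by (simp add: X_endpoints)

lemma bdd_above_critical: "bdd_above {y \<in> {0..1::real}. R y}"
  by (rule bdd_aboveI[of _ 1]) auto

lemma critical_bounds:
  assumes "\<omega> \<in> space P" shows "0 \<le> critical i \<omega>" "critical i \<omega> \<le> 1"
proof -
  show "0 \<le> critical i \<omega>"
    unfolding critical_def by (rule cSup_upper[OF critical_nonempty[OF assms] bdd_above_critical])
  have "{y \<in> {0..1}. ends_in i y 0 \<omega>} \<noteq> {}" using critical_nonempty[OF assms, of i] by blast
  then show "critical i \<omega> \<le> 1" unfolding critical_def by (rule cSup_least) auto
qed

lemma below_critical:
  assumes w: "\<omega> \<in> space P" and y: "0 \<le> y" "y < critical i \<omega>"
  shows "ends_in i y 0 \<omega>"
proof -
  have "{y \<in> {0..1}. ends_in i y 0 \<omega>} \<noteq> {}" using critical_nonempty[OF w, of i] by blast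
  from less_cSupD[OF this y(2)[unfolded critical_def]]
  obtain z where z: "z \<in> {0..1}" "ends_in i z 0 \<omega>" "y < z" by blast
  show ?thesis
  proof (rule tendsto_sandwich[OF _ _ tendsto_const z(2)])
    show "\<forall>\<^sub>F t in at_top. 0 \<le> X i y t \<omega>" using X_bounds(1)[OF w, of y i] y z by auto
    show "\<forall>\<^sub>F t in at_top. X i y t \<omega> \<le> X i z t \<omega>" using X_mono[OF w y(1), of z i] z by auto
  qed
qed

lemma above_critical:
  assumes r: "regular \<omega>" and y: "critical i \<omega> < y" "y \<le> 1"
  shows "ends_in i y 1 \<omega>"
proof -
  have w: "\<omega> \<in> space P" using r by (simp add: regular_def)
  obtain q where q: "q \<in> \<rat>" "critical i \<omega> < q" "q < y" using Rats_dense_in_real[OF y(1)] by auto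
  have q01: "0 \<le> q" "q \<le> 1" using q y critical_bounds(1)[OF w, of i] by auto
  have "\<not> ends_in i q 0 \<omega>"
    using cSup_upper[OF _ bdd_above_critical, of q "\<lambda>y. ends_in i y 0 \<omega>"] q01 q(2)
    unfolding critical_def by auto
  then have lim: "ends_in i q 1 \<omega>"
  proof -
    have "q \<in> \<rat> \<inter> {0..1}" using q01 q(1) by simp
    with \<open>\<not> ends_in i q 0 \<omega>\<close> r show ?thesis unfolding regular_def by blast
  qed
  show ?thesis
  proof (rule tendsto_sandwich[OF _ _ lim tendsto_const])
    show "\<forall>\<^sub>F t in at_top. X i q t \<omega> \<le> X i y t \<omega>" using X_mono[OF w q01(1), of y i] q y by auto
    show "\<forall>\<^sub>F t in at_top. X i y t \<omega> \<le> 1" using X_bounds(2)[OF w, of y i] y q q01 by auto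
  qed
qed

text \<open>
  The event says that the critical point lies in the box with corners \<open>a\<close> and \<open>b\<close>, up to its boundary. On it the
  product of the spreads \<open>X i (b i) t - X i (a i) t\<close> tends to 1, while the mean of this product is the volume of the
  box at all times; Fatou's lemma concludes.
\<close>

lemma separating_box_probability:
  assumes ab: "\<And>i. 0 \<le> a i" "\<And>i. a i \<le> b i" "\<And>i. b i \<le> 1"
  shows "\<exists>E\<in>sets P. {\<omega>\<in>space P. \<forall>i\<in>I. ends_in i (a i) 0 \<omega> \<and> ends_in i (b i) 1 \<omega>} \<subseteq> E \<and>
    emeasure P E \<le> ennreal (\<Prod>i\<in>I. (b i - a i))"
proof -
  have y: "a i \<in> {0..1}" "b i \<in> {0..1}" for i using ab[of i] by auto
  note [measurable] = X_measurable[OF y(1)] X_measurable[OF y(2)]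
  define f where "f n \<omega> = (\<Prod>i\<in>I. (X i (b i) (real (Suc n)) \<omega> - X i (a i) (real (Suc n)) \<omega>))" for n \<omega>
  have fm [measurable]: "f n \<in> borel_measurable P" for n unfolding f_def by measurable
  have f01: "0 \<le> f n \<omega> \<and> f n \<omega> \<le> 1" if w: "\<omega> \<in> space P" for n \<omega>
  proof -
    have "0 \<le> X i (b i) (real (Suc n)) \<omega> - X i (a i) (real (Suc n)) \<omega>"
      "X i (b i) (real (Suc n)) \<omega> - X i (a i) (real (Suc n)) \<omega> \<le> 1" for i
      using X_mono[OF w ab(1)[of i] ab(2)[of i] ab(3)[of i], of i "real (Suc n)"] X_bounds[OF w y(1), of i i "real (Suc n)"] X_bounds[OF w y(2), of i i "real (Suc n)"]
      by linarith+
    then show ?thesis unfolding f_def by (auto intro!: prod_nonneg prod_le_1)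
  qed
  define h where "h \<omega> = liminf (\<lambda>n. ennreal (f n \<omega>))" for \<omega>
  have [measurable]: "h \<in> borel_measurable P" unfolding h_def by measurable
  define E where "E = {\<omega>\<in>space P. 1 \<le> h \<omega>}"
  have Em [measurable]: "E \<in> sets P" unfolding E_def by measurable
  have "(\<integral>\<^sup>+\<omega>. ennreal (f n \<omega>) \<partial>P) = ennreal (\<Prod>i\<in>I. (b i - a i))" for n
  proof -
    have "(\<integral>\<^sup>+\<omega>. ennreal (f n \<omega>) \<partial>P) = ennreal (expectation (f n))"
      using f01 by (intro nn_integral_eq_integral integrable_bounded_by[of _ 1]) (auto simp: abs_le_iff intro: order_trans)
    also have "expectation (f n) = (\<Prod>i\<in>I. (b i - a i))"
      unfolding f_def by (rule expectation_prod_spread[OF _ y]) simp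
    finally show ?thesis .
  qed
  then have "(\<integral>\<^sup>+\<omega>. h \<omega> \<partial>P) \<le> ennreal (\<Prod>i\<in>I. (b i - a i))"
    unfolding h_def using nn_integral_liminf[of "\<lambda>n \<omega>. ennreal (f n \<omega>)" P] by (simp add: Liminf_const)
  moreover have "emeasure P E = (\<integral>\<^sup>+\<omega>. indicator E \<omega> \<partial>P)" by simp
  moreover have "(\<integral>\<^sup>+\<omega>. indicator E \<omega> \<partial>P) \<le> (\<integral>\<^sup>+\<omega>. h \<omega> \<partial>P)"
    by (intro nn_integral_mono) (auto simp: E_def indicator_def)
  ultimately have "emeasure P E \<le> ennreal (\<Prod>i\<in>I. (b i - a i))" by simp
  moreover have "\<omega> \<in> E"
    if w: "\<omega> \<in> space P" and lim: "\<forall>i\<in>I. ends_in i (a i) 0 \<omega> \<and> ends_in i (b i) 1 \<omega>" for \<omega>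
  proof -
    have s: "filterlim (\<lambda>n. real (Suc n)) at_top sequentially"
      by (rule filterlim_compose[OF filterlim_real_sequentially filterlim_Suc])
    have "(\<lambda>n. f n \<omega>) \<longlonglongrightarrow> (\<Prod>i\<in>I. (1 - 0))"
      unfolding f_def
    proof (intro tendsto_prod tendsto_diff)
      fix i assume "i \<in> I"
      then have l: "ends_in i (a i) 0 \<omega>" "ends_in i (b i) 1 \<omega>"
        using lim by auto
      show "(\<lambda>n. X i (b i) (real (Suc n)) \<omega>) \<longlonglongrightarrow> 1" by (rule filterlim_compose[OF l(2) s])
      show "(\<lambda>n. X i (a i) (real (Suc n)) \<omega>) \<longlonglongrightarrow> 0" by (rule filterlim_compose[OF l(1) s])
    qed
    then have "(\<lambda>n. ennreal (f n \<omega>)) \<longlonglongrightarrow> ennreal 1" by (intro tendsto_ennrealI) simp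
    then have "h \<omega> = 1" unfolding h_def by (simp add: lim_imp_Liminf)
    then show ?thesis using w by (simp add: E_def)
  qed
  ultimately show ?thesis using Em by (intro bexI[of _ E]) auto
qed

text \<open>
  The critical points with indices in \<open>I\<close> fall into the projection of a ball of radius \<open>r\<close> with probability at
  most \<open>(2 r) ^ card I\<close>, so a set of dimension less than \<open>card I\<close> is not hit.
\<close>

lemma AE_critical_avoids:
  assumes "hausdorff_dim K < ereal (real (card I))"
  shows "AE \<omega> in P. \<forall>x\<in>K. \<not> (regular \<omega> \<and> (\<forall>i\<in>I. x $ i = critical i \<omega>))"
proof (rule AE_avoids_low_dimension[where C="2 ^ card I", OF assms])
  fix u :: "real ^ 'd" and r :: real assume r: "0 < r"
  \<comment> \<open>Clipping the box to the unit interval is harmless, because 0 and 1 are fixed by the flow.\<close>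
  define a b where "a i = clip (u $ i - r)" and "b i = clip (u $ i + r)" for i
  have ab: "0 \<le> a i" "a i \<le> b i" "b i \<le> 1" "b i - a i \<le> 2 * r" for i
    using r by (auto simp: a_def b_def clip_def)
  obtain E where E: "E \<in> sets P"
    "{\<omega>\<in>space P. \<forall>i\<in>I. ends_in i (a i) 0 \<omega> \<and> ends_in i (b i) 1 \<omega>} \<subseteq> E"
    "emeasure P E \<le> ennreal (\<Prod>i\<in>I. (b i - a i))"
    using separating_box_probability[where a=a and b=b and I=I, OF ab(1-3)] by (elim bexE conjE) (rule that)
  have "(\<Prod>i\<in>I. (b i - a i)) \<le> (\<Prod>i\<in>I. 2 * r)"
    using ab by (intro prod_mono) auto
  then have "emeasure P E \<le> ennreal (2 ^ card I * r ^ card I)"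
    using E(3) by (auto simp: power_mult_distrib intro: order_trans ennreal_leI)
  moreover have "{\<omega>\<in>space P. \<exists>x. infnorm (x - u) < r \<and> regular \<omega> \<and> (\<forall>i\<in>I. x $ i = critical i \<omega>)} \<subseteq> E"
  proof clarify
    fix \<omega> x assume w: "\<omega> \<in> space P" and x: "infnorm (x - u) < r" "\<forall>i\<in>I. x $ i = critical i \<omega>" and reg: "regular \<omega>"
    have "ends_in i (a i) 0 \<omega> \<and> ends_in i (b i) 1 \<omega>" if "i \<in> I" for i
    proof -
      have "\<bar>x $ i - u $ i\<bar> < r" using component_le_infnorm_cart[of "x - u" i] x(1) by simp
      then have c: "u $ i - r < critical i \<omega>" "critical i \<omega> < u $ i + r" using x(2) that by auto
      note cb = critical_bounds[OF w, of i]
      have "ends_in i (a i) 0 \<omega>"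
      proof (cases "a i = 0")
        case True then show ?thesis using X_endpoints[OF w] by simp
      next
        case False
        then have "a i < critical i \<omega>" using c cb by (auto simp: a_def clip_def)
        then show ?thesis by (rule below_critical[OF w ab(1)])
      qed
      moreover have "ends_in i (b i) 1 \<omega>"
      proof (cases "b i = 1")
        case True then show ?thesis using X_endpoints[OF w] by simp
      next
        case False
        then have "critical i \<omega> < b i" using c cb by (auto simp: b_def clip_def)
        then show ?thesis by (rule above_critical[OF reg _ ab(3)])
      qed
      ultimately show ?thesis ..
    qed
    then show "\<omega> \<in> E" using E(2) w by auto
  qed
  ultimately show "\<exists>E\<in>sets P. {\<omega>\<in>space P. \<exists>x. infnorm (x - u) < r \<and> regular \<omega> \<and> (\<forall>i\<in>I. x $ i = critical i \<omega>)} \<subseteq> E \<and>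
      emeasure P E \<le> ennreal (2 ^ card I * r ^ card I)" using E(1) by blast
qed simp

lemma flow_in_cube: "\<omega> \<in> space P \<Longrightarrow> x \<in> unit_cube \<Longrightarrow> \<phi> t \<omega> x \<in> unit_cube"
proof -
  assume w: "\<omega> \<in> space P" and x: "x \<in> unit_cube"
  have "\<phi> t \<omega> x $ i = X i (x $ i) t \<omega>" for i using coordinate_bijection[OF w, of i t] x by blast
  moreover have "x $ i \<in> {0..1}" for i using unit_cubeD[OF x, of i] by simp
  ultimately show ?thesis using X_bounds[OF w] by (simp add: unit_cube_def)
qed

text \<open>
  The midpoint between \<open>x $ i\<close> and the critical point is driven to an endpoint, and by monotonicity it takes
  along every start on its far side. This makes the convergence locally uniform in the start.
\<close>

lemma coordinate_settles:
  assumes reg: "regular \<omega>" and x: "x \<in> unit_cube" "x $ i \<noteq> critical i \<omega>" and \<epsilon>: "0 < \<epsilon>"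
  shows "\<exists>\<delta>>0. \<forall>\<^sub>F t in at_top. \<forall>z\<in>unit_cube. \<bar>z $ i - x $ i\<bar> < \<delta> \<longrightarrow>
    \<phi> t \<omega> z $ i \<le> \<epsilon> \<or> 1 - \<phi> t \<omega> z $ i \<le> \<epsilon>"
proof -
  have w: "\<omega> \<in> space P" using reg by (simp add: regular_def)
  have co: "\<phi> t \<omega> z $ i = X i (z $ i) t \<omega>" if "z \<in> unit_cube" for t z
    using coordinate_bijection[OF w] that by blast
  note cb = critical_bounds[OF w, of i]
  note xb = unit_cubeD[OF x(1), of i]
  show ?thesis
  proof (cases "x $ i < critical i \<omega>")
    case True
    define y where "y = (x $ i + critical i \<omega>) / 2"
    have y: "x $ i < y" "y < critical i \<omega>" "0 \<le> y" "y \<le> 1" using True cb xb by (auto simp: y_def)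
    have "\<forall>\<^sub>F t in at_top. X i y t \<omega> < \<epsilon>" by (rule order_tendstoD(2)[OF below_critical[OF w y(3,2)] \<epsilon>])
    then have "\<forall>\<^sub>F t in at_top. \<forall>z\<in>unit_cube. \<bar>z $ i - x $ i\<bar> < y - x $ i \<longrightarrow>
       \<phi> t \<omega> z $ i \<le> \<epsilon> \<or> 1 - \<phi> t \<omega> z $ i \<le> \<epsilon>"
    proof eventually_elim
      case (elim t)
      show ?case
      proof (intro ballI impI disjI1)
        fix z assume z: "z \<in> unit_cube" "\<bar>z $ i - x $ i\<bar> < y - x $ i"
        then have "X i (z $ i) t \<omega> \<le> X i y t \<omega>" using unit_cubeD[OF z(1), of i] y by (intro X_mono[OF w]) auto
        then show "\<phi> t \<omega> z $ i \<le> \<epsilon>" using elim co[OF z(1)] by simp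
      qed
    qed
    then show ?thesis using y(1) by (intro exI[of _ "y - x $ i"]) auto
  next
    case False
    define y where "y = (x $ i + critical i \<omega>) / 2"
    have y: "y < x $ i" "critical i \<omega> < y" "0 \<le> y" "y \<le> 1" using False x(2) cb xb by (auto simp: y_def)
    have "\<forall>\<^sub>F t in at_top. 1 - \<epsilon> < X i y t \<omega>"
      by (rule order_tendstoD(1)[OF above_critical[OF reg y(2,4)]]) (use \<epsilon> in simp)
    then have "\<forall>\<^sub>F t in at_top. \<forall>z\<in>unit_cube. \<bar>z $ i - x $ i\<bar> < x $ i - y \<longrightarrow>
       \<phi> t \<omega> z $ i \<le> \<epsilon> \<or> 1 - \<phi> t \<omega> z $ i \<le> \<epsilon>"
    proof eventually_elim
      case (elim t)
      show ?case
      proof (intro ballI impI disjI2)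
        fix z assume z: "z \<in> unit_cube" "\<bar>z $ i - x $ i\<bar> < x $ i - y"
        then have "X i y t \<omega> \<le> X i (z $ i) t \<omega>" using unit_cubeD[OF z(1), of i] y by (intro X_mono[OF w]) auto
        then show "1 - \<phi> t \<omega> z $ i \<le> \<epsilon>" using elim co[OF z(1)] by simp
      qed
    qed
    then show ?thesis using y(1) by (intro exI[of _ "x $ i - y"]) auto
  qed
qed

text \<open>
  At least \<open>CARD('d) - m\<close> coordinates of \<open>x\<close> differ from their critical points. All of these settle near
  an endpoint, uniformly over a neighbourhood of \<open>x\<close>, which places the whole neighbourhood near the skeleton.
\<close>

lemma point_settles:
  assumes reg: "regular \<omega>" and x: "x \<in> unit_cube" and m: "m < CARD('d)" and \<epsilon>: "0 < \<epsilon>"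
    and few: "card {i. x $ i = critical i \<omega>} \<le> m"
  shows "\<exists>\<delta>>0. \<forall>\<^sub>F t in at_top. \<forall>z\<in>unit_cube. dist z x < \<delta> \<longrightarrow> point_dist (\<phi> t \<omega> z) (skeleton m) \<le> \<epsilon>"
proof -
  have w: "\<omega> \<in> space P" using reg by (simp add: regular_def)
  define J where "J = {i. x $ i \<noteq> critical i \<omega>}"
  have "J = UNIV - {i. x $ i = critical i \<omega>}" by (auto simp: J_def)
  then have cJ: "CARD('d) - m \<le> card J" using few by (simp add: card_Diff_subset)
  have "\<forall>i\<in>J. \<exists>\<delta>>0. \<forall>\<^sub>F t in at_top. \<forall>z\<in>unit_cube. \<bar>z $ i - x $ i\<bar> < \<delta> \<longrightarrow>
    \<phi> t \<omega> z $ i \<le> \<epsilon> \<or> 1 - \<phi> t \<omega> z $ i \<le> \<epsilon>"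
    using coordinate_settles[OF reg x _ \<epsilon>] by (auto simp: J_def)
  from bchoice[OF this] obtain \<delta> where \<delta>: "\<And>i. i \<in> J \<Longrightarrow> 0 < \<delta> i"
    "\<And>i. i \<in> J \<Longrightarrow> \<forall>\<^sub>F t in at_top. \<forall>z\<in>unit_cube. \<bar>z $ i - x $ i\<bar> < \<delta> i \<longrightarrow>
    \<phi> t \<omega> z $ i \<le> \<epsilon> \<or> 1 - \<phi> t \<omega> z $ i \<le> \<epsilon>" by auto
  have Jne: "J \<noteq> {}" using cJ m by auto
  define d where "d = Min (\<delta> ` J)"
  have d: "0 < d" "\<And>i. i \<in> J \<Longrightarrow> d \<le> \<delta> i" using \<delta>(1) Jne by (auto simp: d_def)
  have "\<forall>\<^sub>F t in at_top. \<forall>i\<in>J. \<forall>z\<in>unit_cube. \<bar>z $ i - x $ i\<bar> < \<delta> i \<longrightarrow>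
    \<phi> t \<omega> z $ i \<le> \<epsilon> \<or> 1 - \<phi> t \<omega> z $ i \<le> \<epsilon>"
    by (intro eventually_ball_finite ballI \<delta>(2)) auto
  then have "\<forall>\<^sub>F t in at_top. \<forall>z\<in>unit_cube. dist z x < d \<longrightarrow> point_dist (\<phi> t \<omega> z) (skeleton m) \<le> \<epsilon>"
  proof eventually_elim
    case (elim t)
    show ?case
    proof (intro ballI impI)
      fix z assume z: "z \<in> unit_cube" "dist z x < d"
      have "\<phi> t \<omega> z $ i \<le> \<epsilon> \<or> 1 - \<phi> t \<omega> z $ i \<le> \<epsilon>" if "i \<in> J" for i
      proof -
        have "\<bar>z $ i - x $ i\<bar> \<le> dist z x" using component_le_norm_cart[of "z - x" i] by (simp add: dist_norm)
        then have "\<bar>z $ i - x $ i\<bar> < \<delta> i" using z(2) d(2)[OF that] by linarith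
        then show ?thesis using elim that z(1) by blast
      qed
      then obtain s where s: "s \<in> skeleton m" "infnorm (\<phi> t \<omega> z - s) \<le> \<epsilon>"
        using point_dist_skeleton_le[OF flow_in_cube[OF w z(1)] less_imp_le[OF \<epsilon>] cJ less_imp_le[OF m]] by blast
      then show "point_dist (\<phi> t \<omega> z) (skeleton m) \<le> \<epsilon>"
        using point_dist_le[OF s(1), of "\<phi> t \<omega> z"] by linarith
    qed
  qed
  then show ?thesis using d(1) by blast
qed

text \<open>
  A point with at most \<open>m\<close> critical coordinates approaches the skeleton together with a whole neighbourhood, and
  finitely many such neighbourhoods cover \<open>K\<close>.
\<close>

lemma skeleton_attracts_path:
  assumes K: "K \<noteq> {}" "K \<subseteq> unit_cube" "compact K" and m: "m < CARD('d)"
    and reg: "regular \<omega>" and few: "\<And>x. x \<in> K \<Longrightarrow> card {i. x $ i = critical i \<omega>} \<le> m"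
  shows "((\<lambda>t. semidist (\<phi> t \<omega> ` K) (skeleton m)) \<longlongrightarrow> 0) at_top"
proof (rule tendstoI)
  fix e :: real assume e: "0 < e"
  have w: "\<omega> \<in> space P" using reg by (simp add: regular_def)
  have sub: "\<phi> t \<omega> ` K \<subseteq> unit_cube" "\<phi> t \<omega> ` K \<noteq> {}" for t
    by (intro image_subsetI flow_in_cube[OF w] subsetD[OF K(2)]) (simp_all add: K(1))
  note sk = skeleton_subset_cube skeleton_nonempty[OF less_imp_le[OF m]]
  have e2: "0 < e / 2" using e by simp
  have "\<forall>x\<in>K. \<exists>\<delta>>0. \<forall>\<^sub>F t in at_top. \<forall>z\<in>unit_cube. dist z x < \<delta> \<longrightarrow> point_dist (\<phi> t \<omega> z) (skeleton m) \<le> e / 2"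
    by (intro ballI point_settles[OF reg subsetD[OF K(2)] m e2 few])
  from bchoice[OF this] obtain \<delta> where
    \<delta>: "\<forall>x\<in>K. 0 < \<delta> x \<and> (\<forall>\<^sub>F t in at_top. \<forall>z\<in>unit_cube. dist z x < \<delta> x \<longrightarrow> point_dist (\<phi> t \<omega> z) (skeleton m) \<le> e / 2)" ..
  have cover: "K \<subseteq> (\<Union>x\<in>K. ball x (\<delta> x))"
  proof
    fix x assume x: "x \<in> K"
    then have "x \<in> ball x (\<delta> x)" using \<delta> by simp
    with x show "x \<in> (\<Union>x\<in>K. ball x (\<delta> x))" by (rule UN_I)
  qed
  obtain D where D: "D \<subseteq> K" "finite D" "K \<subseteq> (\<Union>x\<in>D. ball x (\<delta> x))"
    by (rule compactE_image[OF K(3) open_ball cover])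
  have "\<forall>\<^sub>F t in at_top. \<forall>x\<in>D. \<forall>z\<in>unit_cube. dist z x < \<delta> x \<longrightarrow> point_dist (\<phi> t \<omega> z) (skeleton m) \<le> e / 2"
  proof (rule eventually_ball_finite[OF D(2)], rule ballI)
    fix x assume "x \<in> D"
    with D(1) have "x \<in> K" by (rule subsetD)
    then show "\<forall>\<^sub>F t in at_top. \<forall>z\<in>unit_cube. dist z x < \<delta> x \<longrightarrow> point_dist (\<phi> t \<omega> z) (skeleton m) \<le> e / 2"
      by (rule conjunct2[OF bspec[OF \<delta>]])
  qed
  then show "\<forall>\<^sub>F t in at_top. dist (semidist (\<phi> t \<omega> ` K) (skeleton m)) 0 < e"
  proof eventually_elim
    case (elim t)
    have "point_dist (\<phi> t \<omega> z) (skeleton m) \<le> e / 2" if "z \<in> K" for z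
    proof -
      have "z \<in> (\<Union>x\<in>D. ball x (\<delta> x))" using D(3) that by (rule subsetD)
      then obtain x where x: "x \<in> D" "dist z x < \<delta> x" by (auto simp: dist_commute)
      have "z \<in> unit_cube" using K(2) that by (rule subsetD)
      from mp[OF bspec[OF bspec[OF elim x(1)] this] x(2)] show ?thesis .
    qed
    then have "semidist (\<phi> t \<omega> ` K) (skeleton m) \<le> e / 2"
      unfolding semidist_le_iff[OF sub(1) sk(1) sub(2) sk(2)] by blast
    moreover have "0 \<le> semidist (\<phi> t \<omega> ` K) (skeleton m)"
      by (rule semidist_nonneg[OF sub(1) sk(1) sub(2) sk(2)])
    ultimately show ?case using e by (simp add: dist_real_def)
  qed
qed

lemma skeleton_attracts:
  assumes K: "K \<noteq> {}" "K \<subseteq> unit_cube" "compact K" and dim: "hausdorff_dim K < ereal (real (m + 1))"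
    and m: "m < CARD('d)"
  shows "AE \<omega> in P. ((\<lambda>t. semidist (\<phi> t \<omega> ` K) (skeleton m)) \<longlongrightarrow> 0) at_top"
proof -
  define avoids where "avoids I \<omega> \<longleftrightarrow> (\<forall>x\<in>K. \<not> (regular \<omega> \<and> (\<forall>i\<in>I. x $ i = critical i \<omega>)))" for I \<omega>
  have one: "AE \<omega> in P. avoids I \<omega>" if "I \<in> {I. card I = m + 1}" for I
  proof -
    have "card I = m + 1" using that by blast
    then have "hausdorff_dim K < ereal (real (card I))" using dim by (simp only:)
    then show ?thesis unfolding avoids_def by (rule AE_critical_avoids)
  qed
  have "finite {I :: 'd set. card I = m + 1}" by (rule finite)
  from AE_finite_allI[OF this one] have "AE \<omega> in P. \<forall>I\<in>{I. card I = m + 1}. avoids I \<omega>" .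
  with AE_regular show ?thesis
  proof eventually_elim
    case (elim \<omega>)
    show ?case
    proof (rule skeleton_attracts_path[OF K m elim(1)])
      fix x assume x: "x \<in> K"
      show "card {i. x $ i = critical i \<omega>} \<le> m"
      proof (rule ccontr)
        assume "\<not> card {i. x $ i = critical i \<omega>} \<le> m"
        then have "m + 1 \<le> card {i. x $ i = critical i \<omega>}" by simp
        then obtain I where I: "I \<subseteq> {i. x $ i = critical i \<omega>}" "card I = m + 1" by (rule obtain_subset_with_card_n)
        then have "avoids I \<omega>" using elim(2) by blast
        then show False using I(1) x elim(1) unfolding avoids_def by blast
      qed
    qed
  qed
qed

lemma flow_face: "\<omega> \<in> space P \<Longrightarrow> range \<alpha> \<subseteq> {-1,0,1} \<Longrightarrow> \<phi> t \<omega> ` face \<alpha> = face \<alpha>"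
  using coordinate_bijection by (intro coordinatewise_bijection_face[where f="\<lambda>i y. X i y t \<omega>"]) auto

lemma flow_skeleton:
  assumes w: "\<omega> \<in> space P" shows "\<phi> t \<omega> ` skeleton m = skeleton m"
proof -
  have "\<phi> t \<omega> ` face \<alpha> = face \<alpha>"
    if "\<alpha> \<in> {\<alpha>. range \<alpha> \<subseteq> {-1, 0, 1} \<and> (\<Sum>i\<in>UNIV. \<bar>\<alpha> i\<bar>) = int CARD('d) - int m}" for \<alpha>
    by (rule flow_face[OF w]) (use that in blast)
  then show ?thesis unfolding skeleton_eq image_UN by (rule SUP_cong[OF refl])
qed

end

section \<open>The skeleton as a minimal attractor\<close>

lemma exceeds_on_dense_subset:
  fixes g :: "'a::euclidean_space \<Rightarrow> real"
  assumes "continuous_on K g" "D \<subseteq> K" "K \<subseteq> closure D"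
  shows "(\<exists>x\<in>K. \<epsilon> < g x) \<longleftrightarrow> (\<exists>x\<in>D. \<epsilon> < g x)"
proof
  assume "\<exists>x\<in>K. \<epsilon> < g x"
  then obtain x where x: "x \<in> K" "\<epsilon> < g x" by auto
  obtain \<delta> where \<delta>: "0 < \<delta>" "\<And>z. z \<in> K \<Longrightarrow> dist z x < \<delta> \<Longrightarrow> dist (g z) (g x) < g x - \<epsilon>"
    using assms(1) x unfolding continuous_on_iff by (metis diff_gt_0_iff_gt)
  have "x \<in> closure D" using assms(3) x(1) by (rule subsetD)
  then obtain z where z: "z \<in> D" "dist z x < \<delta>" using \<delta>(1) unfolding closure_approachable by blast
  have "dist (g z) (g x) < g x - \<epsilon>" using \<delta>(2) z assms(2) by blast
  then have "\<epsilon> < g z" by (simp add: dist_real_def abs_if split: if_splits)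
  then show "\<exists>x\<in>D. \<epsilon> < g x" using z(1) by blast
qed (use assms(2) in blast)

text \<open>
  The supremum over \<open>K\<close> may be taken over a countable dense subset, by continuity.
\<close>

lemma semidist_gt_measurable:
  fixes f :: "'w \<Rightarrow> real ^ 'd::finite \<Rightarrow> real ^ 'd" and B :: "'w \<Rightarrow> (real ^ 'd) set"
  assumes K: "K \<noteq> {}"
    and f: "\<And>\<omega>. \<omega> \<in> space M \<Longrightarrow> continuous_on K (f \<omega>)" "\<And>\<omega>. \<omega> \<in> space M \<Longrightarrow> f \<omega> ` K \<subseteq> unit_cube"
    and B: "\<And>\<omega>. \<omega> \<in> space M \<Longrightarrow> B \<omega> \<subseteq> unit_cube" "\<And>\<omega>. \<omega> \<in> space M \<Longrightarrow> B \<omega> \<noteq> {}"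
    and meas: "\<And>x. x \<in> K \<Longrightarrow> (\<lambda>\<omega>. point_dist (f \<omega> x) (B \<omega>)) \<in> borel_measurable M"
  shows "{\<omega>\<in>space M. semidist (f \<omega> ` K) (B \<omega>) > \<epsilon>} \<in> sets M"
proof -
  obtain D where D: "countable D" "D \<subseteq> K" "K \<subseteq> closure D" using separable by blast
  have "semidist (f \<omega> ` K) (B \<omega>) > \<epsilon> \<longleftrightarrow> (\<exists>x\<in>D. \<epsilon> < point_dist (f \<omega> x) (B \<omega>))" if w: "\<omega> \<in> space M" for \<omega>
  proof -
    have ne: "f \<omega> ` K \<noteq> {}" using K by simp
    have "semidist (f \<omega> ` K) (B \<omega>) > \<epsilon> \<longleftrightarrow> (\<exists>x\<in>K. \<epsilon> < point_dist (f \<omega> x) (B \<omega>))"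
      using semidist_le_iff[OF f(2)[OF w] B(1)[OF w] ne B(2)[OF w], of \<epsilon>] by (auto simp: not_le[symmetric])
    also have "\<dots> \<longleftrightarrow> (\<exists>x\<in>D. \<epsilon> < point_dist (f \<omega> x) (B \<omega>))"
    proof (rule exceeds_on_dense_subset[OF _ D(2,3)])
      show "continuous_on K (\<lambda>x. point_dist (f \<omega> x) (B \<omega>))"
        by (rule continuous_on_compose2[OF continuous_point_dist[OF B(2)[OF w], of UNIV] f(1)[OF w]]) simp
    qed
    finally show ?thesis .
  qed
  then have "{\<omega>\<in>space M. semidist (f \<omega> ` K) (B \<omega>) > \<epsilon>} = (\<Union>x\<in>D. {\<omega>\<in>space M. \<epsilon> < point_dist (f \<omega> x) (B \<omega>)})"
    by auto
  also have "\<dots> \<in> sets M"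
  proof (rule sets.countable_UN'[OF D(1)], rule image_subsetI)
    fix x assume "x \<in> D"
    then have [measurable]: "(\<lambda>\<omega>. point_dist (f \<omega> x) (B \<omega>)) \<in> borel_measurable M" using meas D(2) by blast
    show "{\<omega>\<in>space M. \<epsilon> < point_dist (f \<omega> x) (B \<omega>)} \<in> sets M" by measurable
  qed
  finally show ?thesis .
qed

text \<open>
  Almost sure convergence implies convergence in probability; it is enough to check the latter along sequences of
  times, where dominated convergence applies.
\<close>

lemma (in prob_space) AE_tendsto_imp_outer_measure_tendsto:
  fixes Y :: "real \<Rightarrow> 'a \<Rightarrow> real"
  assumes meas: "\<And>t. {\<omega>\<in>space M. Y t \<omega> > \<epsilon>} \<in> sets M"
    and lim: "AE \<omega> in M. ((\<lambda>t. Y t \<omega>) \<longlongrightarrow> 0) at_top" and \<epsilon>: "0 < \<epsilon>"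
  shows "((\<lambda>t. outer_measure_of M {\<omega>\<in>space M. Y t \<omega> > \<epsilon>}) \<longlongrightarrow> 0) at_top"
proof (rule tendsto_at_topI_sequentially)
  fix s :: "nat \<Rightarrow> real" assume s: "filterlim s at_top sequentially"
  define A where "A n = {\<omega>\<in>space M. Y (s n) \<omega> > \<epsilon>}" for n
  have Am [measurable]: "A n \<in> sets M" for n unfolding A_def by (rule meas)
  have "(\<lambda>n. expectation (indicator (A n))) \<longlonglongrightarrow> expectation (\<lambda>_. 0 :: real)"
  proof (rule integral_dominated_convergence[where w="\<lambda>_. 1"])
    show "AE \<omega> in M. (\<lambda>n. indicator (A n) \<omega> :: real) \<longlonglongrightarrow> 0"
      using lim
    proof eventually_elim
      case (elim \<omega>)
      have "(\<lambda>n. Y (s n) \<omega>) \<longlonglongrightarrow> 0" by (rule filterlim_compose[OF elim s])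
      then have "\<forall>\<^sub>F n in sequentially. Y (s n) \<omega> < \<epsilon>" using \<epsilon> by (rule order_tendstoD(2))
      then have "\<forall>\<^sub>F n in sequentially. indicator (A n) \<omega> = (0::real)"
        by eventually_elim (simp add: A_def)
      then show ?case by (rule tendsto_eventually)
    qed
  qed (auto simp: indicator_def)
  then have "(\<lambda>n. prob (A n)) \<longlonglongrightarrow> 0" by simp
  then have "(\<lambda>n. ennreal (prob (A n))) \<longlonglongrightarrow> ennreal 0" by (rule tendsto_ennrealI)
  then show "(\<lambda>n. outer_measure_of M {\<omega>\<in>space M. Y (s n) \<omega> > \<epsilon>}) \<longlonglongrightarrow> 0"
    unfolding A_def[symmetric] by (simp add: outer_measure_of_eq[OF Am] emeasure_eq_measure)
qed

context logistic_flow
begin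

lemma flow_point_measurable:
  assumes x: "x \<in> unit_cube" shows "(\<lambda>\<omega>. \<phi> t \<omega> x) \<in> borel_measurable P"
proof -
  have m: "(\<lambda>(t, \<omega>, x). \<phi> t \<omega> x) \<in> (borel \<Otimes>\<^sub>M (P \<Otimes>\<^sub>M restrict_space borel unit_cube)) \<rightarrow>\<^sub>M restrict_space borel unit_cube"
    using rds by (simp add: random_dynamical_system_def)
  have c: "x \<in> space (restrict_space borel unit_cube)" using x by (simp add: space_restrict_space)
  have "(\<lambda>\<omega>. (t, \<omega>, x)) \<in> P \<rightarrow>\<^sub>M (borel \<Otimes>\<^sub>M (P \<Otimes>\<^sub>M restrict_space borel unit_cube))"
    using measurable_const[OF c, of P] by measurable
  from measurable_compose[OF this m]
  have "(\<lambda>\<omega>. \<phi> t \<omega> x) \<in> P \<rightarrow>\<^sub>M restrict_space borel unit_cube" by simp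
  then show ?thesis by (rule measurable_restrict_space2_iff[THEN iffD1, THEN conjunct1])
qed

lemma flow_continuous_in_space:
  assumes "\<omega> \<in> space P" shows "continuous_on unit_cube (\<phi> t \<omega>)"
proof -
  have "continuous_on (UNIV \<times> unit_cube) (\<lambda>(t, x). \<phi> t \<omega> x)"
    using flow assms by (simp add: sde_flow_def)
  then have "continuous_on unit_cube (\<lambda>x. (\<lambda>(t, x). \<phi> t \<omega> x) (t, x))"
    by (rule continuous_on_compose2) (auto intro!: continuous_intros)
  then show ?thesis by simp
qed

lemma shift_measurable: "wiener_shift t \<in> P \<rightarrow>\<^sub>M P"
  and distr_shift: "distr P P (wiener_shift t) = P"
proof -
  have mds: "metric_dynamical_system P wiener_shift" using rds by (simp add: random_dynamical_system_def)
  then have "(\<lambda>(t, \<omega>). wiener_shift t \<omega>) \<in> (borel \<Otimes>\<^sub>M P) \<rightarrow>\<^sub>M P" by (simp add: metric_dynamical_system_def)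
  moreover have "(\<lambda>\<omega>. (t, \<omega>)) \<in> P \<rightarrow>\<^sub>M (borel \<Otimes>\<^sub>M P)" by measurable
  ultimately have "(\<lambda>\<omega>. (\<lambda>(t, \<omega>). wiener_shift t \<omega>) (t, \<omega>)) \<in> P \<rightarrow>\<^sub>M P" by (rule measurable_compose[rotated])
  then show "wiener_shift t \<in> P \<rightarrow>\<^sub>M P" by simp
  show "distr P P (wiener_shift t) = P" using mds by (simp add: metric_dynamical_system_def)
qed

lemma skeleton_random_set:
  assumes "m < CARD('d)" shows "compact_random_set P (unit_cube :: (real ^ 'd) set) (\<lambda>_. skeleton m)"
  unfolding compact_random_set_def
  using skeleton_subset_cube skeleton_nonempty[OF less_imp_le[OF assms]] compact_skeleton by auto

lemma skeleton_invariant: "strictly_invariant P wiener_shift \<phi> (\<lambda>_. skeleton m)"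
  unfolding strictly_invariant_def by (intro allI AE_I2 flow_skeleton)

lemma skeleton_attracts_weakly:
  assumes K: "K \<noteq> {}" "K \<subseteq> unit_cube" "compact K" and dim: "hausdorff_dim K < ereal (real (m + 1))"
    and m: "m < CARD('d)" and \<epsilon>: "0 < \<epsilon>"
  shows "((\<lambda>t. outer_measure_of P {\<omega>\<in>space P. semidist (\<phi> t \<omega> ` K) (skeleton m) > \<epsilon>}) \<longlongrightarrow> 0) at_top"
proof (rule AE_tendsto_imp_outer_measure_tendsto[OF _ skeleton_attracts[OF K dim m] \<epsilon>])
  note ne = skeleton_nonempty[OF less_imp_le[OF m]]
  fix t
  show "{\<omega>\<in>space P. semidist (\<phi> t \<omega> ` K) (skeleton m) > \<epsilon>} \<in> sets P"
  proof (rule semidist_gt_measurable[OF K(1)])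
    fix x assume "x \<in> K"
    with K(2) have "x \<in> unit_cube" by (rule subsetD)
    then have "(\<lambda>\<omega>. \<phi> t \<omega> x) \<in> borel_measurable P" by (rule flow_point_measurable)
    then show "(\<lambda>\<omega>. point_dist (\<phi> t \<omega> x) (skeleton m)) \<in> borel_measurable P"
      by (rule borel_measurable_continuous_on[OF continuous_point_dist[OF ne]])
  next
    fix \<omega> assume w: "\<omega> \<in> space P"
    show "continuous_on K (\<phi> t \<omega>)" by (rule continuous_on_subset[OF flow_continuous_in_space[OF w] K(2)])
    show "\<phi> t \<omega> ` K \<subseteq> unit_cube" by (intro image_subsetI flow_in_cube[OF w] subsetD[OF K(2)])
  qed (use skeleton_subset_cube ne in auto)
qed

lemma face_distance_measurable:
  fixes B :: "'d path \<Rightarrow> (real ^ 'd) set"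
  assumes B: "compact_random_set P unit_cube B" and \<alpha>: "range \<alpha> \<subseteq> {-1,0,1}"
  shows "{\<omega>\<in>space P. semidist (face \<alpha>) (B \<omega>) > \<epsilon>} \<in> sets P"
proof -
  have "{\<omega>\<in>space P. semidist ((\<lambda>x. x) ` face \<alpha>) (B \<omega>) > \<epsilon>} \<in> sets P"
  proof (rule semidist_gt_measurable[OF face_nonempty[OF \<alpha>]])
    fix x :: "real ^ 'd" assume "x \<in> face \<alpha>"
    with face_subset_cube have "x \<in> unit_cube" by (rule subsetD)
    then show "(\<lambda>\<omega>. point_dist x (B \<omega>)) \<in> borel_measurable P"
      using B unfolding compact_random_set_def by blast
  qed (use B face_subset_cube in \<open>auto simp: compact_random_set_def\<close>)
  then show ?thesis by simp
qed

lemma moving_face_distance: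
  assumes \<alpha>: "range \<alpha> \<subseteq> {-1,0,1}"
  shows "{\<omega>\<in>space P. semidist (\<phi> t \<omega> ` face \<alpha>) (B (wiener_shift t \<omega>)) > \<epsilon>}
    = wiener_shift t -` {\<omega>\<in>space P. semidist (face \<alpha>) (B \<omega>) > \<epsilon>} \<inter> space P"
  using flow_face[OF _ \<alpha>] measurable_space[OF shift_measurable, of _ t] by auto

text \<open>
  The face is invariant under the flow, so the event that it is far from \<open>B (\<vartheta>\<^sub>t \<omega>)\<close> is the preimage under the
  shift of the event that it is far from \<open>B \<omega>\<close>. Its probability is thus constant in \<open>t\<close> and, having limit 0, equal
  to 0.
\<close>

lemma weakly_attracted_face_subset:
  fixes B :: "'d path \<Rightarrow> (real ^ 'd) set"
  assumes B: "compact_random_set P unit_cube B" and \<alpha>: "range \<alpha> \<subseteq> {-1,0,1}"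
    and attr: "\<And>\<epsilon>. 0 < \<epsilon> \<Longrightarrow> ((\<lambda>t. outer_measure_of P
        {\<omega>\<in>space P. semidist (\<phi> t \<omega> ` face \<alpha>) (B (wiener_shift t \<omega>)) > \<epsilon>}) \<longlongrightarrow> 0) at_top"
  shows "AE \<omega> in P. face \<alpha> \<subseteq> B \<omega>"
proof -
  have null: "AE \<omega> in P. semidist (face \<alpha>) (B \<omega>) \<le> \<epsilon>" if \<epsilon>: "0 < \<epsilon>" for \<epsilon>
  proof -
    define E where "E = {\<omega>\<in>space P. semidist (face \<alpha>) (B \<omega>) > \<epsilon>}"
    have E: "E \<in> sets P" unfolding E_def by (rule face_distance_measurable[OF B \<alpha>])
    have "outer_measure_of P {\<omega>\<in>space P. semidist (\<phi> t \<omega> ` face \<alpha>) (B (wiener_shift t \<omega>)) > \<epsilon>} = emeasure P E" for t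
    proof -
      have "outer_measure_of P (wiener_shift t -` E \<inter> space P) = emeasure P (wiener_shift t -` E \<inter> space P)"
        by (rule outer_measure_of_eq) (rule measurable_sets[OF shift_measurable E])
      also have "\<dots> = emeasure (distr P P (wiener_shift t)) E"
        by (rule emeasure_distr[OF shift_measurable E, symmetric])
      finally show ?thesis unfolding moving_face_distance[OF \<alpha>] E_def[symmetric] distr_shift .
    qed
    with attr[OF \<epsilon>] have "((\<lambda>t::real. emeasure P E) \<longlongrightarrow> 0) at_top" by simp
    then have "emeasure P E = 0" by (simp add: tendsto_const_iff)
    then have "E \<in> null_sets P" using E by auto
    then show ?thesis by (rule AE_I') (auto simp: E_def)
  qed
  have "AE \<omega> in P. \<forall>n. semidist (face \<alpha>) (B \<omega>) \<le> 1 / real (Suc n)"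
    unfolding AE_all_countable by (intro allI null) simp
  with AE_space show ?thesis
  proof eventually_elim
    case (elim \<omega>)
    have Bw: "B \<omega> \<subseteq> unit_cube" "B \<omega> \<noteq> {}" "compact (B \<omega>)" using B elim(1) by (auto simp: compact_random_set_def)
    note le = semidist_le_iff[OF face_subset_cube Bw(1) face_nonempty[OF \<alpha>] Bw(2)]
    show "face \<alpha> \<subseteq> B \<omega>"
    proof
      fix x assume x: "x \<in> face \<alpha>"
      have "point_dist x (B \<omega>) \<le> 1 / real (Suc n)" for n using elim(2) x unfolding le by blast
      then have "point_dist x (B \<omega>) \<le> 0"
        using LIMSEQ_le_const[OF LIMSEQ_Suc[OF lim_1_over_n]] by blast
      then show "x \<in> B \<omega>" by (rule point_dist_eq_0_imp_mem[OF Bw(3,2)])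
    qed
  qed
qed

lemma face_in_hausdorff_family:
  assumes \<alpha>: "range \<alpha> \<subseteq> {-1,0,1}" "(\<Sum>i\<in>UNIV. \<bar>\<alpha> i\<bar>) = int CARD('d) - int m"
    and "m \<le> CARD('d)" "real m \<le> \<Delta>"
  shows "(face \<alpha> :: (real ^ 'd) set) \<in> hausdorff_family unit_cube \<Delta>"
proof -
  have "{i. \<alpha> i = 0} = UNIV - {i. \<alpha> i \<noteq> 0}" by auto
  then have "card {i. \<alpha> i = 0} = CARD('d) - card {i. \<alpha> i \<noteq> 0}" by (simp add: card_Diff_subset)
  moreover have "int (card {i. \<alpha> i \<noteq> 0}) = int CARD('d) - int m"
    using sum_abs_sign_vector[OF \<alpha>(1)] \<alpha>(2) by simp
  ultimately have "card {i. \<alpha> i = 0} = m" using assms(3) by linarith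
  then have "hausdorff_dim (face \<alpha> :: (real ^ 'd) set) \<le> ereal (real m)" using hausdorff_dim_face[of \<alpha>] by simp
  also have "\<dots> \<le> ereal \<Delta>" using assms(4) by simp
  finally show ?thesis
    unfolding hausdorff_family_def using face_nonempty[OF \<alpha>(1)] face_subset_cube compact_face by blast
qed

lemma skeleton_subset_if_faces:
  fixes B :: "'d path \<Rightarrow> (real ^ 'd) set"
  assumes "\<And>\<alpha>. range \<alpha> \<subseteq> {-1,0,1} \<Longrightarrow> (\<Sum>i\<in>UNIV. \<bar>\<alpha> i\<bar>) = int CARD('d) - int m \<Longrightarrow> AE \<omega> in P. face \<alpha> \<subseteq> B \<omega>"
  shows "AE \<omega> in P. skeleton m \<subseteq> B \<omega>"
proof -
  define A where "A = {\<alpha> :: 'd \<Rightarrow> int. range \<alpha> \<subseteq> {-1, 0, 1} \<and> (\<Sum>i\<in>UNIV. \<bar>\<alpha> i\<bar>) = int CARD('d) - int m}"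
  have fin: "finite A" unfolding A_def by (rule finite_subset[OF _ finite_sign_vectors]) auto
  have "AE \<omega> in P. \<forall>\<alpha>\<in>A. face \<alpha> \<subseteq> B \<omega>"
    by (rule AE_finite_allI[OF fin]) (auto simp: A_def intro!: assms)
  then show ?thesis by eventually_elim (auto simp: skeleton_eq A_def)
qed

lemma skeleton_minimal_attractor:
  assumes m: "m < CARD('d)" and \<Delta>: "real m \<le> \<Delta>" "\<Delta> < real m + 1"
  shows "minimal_attractor P
           (forward_attractor P wiener_shift unit_cube \<phi> (hausdorff_family unit_cube \<Delta>))
           (\<lambda>_. skeleton m)"
    "minimal_attractor P
           (weak_attractor P wiener_shift unit_cube \<phi> (hausdorff_family unit_cube \<Delta>))
           (\<lambda>_. skeleton m)"
proof -
  have fam: "K \<noteq> {}" "K \<subseteq> unit_cube" "compact K" "hausdorff_dim K < ereal (real (m + 1))"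
    if "K \<in> hausdorff_family unit_cube \<Delta>" for K :: "(real ^ 'd) set"
    using that \<Delta>(2) by (auto simp: hausdorff_family_def intro: le_less_trans)
  note face_fam = face_in_hausdorff_family[OF _ _ less_imp_le[OF m] \<Delta>(1)]
  show "minimal_attractor P
           (forward_attractor P wiener_shift unit_cube \<phi> (hausdorff_family unit_cube \<Delta>)) (\<lambda>_. skeleton m)"
    unfolding minimal_attractor_def
  proof (intro conjI allI impI)
    show "forward_attractor P wiener_shift unit_cube \<phi> (hausdorff_family unit_cube \<Delta>) (\<lambda>_. skeleton m)"
      unfolding forward_attractor_def
      by (intro conjI skeleton_random_set[OF m] skeleton_invariant ballI skeleton_attracts[OF _ _ _ _ m] fam)
  next
    fix B assume B: "forward_attractor P wiener_shift unit_cube \<phi> (hausdorff_family unit_cube \<Delta>) B"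
    show "AE \<omega> in P. skeleton m \<subseteq> B \<omega>"
    proof (rule skeleton_subset_if_faces)
      fix \<alpha> :: "'d \<Rightarrow> int"
      assume \<alpha>: "range \<alpha> \<subseteq> {-1,0,1}" "(\<Sum>i\<in>UNIV. \<bar>\<alpha> i\<bar>) = int CARD('d) - int m"
      have crs: "compact_random_set P unit_cube B"
        and lim: "AE \<omega> in P. ((\<lambda>t. semidist (\<phi> t \<omega> ` face \<alpha>) (B (wiener_shift t \<omega>))) \<longlongrightarrow> 0) at_top"
        using B face_fam[OF \<alpha>] by (auto simp: forward_attractor_def)
      show "AE \<omega> in P. face \<alpha> \<subseteq> B \<omega>"
      proof (rule weakly_attracted_face_subset[OF crs \<alpha>(1)])
        fix \<epsilon> :: real assume \<epsilon>: "0 < \<epsilon>"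
        show "((\<lambda>t. outer_measure_of P
          {\<omega>\<in>space P. semidist (\<phi> t \<omega> ` face \<alpha>) (B (wiener_shift t \<omega>)) > \<epsilon>}) \<longlongrightarrow> 0) at_top"
        proof (rule AE_tendsto_imp_outer_measure_tendsto[OF _ lim \<epsilon>])
          fix t
          show "{\<omega>\<in>space P. semidist (\<phi> t \<omega> ` face \<alpha>) (B (wiener_shift t \<omega>)) > \<epsilon>} \<in> sets P"
            unfolding moving_face_distance[OF \<alpha>(1)]
            by (rule measurable_sets[OF shift_measurable face_distance_measurable[OF crs \<alpha>(1)]])
        qed
      qed
    qed
  qed
  show "minimal_attractor P
           (weak_attractor P wiener_shift unit_cube \<phi> (hausdorff_family unit_cube \<Delta>)) (\<lambda>_. skeleton m)"
    unfolding minimal_attractor_def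
  proof (intro conjI allI impI)
    show "weak_attractor P wiener_shift unit_cube \<phi> (hausdorff_family unit_cube \<Delta>) (\<lambda>_. skeleton m)"
      unfolding weak_attractor_def
      by (intro conjI skeleton_random_set[OF m] skeleton_invariant ballI allI impI
          skeleton_attracts_weakly[OF _ _ _ _ m] fam)
  next
    fix B assume B: "weak_attractor P wiener_shift unit_cube \<phi> (hausdorff_family unit_cube \<Delta>) B"
    show "AE \<omega> in P. skeleton m \<subseteq> B \<omega>"
    proof (rule skeleton_subset_if_faces)
      fix \<alpha> :: "'d \<Rightarrow> int"
      assume \<alpha>: "range \<alpha> \<subseteq> {-1,0,1}" "(\<Sum>i\<in>UNIV. \<bar>\<alpha> i\<bar>) = int CARD('d) - int m"
      show "AE \<omega> in P. face \<alpha> \<subseteq> B \<omega>"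
        using B face_fam[OF \<alpha>] unfolding weak_attractor_def
        by (intro weakly_attracted_face_subset[OF _ \<alpha>(1)]) blast+
    qed
  qed
qed

end

theorem theorem3p1:
  fixes P :: "(real \<Rightarrow> real ^ 'd::finite) measure"
    and \<phi> :: "real \<Rightarrow> (real \<Rightarrow> real ^ 'd) \<Rightarrow> real ^ 'd \<Rightarrow> real ^ 'd"
    and m :: nat and \<Delta> :: real
  assumes "wiener_measure P"
    and "sde_flow P \<phi>"
    and "m \<le> CARD('d) - 1"
    and "real m \<le> \<Delta>" and "\<Delta> < real m + 1"
  shows "minimal_attractor P
           (forward_attractor P wiener_shift unit_cube \<phi> (hausdorff_family unit_cube \<Delta>))
           (\<lambda>_. skeleton m) \<and>
         minimal_attractor P
           (weak_attractor P wiener_shift unit_cube \<phi> (hausdorff_family unit_cube \<Delta>))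
           (\<lambda>_. skeleton m)"
proof -
  interpret logistic_flow P \<phi> by unfold_locales (rule assms(1), rule assms(2))
  have "0 < CARD('d)" by simp
  then have "m < CARD('d)" using assms(3) by linarith
  then show ?thesis using skeleton_minimal_attractor assms(4,5) by blast
qed

end
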